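(* Let $\varepsilon,\delta>0$ be constants and let $u_\pm$ be real numbers with $u_->u_+$ and \[ 0<\frac{\delta(u_--u_+)}{2\varepsilon^2}\le \frac14 . \] Let $\sigma=\frac{u_-+u_+}{2}$ and let $\tilde u$ be a viscous-dispersive shock of the KdV--Burgers equation $u_t+(u^2/2)_x=\varepsilon u_{xx}-\delta u_{xxx}$ connecting $u_-$ and $u_+$ monotonically. Let $u_0$ be initial data with $\|u_0-\tilde u\|_{H^1(\mathbb R)}<+\infty$, and let $u$ be the solution of \[ u_t+\Big(\frac{u^2}{2}\Big)_x=\varepsilon u_{xx}-\delta u_{xxx},\qquad u(0,x)=u_0(x), \] with $u\in\mathcal X_T$ for every $T>0$. Let $X$ be the Lipschitz function determined by $X(0)=0$ and \[ \dot X(t)=-\frac{1}{u_--u_+}\int_{\mathbb R}\big(u(t,x+X(t))-\tilde u(x-\sigma t)\big)\,\tilde u'(x-\sigma t)\,dx . \] Then for every $T>0$, \[ \int_{\mathbb R}\big(u(T,x)-\tilde u(x-\sigma T-X(T))\big)^2dx+C^*\varepsilon\int_0^T\!\!\int_{\mathbb R}\Big(\big(u(t,x)-\tilde u(x-\sigma t-X(t))\big)_x\Big)^2dx\,dt\le\int_{\mathbb R}\big(u_0(x)-\tilde u(x)\big)^2dx, \] where $C^*=2\sqrt2-\frac52$. Moreover, for every $2<p\le\infty$, \[ \|u(t,\cdot)-\tilde u(\cdot-\sigma t-X(t))\|_{L^p(\mathbb R)}\to0\quad\text{as }t\to\infty, \] and $|\dot X(t)|\to0$ as $t\to\infty$.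
   Context: A viscous-dispersive shock connecting $u_-$ and $u_+$ (with $u_->u_+$) is a smooth function $\tilde u:\mathbb R\to\mathbb R$ such that $\tilde u(x-\sigma t)$ solves the equation, i.e. $-\sigma\tilde u'+(\tilde u^2/2)'=\varepsilon\tilde u''-\delta\tilde u'''$, with $\tilde u(\xi)\to u_\pm$ and $\tilde u'(\xi)\to0$ as $\xi\to\pm\infty$, where $\sigma=\frac{u_-+u_+}{2}$ (Rankine--Hugoniot speed). Fix a smooth monotone function $\bar u$ with $\bar u(x)=u_-$ for $x\le-1$ and $\bar u(x)=u_+$ for $x\ge1$. The solution space is $\mathcal X_T=\{u:\mathbb R^+\times\mathbb R\to\mathbb R \mid u-\bar u\in C([0,T];H^1(\mathbb R))\cap L^2(0,T;H^2(\mathbb R))\}$. *)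

theory Defs
  imports "HOL-Analysis.Analysis" "HOL-Probability.Essential_Supremum"
begin

definition smooth_fun :: "(real \<Rightarrow> real) \<Rightarrow> bool" where
  "smooth_fun f \<longleftrightarrow> (\<forall>k x. (deriv ^^ k) f differentiable (at x))"

definition test_fun :: "(real \<Rightarrow> real) \<Rightarrow> bool" where
  "test_fun \<phi> \<longleftrightarrow> smooth_fun \<phi> \<and> (\<exists>R. \<forall>x. R < \<bar>x\<bar> \<longrightarrow> \<phi> x = 0)"

definition loc_integrable :: "(real \<Rightarrow> real) \<Rightarrow> bool" where
  "loc_integrable f \<longleftrightarrow> (\<forall>a b. set_integrable lborel {a..b} f)"

definition weak_deriv :: "(real \<Rightarrow> real) \<Rightarrow> (real \<Rightarrow> real) \<Rightarrow> bool" where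
  "weak_deriv f g \<longleftrightarrow> loc_integrable f \<and> loc_integrable g \<and>
     (\<forall>\<phi>. test_fun \<phi> \<longrightarrow>
        (\<integral>x. f x * deriv \<phi> x \<partial>lborel) = - (\<integral>x. g x * \<phi> x \<partial>lborel))"

definition L2 :: "(real \<Rightarrow> real) \<Rightarrow> bool" where
  "L2 f \<longleftrightarrow> f \<in> borel_measurable lborel \<and> integrable lborel (\<lambda>x. (f x)^2)"

definition H1 :: "(real \<Rightarrow> real) \<Rightarrow> bool" where
  "H1 f \<longleftrightarrow> L2 f \<and> (\<exists>g. weak_deriv f g \<and> L2 g)"

text \<open>Viscous-dispersive shock connecting um and up (with sigma the RH speed).\<close>
definition vd_shock :: "real \<Rightarrow> real \<Rightarrow> real \<Rightarrow> real \<Rightarrow> (real \<Rightarrow> real) \<Rightarrow> bool" where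
  "vd_shock eps delta um up ut \<longleftrightarrow>
     smooth_fun ut \<and>
     (\<forall>x. - ((um + up) / 2) * deriv ut x + ut x * deriv ut x
          = eps * (deriv ^^ 2) ut x - delta * (deriv ^^ 3) ut x) \<and>
     (ut \<longlongrightarrow> um) at_bot \<and> (ut \<longlongrightarrow> up) at_top \<and>
     (deriv ut \<longlongrightarrow> 0) at_bot \<and> (deriv ut \<longlongrightarrow> 0) at_top"

text \<open>The solution space X_T (relative to the reference profile ubar):
  u - ubar in C([0,T];H^1) and in L^2(0,T;H^2).  v = u - ubar, vx, vxx its
  first and second weak x-derivatives.\<close>
definition in_XT :: "real \<Rightarrow> (real \<Rightarrow> real) \<Rightarrow> (real \<Rightarrow> real \<Rightarrow> real) \<Rightarrow> bool" where
  "in_XT T ubar u \<longleftrightarrow> (\<exists>vx vxx :: real \<Rightarrow> real \<Rightarrow> real.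
     (\<lambda>(t, x). u t x - ubar x) \<in> borel_measurable (lborel \<Otimes>\<^sub>M lborel) \<and>
     (\<lambda>(t, x). vx t x) \<in> borel_measurable (lborel \<Otimes>\<^sub>M lborel) \<and>
     (\<lambda>(t, x). vxx t x) \<in> borel_measurable (lborel \<Otimes>\<^sub>M lborel) \<and>
     (\<forall>t\<in>{0..T}. L2 (\<lambda>x. u t x - ubar x) \<and> weak_deriv (\<lambda>x. u t x - ubar x) (vx t) \<and> L2 (vx t)) \<and>
     (\<forall>t\<in>{0..T}. ((\<lambda>s. \<integral>x. (u s x - u t x)^2 + (vx s x - vx t x)^2 \<partial>lborel) \<longlongrightarrow> 0)
                     (at t within {0..T})) \<and>
     (AE t in lborel. t \<in> {0..T} \<longrightarrow> weak_deriv (vx t) (vxx t) \<and> L2 (vxx t)) \<and>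
     (\<integral>\<^sup>+ t. indicator {0..T} t *
        (\<integral>\<^sup>+ x. ennreal ((u t x - ubar x)^2 + (vx t x)^2 + (vxx t x)^2) \<partial>lborel) \<partial>lborel) < \<infinity>)"

text \<open>u solves u_t + (u^2/2)_x = eps u_xx - delta u_xxx with u(0) = u0, in the
  sense of distributions in x and integrated in time.\<close>
definition kdvb_solution :: "real \<Rightarrow> real \<Rightarrow> (real \<Rightarrow> real) \<Rightarrow> (real \<Rightarrow> real \<Rightarrow> real) \<Rightarrow> bool" where
  "kdvb_solution eps delta u0 u \<longleftrightarrow>
     (AE x in lborel. u 0 x = u0 x) \<and>
     (\<forall>\<phi> t. test_fun \<phi> \<and> 0 \<le> t \<longrightarrow>
        (\<integral>x. u t x * \<phi> x \<partial>lborel) - (\<integral>x. u 0 x * \<phi> x \<partial>lborel)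
        = set_lebesgue_integral lborel {0..t} (\<lambda>s.
            \<integral>x. (u s x)^2 / 2 * deriv \<phi> x + eps * u s x * (deriv ^^ 2) \<phi> x
                 + delta * u s x * (deriv ^^ 3) \<phi> x \<partial>lborel))"

end

theory Submission
  imports Defs
begin

text \<open>Write \<open>\<psi> t x = u t x - ut (x - \<sigma> t - X t)\<close>, \<open>A = um - up\<close>, and use the profile \<open>y = (um - ut) / A\<close>, which rises from
  \<open>0\<close> to \<open>1\<close>, as a coordinate with density \<open>q = y'\<close>. The shift moves with the \<open>q\<close>-mean \<open>m\<close> of \<open>\<psi>\<close>, and
  \<open>(1/2) d/dt |\<psi>|\<^sup>2 = (A/2) \<integral> q \<psi>\<^sup>2 - A m\<^sup>2 - eps |\<psi>\<^sub>x|\<^sup>2\<close>, since the dispersive term is skew. A phase plane comparison,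
  which is where the smallness condition enters, gives \<open>q \<ge> (2 A / (5 eps)) y (1 - y)\<close>; the sharp weighted Poincare
  inequality for the weight \<open>y (1 - y)\<close> then bounds the variance part of the first term by \<open>(5/8) eps |\<psi>\<^sub>x|\<^sup>2\<close>. This
  yields the contraction and the time integrability of \<open>m\<^sup>2 + |\<psi>\<^sub>x|\<^sup>2\<close>. Testing with \<open>\<psi>\<^sub>x\<^sub>x\<close> and absorbing gives
  \<open>d/dt |\<psi>\<^sub>x|\<^sup>2 \<le> K (1 + |\<psi>\<^sub>x|\<^sup>2) (m\<^sup>2 + |\<psi>\<^sub>x|\<^sup>2)\<close>, so \<open>|\<psi>\<^sub>x|\<close> tends to \<open>0\<close> by a Gronwall argument, and so do the sup norm, the
  \<open>L\<^sup>p\<close> norms and \<open>m\<close> by interpolation. Both energy estimates are carried out for the mollified \<open>\<psi>\<close>, for which they are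
  classical because mollification commutes with the constant coefficient linear part.\<close>

section \<open>Smooth functions and mollifiers\<close>

text \<open>The solution is only distributional, so the equation cannot be multiplied by
  \<open>psi\<close> directly. Testing with a translated mollifier makes the mollified perturbation
  C1 in t at each fixed x; squaring pointwise and integrating over x then gives an energy identity.
  The quadratic flux does not commute with mollification, but no commutator estimate arises: the
  flux difference \<open>N\<close> is mollified as a whole, and its weak derivative
  \<open>Nx\<close> lies in L2. In the L2 estimate every term converges as the mollifier narrows,
  and the cubic cancellation is carried out in the limit. In the derivative estimate the second
  derivative has no bound uniform in n, so it is absorbed by the dissipation before the limit. Since
  the cubic term vanishes identically, the size of the perturbation is never restricted. The
  variance bound costs 5/4 eps of the available 2 eps; the remaining 3/4 eps exceeds the required
  constant, which is about 0.33 eps. For the final Gronwall argument the growth of the derivative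
  must be bounded by time-integrable quantities; therefore the localised term \<open>ut1\<close> psi
  is measured by a q-weighted moment and not by the merely bounded L2 norm.\<close>

lemma smooth_fun_coinduct:
  assumes "f \<in> C" and "\<And>g. g \<in> C \<Longrightarrow> (\<forall>x. g differentiable (at x)) \<and> deriv g \<in> C"
  shows "smooth_fun f"
proof -
  have "(deriv ^^ k) f \<in> C" for k
    by (induction k) (use assms in auto)
  then show ?thesis unfolding smooth_fun_def using assms(2) by blast
qed

lemma smooth_fun_deriv: "smooth_fun f \<Longrightarrow> smooth_fun (deriv f)"
  unfolding smooth_fun_def by (metis funpow_Suc_right o_apply)

lemma smooth_fun_funpow_deriv: "smooth_fun f \<Longrightarrow> smooth_fun ((deriv ^^ k) f)"
  by (induction k) (auto simp: smooth_fun_deriv)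

lemma smooth_fun_DERIV: "smooth_fun f \<Longrightarrow> (f has_real_derivative deriv f x) (at x)"
  unfolding smooth_fun_def
  by (metis DERIV_deriv_iff_real_differentiable eq_id_iff funpow_0)

lemma smooth_fun_continuous: "smooth_fun f \<Longrightarrow> continuous_on A f"
  by (meson DERIV_isCont continuous_at_imp_continuous_on smooth_fun_DERIV)

lemma smooth_fun_measurable [measurable_dest]: "smooth_fun f \<Longrightarrow> f \<in> borel_measurable borel"
  by (rule borel_measurable_continuous_onI) (rule smooth_fun_continuous)

text \<open>An invariant class for \<open>smooth_fun_coinduct\<close>: it contains a derivative of
  each of its members, so smoothness of products and affine substitutions follows without a Leibniz
  formula for the k-th derivative. Afterwards the class turns out to be exactly the smooth
  functions.\<close>

inductive_set smooth_alg :: "(real \<Rightarrow> real) set" where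
  affine: "smooth_fun f \<Longrightarrow> (\<lambda>x. f (c * x + d)) \<in> smooth_alg"
| const: "(\<lambda>x. c) \<in> smooth_alg"
| add: "f \<in> smooth_alg \<Longrightarrow> g \<in> smooth_alg \<Longrightarrow> (\<lambda>x. f x + g x) \<in> smooth_alg"
| mult: "f \<in> smooth_alg \<Longrightarrow> g \<in> smooth_alg \<Longrightarrow> (\<lambda>x. f x * g x) \<in> smooth_alg"

lemma smooth_alg_DERIV:
  "f \<in> smooth_alg \<Longrightarrow> \<exists>f'\<in>smooth_alg. \<forall>x. (f has_real_derivative f' x) (at x)"
proof (induction rule: smooth_alg.induct)
  case (affine f c d)
  have "(\<lambda>x. c * deriv f (c * x + d)) \<in> smooth_alg"
    using smooth_alg.mult[OF smooth_alg.const smooth_alg.affine[OF smooth_fun_deriv[OF affine]]] .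
  moreover have "((\<lambda>x. f (c * x + d)) has_real_derivative c * deriv f (c * x + d)) (at x)" for x
  proof -
    have "((\<lambda>x. c * x + d) has_real_derivative c) (at x)"
      by (auto intro!: derivative_eq_intros)
    from DERIV_chain'[OF this smooth_fun_DERIV[OF affine]] show ?thesis by (simp add: mult.commute)
  qed
  ultimately show ?case by (intro bexI[of _ "\<lambda>x. c * deriv f (c * x + d)"]) auto
next
  case (const c)
  then show ?case using smooth_alg.const[of 0] by (auto intro!: bexI[of _ "\<lambda>_. 0"])
next
  case (add f g)
  then obtain f' g' where *: "f' \<in> smooth_alg" "g' \<in> smooth_alg"
    "\<And>x. (f has_real_derivative f' x) (at x)" "\<And>x. (g has_real_derivative g' x) (at x)" by blast
  show ?case
    by (rule bexI[OF _ smooth_alg.add[OF *(1,2)]]) (auto intro!: derivative_eq_intros *)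
next
  case (mult f g)
  then obtain f' g' where *: "f' \<in> smooth_alg" "g' \<in> smooth_alg"
    "\<And>x. (f has_real_derivative f' x) (at x)" "\<And>x. (g has_real_derivative g' x) (at x)" by blast
  have "(\<lambda>x. f' x * g x + f x * g' x) \<in> smooth_alg"
    using * mult.hyps by (intro smooth_alg.add smooth_alg.mult)
  then show ?case
    by (rule bexI[rotated]) (auto intro!: derivative_eq_intros * simp: algebra_simps)
qed

lemma smooth_alg_smooth: assumes "f \<in> smooth_alg" shows "smooth_fun f"
proof (rule smooth_fun_coinduct[OF assms])
  fix g assume "g \<in> smooth_alg"
  then obtain g' where g': "g' \<in> smooth_alg" "\<And>x. (g has_real_derivative g' x) (at x)"
    using smooth_alg_DERIV by blast
  then have "deriv g = g'" by (auto intro!: ext DERIV_imp_deriv)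
  then show "(\<forall>x. g differentiable (at x)) \<and> deriv g \<in> smooth_alg"
    using g' real_differentiable_def by blast
qed

lemma smooth_alg_iff: "f \<in> smooth_alg \<longleftrightarrow> smooth_fun f"
  using smooth_alg_smooth smooth_alg.affine[of f 1 0] by auto

lemma smooth_fun_mult: "smooth_fun f \<Longrightarrow> smooth_fun g \<Longrightarrow> smooth_fun (\<lambda>x. f x * g x)"
  and smooth_fun_affine: "smooth_fun f \<Longrightarrow> smooth_fun (\<lambda>x. f (c * x + d))"
  and smooth_fun_const: "smooth_fun (\<lambda>x. c)"
  using smooth_alg.intros by (simp_all add: smooth_alg_iff)

text \<open>The classical flat function exp(-1/x) times a polynomial in 1/x. The polynomial is a
  parameter so that the family is closed under differentiation.\<close>

definition expinv :: "real poly \<Rightarrow> real \<Rightarrow> real" where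
  "expinv p x = (if x > 0 then poly p (1 / x) * exp (- (1 / x)) else 0)"

lemma poly_div_exp_tendsto_0: "((\<lambda>y. poly p y / exp y) \<longlongrightarrow> (0::real)) at_top"
proof -
  have "((\<lambda>y. \<Sum>i\<le>degree p. coeff p i * (y ^ i / exp y)) \<longlongrightarrow> (\<Sum>i\<le>degree p. coeff p i * 0)) at_top"
    by (intro tendsto_intros tendsto_power_div_exp_0)
  then show ?thesis by (simp add: poly_altdef sum_divide_distrib)
qed

text \<open>For x > 0 the chain rule produces the factor 1/x^2 and the difference p - p', both in
  terms of 1/x, hence the new polynomial X^2 (p - p'). At 0 the left quotient vanishes and the right
  one decays because the exponential beats every polynomial.\<close>

lemma DERIV_expinv:
  "(expinv p has_real_derivative expinv (monom 1 2 * (p - pderiv p)) x) (at x)"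
proof -
  consider "x > 0" | "x < 0" | "x = 0" by linarith
  then show ?thesis
  proof cases
    case 1
    have "((\<lambda>x. poly p (1 / x) * exp (- (1 / x))) has_real_derivative
        expinv (monom 1 2 * (p - pderiv p)) x) (at x)"
      using 1
      by (auto intro!: derivative_eq_intros DERIV_chain'[of "\<lambda>x. 1 / x" _ _ _ "poly p"] poly_DERIV
          simp: expinv_def poly_monom power2_eq_square field_simps)
    then show ?thesis
      by (rule has_field_derivative_transform_within_open[where S="{0<..}"])
        (use 1 in \<open>auto simp: expinv_def\<close>)
  next
    case 2
    have "((\<lambda>x. 0) has_real_derivative expinv (monom 1 2 * (p - pderiv p)) x) (at x)"
      using 2 by (auto simp: expinv_def)
    then show ?thesis
      by (rule has_field_derivative_transform_within_open[where S="{..<0}"])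
        (use 2 in \<open>auto simp: expinv_def\<close>)
  next
    case 3
    have l: "((\<lambda>h. expinv p h / h) \<longlongrightarrow> 0) (at_left 0)"
      by (rule tendsto_eventually) (auto simp: eventually_at_filter expinv_def)
    \<comment> \<open>Division by h is absorbed into the polynomial: \<open>pCons 0 p\<close> is X
      p, evaluated at 1/h.\<close>
    have "((\<lambda>h. poly (pCons 0 p) (inverse h) / exp (inverse h)) \<longlongrightarrow> 0) (at_right (0::real))"
      using filterlim_compose[OF poly_div_exp_tendsto_0 filterlim_inverse_at_top_right] .
    then have r: "((\<lambda>h. expinv p h / h) \<longlongrightarrow> 0) (at_right 0)"
      by (rule Lim_transform_eventually)
        (auto simp: eventually_at_filter expinv_def exp_minus field_simps)
    show ?thesis unfolding 3 has_field_derivative_iff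
      using filterlim_split_at[OF l r] by (simp add: expinv_def)
  qed
qed

lemma smooth_fun_expinv: "smooth_fun (expinv p)"
proof (rule smooth_fun_coinduct[of _ "range expinv"])
  fix g assume "g \<in> range expinv"
  then obtain p where g: "g = expinv p" by blast
  have "deriv g = expinv (monom 1 2 * (p - pderiv p))"
    unfolding g by (auto intro!: DERIV_imp_deriv DERIV_expinv)
  then show "(\<forall>x. g differentiable (at x)) \<and> deriv g \<in> range expinv"
    using DERIV_expinv real_differentiable_def unfolding g by blast
qed simp

section \<open>Test functions: closure properties, bounds, reflections\<close>

lemma test_fun_smooth: "test_fun f \<Longrightarrow> smooth_fun f"
  by (simp add: test_fun_def)

lemma test_fun_measurable [measurable_dest]: "test_fun f \<Longrightarrow> f \<in> borel_measurable borel"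
  by (simp add: smooth_fun_measurable test_fun_smooth)

lemma test_fun_DERIV: "test_fun f \<Longrightarrow> (f has_real_derivative deriv f x) (at x)"
  by (simp add: smooth_fun_DERIV test_fun_smooth)

lemma test_fun_support:
  assumes "test_fun f" obtains R where "R > 0" "\<And>x. R < \<bar>x\<bar> \<Longrightarrow> f x = 0"
proof -
  obtain R where "\<And>x. R < \<bar>x\<bar> \<Longrightarrow> f x = 0" using assms unfolding test_fun_def by blast
  then show ?thesis by (intro that[of "max R 1"]) auto
qed

lemma test_fun_deriv: assumes "test_fun f" shows "test_fun (deriv f)"
proof -
  obtain R where R: "\<And>x. R < \<bar>x\<bar> \<Longrightarrow> f x = 0" using test_fun_support[OF assms] by blast
  have "deriv f x = 0" if "R < \<bar>x\<bar>" for x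
  proof (rule DERIV_imp_deriv)
    have "open {x::real. R < \<bar>x\<bar>}" by (intro open_Collect_less continuous_intros)
    then show "(f has_real_derivative 0) (at x)"
      by (rule has_field_derivative_transform_within_open[OF DERIV_const[of 0]]) (use that R in auto)
  qed
  then show ?thesis using assms smooth_fun_deriv unfolding test_fun_def by blast
qed

lemma test_fun_affine: assumes "test_fun f" "c \<noteq> 0" shows "test_fun (\<lambda>x. f (c * x + d))"
proof -
  obtain R where R: "\<And>x. R < \<bar>x\<bar> \<Longrightarrow> f x = 0" using test_fun_support[OF assms(1)] by blast
  have "f (c * x + d) = 0" if "(\<bar>R\<bar> + \<bar>d\<bar>) / \<bar>c\<bar> < \<bar>x\<bar>" for x
  proof (rule R)
    have "\<bar>R\<bar> + \<bar>d\<bar> < \<bar>c * x\<bar>" using that assms(2) by (simp add: field_simps abs_mult)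
    then show "R < \<bar>c * x + d\<bar>" by linarith
  qed
  then show ?thesis using assms smooth_fun_affine unfolding test_fun_def by blast
qed

lemma test_fun_mult: "test_fun f \<Longrightarrow> smooth_fun g \<Longrightarrow> test_fun (\<lambda>x. f x * g x)"
  unfolding test_fun_def using smooth_fun_mult by fastforce

lemma test_fun_cmult: "test_fun f \<Longrightarrow> test_fun (\<lambda>x. c * f x)"
  using test_fun_mult[OF _ smooth_fun_const[of c], of f] by (simp add: mult.commute)

lemma test_fun_bounded: assumes "test_fun f" obtains B where "B > 0" "\<And>x. \<bar>f x\<bar> \<le> B"
proof -
  obtain R where R: "R > 0" "\<And>x. R < \<bar>x\<bar> \<Longrightarrow> f x = 0" using test_fun_support[OF assms] by blast
  have "compact (f ` {-R..R})"
    using assms by (intro compact_continuous_image smooth_fun_continuous test_fun_smooth) auto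
  then obtain B where B: "\<And>x. x \<in> {-R..R} \<Longrightarrow> \<bar>f x\<bar> \<le> B"
    by (meson compact_imp_bounded bounded_real imageI)
  have "\<bar>f x\<bar> \<le> max B 1" for x
    using B[of x] R(2)[of x] by (cases "R < \<bar>x\<bar>") (simp, force simp: abs_le_iff max_def)
  then show ?thesis by (intro that[of "max B 1"]) auto
qed

lemma deriv_reflect:
  assumes "smooth_fun k" shows "deriv (\<lambda>z. k (x - z)) = (\<lambda>z. - deriv k (x - z))"
proof (rule ext, rule DERIV_imp_deriv)
  fix z
  have "((\<lambda>z. x - z) has_real_derivative - 1) (at z)" by (auto intro!: derivative_eq_intros)
  from DERIV_chain'[OF this smooth_fun_DERIV[OF assms]]
  show "((\<lambda>z. k (x - z)) has_real_derivative - deriv k (x - z)) (at z)" by simp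
qed

lemma deriv_uminus_smooth:
  assumes "smooth_fun k" shows "deriv (\<lambda>z. - k z) = (\<lambda>z. - deriv k z)"
  by (rule ext, rule DERIV_imp_deriv) (auto intro!: derivative_eq_intros smooth_fun_DERIV assms)

lemma smooth_fun_reflect: "smooth_fun k \<Longrightarrow> smooth_fun (\<lambda>z. k (x - z))"
  using smooth_fun_affine[of k "-1" x] by (simp add: algebra_simps)

lemma test_fun_reflect: "test_fun k \<Longrightarrow> test_fun (\<lambda>z. k (x - z))"
  using test_fun_affine[of k "-1" x] by (simp add: algebra_simps)

lemma deriv2_reflect:
  assumes "smooth_fun k" shows "(deriv ^^ 2) (\<lambda>z. k (x - z)) = (\<lambda>z. (deriv ^^ 2) k (x - z))"
  using assms
  by (simp add: numeral_2_eq_2 deriv_reflect deriv_uminus_smooth smooth_fun_deriv smooth_fun_reflect)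

lemma deriv3_reflect:
  assumes "smooth_fun k" shows "(deriv ^^ 3) (\<lambda>z. k (x - z)) = (\<lambda>z. - (deriv ^^ 3) k (x - z))"
  using assms deriv2_reflect[OF assms, of x] deriv_reflect[OF smooth_fun_funpow_deriv[OF assms, of 2], of x]
  by (simp add: numeral_3_eq_3 numeral_2_eq_2)

section \<open>Integrability of test functions and the mollifier\<close>

lemma integrable_compact_support:
  fixes f :: "real \<Rightarrow> real"
  assumes "continuous_on UNIV f" "\<And>x. R < \<bar>x\<bar> \<Longrightarrow> f x = 0"
  shows "integrable lborel f"
proof -
  have "integrable lborel (\<lambda>x. indicator {-R..R} x *\<^sub>R f x)"
    using assms(1) by (intro borel_integrable_compact continuous_on_subset[OF assms(1)]) auto
  also have "(\<lambda>x. indicator {-R..R} x *\<^sub>R f x) = f"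
  proof
    show "indicator {-R..R} x *\<^sub>R f x = f x" for x
      using assms(2)[of x] by (cases "R < \<bar>x\<bar>") (auto simp: indicator_def)
  qed
  finally show ?thesis .
qed

lemma test_fun_integrable: "test_fun f \<Longrightarrow> integrable lborel f"
  using test_fun_support[of f] integrable_compact_support[of f] smooth_fun_continuous[OF test_fun_smooth]
  by metis

lemma test_fun_integral_abs: "test_fun f \<Longrightarrow> integrable lborel (\<lambda>x. \<bar>f x\<bar>)"
  using test_fun_integrable by auto

lemma ex_unit_bump:
  "\<exists>r. test_fun r \<and> (\<forall>x. r x \<ge> 0) \<and> (\<forall>x. 1 \<le> \<bar>x\<bar> \<longrightarrow> r x = 0) \<and> integral\<^sup>L lborel r = 1"
proof -
  \<comment> \<open>With the arguments x + 1 and 1 - x the product of the two flat functions is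
    positive exactly on (-1,1). The shape c * x + d is the one \<open>smooth_fun_affine\<close>
    expects.\<close>
  define b where "b = (\<lambda>x. expinv 1 (1 * x + 1) * expinv 1 (-1 * x + 1))"
  have b0: "b x = 0" if "1 \<le> \<bar>x\<bar>" for x using that by (auto simp: b_def expinv_def)
  have sb: "smooth_fun b" unfolding b_def by (intro smooth_fun_mult smooth_fun_affine smooth_fun_expinv)
  have tb: "test_fun b" using sb b0 unfolding test_fun_def by (auto intro!: exI[of _ 1])
  have nn: "b x \<ge> 0" for x by (auto simp: b_def expinv_def)
  have "integral\<^sup>L lborel b > 0"
  proof -
    \<comment> \<open>The positive minimum on the middle half bounds the integral from below, so
      that b can be normalised.\<close>
    have "continuous_on {-1/2..1/2} b" "\<And>x. x \<in> {-1/2..1/2} \<Longrightarrow> b x > 0"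
      using sb smooth_fun_continuous by (auto simp: b_def expinv_def)
    moreover have "compact {-1/2..1/2::real}" "{-1/2..1/2::real} \<noteq> {}" by auto
    ultimately obtain m where m: "m \<in> {-1/2..1/2}" "\<And>x. x \<in> {-1/2..1/2} \<Longrightarrow> b m \<le> b x" "b m > 0"
      by (metis continuous_attains_inf)
    have "b m * measure lborel {-1/2..1/2::real} = (LBINT x. b m * indicator {-1/2..1/2} (x::real))" by simp
    also have "\<dots> \<le> integral\<^sup>L lborel b"
    proof (rule integral_mono)
      show "integrable lborel (\<lambda>x. b m * indicator {-1/2..1/2} (x::real))"
        by (intro integrable_mult_right integrable_real_indicator) auto
    qed (use m nn in \<open>auto simp: indicator_def intro: test_fun_integrable[OF tb]\<close>)
    finally show ?thesis using m(3) by simp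
  qed
  then show ?thesis
    using tb nn b0 by (intro exI[of _ "\<lambda>x. inverse (integral\<^sup>L lborel b) * b x"]) (auto intro: test_fun_cmult)
qed

definition unit_bump :: "real \<Rightarrow> real" where
  "unit_bump = (SOME r. test_fun r \<and> (\<forall>x. r x \<ge> 0) \<and> (\<forall>x. 1 \<le> \<bar>x\<bar> \<longrightarrow> r x = 0) \<and> integral\<^sup>L lborel r = 1)"

lemma unit_bump: "test_fun unit_bump" "unit_bump x \<ge> 0" "1 \<le> \<bar>x\<bar> \<Longrightarrow> unit_bump x = 0"
  "integral\<^sup>L lborel unit_bump = 1"
  using someI_ex[OF ex_unit_bump] unfolding unit_bump_def by auto

text \<open>Indexing by \<open>Suc n\<close> keeps the scale positive, and the support radius 1/(n +
  1) never exceeds 1.\<close>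

definition mollifier :: "nat \<Rightarrow> real \<Rightarrow> real" where
  "mollifier n x = real (Suc n) * unit_bump (real (Suc n) * x)"

lemma mollifier: "test_fun (mollifier n)" "mollifier n x \<ge> 0"
  "1 / real (Suc n) \<le> \<bar>x\<bar> \<Longrightarrow> mollifier n x = 0" "integral\<^sup>L lborel (mollifier n) = 1"
proof -
  show "test_fun (mollifier n)"
    using test_fun_cmult[OF test_fun_affine[OF unit_bump(1), of "real (Suc n)" 0], of "real (Suc n)"]
    unfolding mollifier_def by (simp add: fun_eq_iff)
  show "mollifier n x \<ge> 0" by (simp add: mollifier_def unit_bump(2))
  show "1 / real (Suc n) \<le> \<bar>x\<bar> \<Longrightarrow> mollifier n x = 0"
    unfolding mollifier_def
    by (subst unit_bump(3)) (simp_all add: abs_mult field_simps)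
  show "integral\<^sup>L lborel (mollifier n) = 1"
    using lborel_integral_real_affine[of "real (Suc n)" unit_bump 0]
    unfolding mollifier_def by (simp add: unit_bump(4) del: of_nat_Suc)
qed

section \<open>Square-integrable functions and convolution\<close>

text \<open>The integral of a non-integrable function is 0 by convention, so this is the L2 norm
  only for functions that satisfy \<open>L2\<close>; hence the separate \<open>L2\<close> premises
  throughout.\<close>

definition norm2 :: "(real \<Rightarrow> real) \<Rightarrow> real" where
  "norm2 f = sqrt (LBINT x. (f x)\<^sup>2)"

lemma norm2_nonneg [simp]: "norm2 f \<ge> 0"
  by (simp add: norm2_def)

lemma norm2_zero [simp]: "norm2 (\<lambda>x. 0) = 0"
  by (simp add: norm2_def)

lemma norm2_power2: "(norm2 f)\<^sup>2 = (LBINT x. (f x)\<^sup>2)"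
  by (simp add: norm2_def)

lemma L2_measurable [measurable_dest]: "L2 f \<Longrightarrow> f \<in> borel_measurable borel"
  by (simp add: L2_def)

lemma L2_square_integrable: "L2 f \<Longrightarrow> integrable lborel (\<lambda>x. (f x)\<^sup>2)"
  by (simp add: L2_def)

lemma L2_integrable_mult: assumes "L2 f" "L2 g" shows "integrable lborel (\<lambda>x. f x * g x)"
proof (rule Bochner_Integration.integrable_bound)
  show "integrable lborel (\<lambda>x. (f x)\<^sup>2 + (g x)\<^sup>2)"
    using assms by (auto simp: L2_def)
  show "(\<lambda>x. f x * g x) \<in> borel_measurable lborel" using assms by (auto simp: L2_def)
  have "\<bar>a * b\<bar> \<le> a\<^sup>2 + b\<^sup>2" for a b :: real
    using sum_squares_bound[of "\<bar>a\<bar>" "\<bar>b\<bar>"] mult_nonneg_nonneg[OF abs_ge_zero[of a] abs_ge_zero[of b]]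
    unfolding abs_mult power2_abs by linarith
  then show "AE x in lborel. norm (f x * g x) \<le> norm ((f x)\<^sup>2 + (g x)\<^sup>2)" by auto
qed

lemma L2_bound: assumes "L2 g" "f \<in> borel_measurable borel" "\<And>x. \<bar>f x\<bar> \<le> \<bar>g x\<bar>" shows "L2 f"
  unfolding L2_def
proof
  show "integrable lborel (\<lambda>x. (f x)\<^sup>2)"
    by (rule Bochner_Integration.integrable_bound[OF L2_square_integrable[OF assms(1)]])
      (use assms in \<open>auto simp: abs_le_square_iff\<close>)
qed (use assms in auto)

lemma L2_AE_cong: assumes "L2 f" "g \<in> borel_measurable borel" "AE x in lborel. f x = g x" shows "L2 g"
  unfolding L2_def
proof
  show "integrable lborel (\<lambda>x. (g x)\<^sup>2)"
    using assms by (subst integrable_cong_AE[where g="\<lambda>x. (f x)\<^sup>2"]) (auto simp: L2_def)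
qed (use assms in auto)

lemma L2_cmult: "L2 f \<Longrightarrow> L2 (\<lambda>x. c * f x)"
  by (auto simp: L2_def power_mult_distrib)

lemma L2_uminus: "L2 f \<Longrightarrow> L2 (\<lambda>x. - f x)"
  by (auto simp: L2_def)

lemma L2_mult_bounded:
  assumes "L2 f" "b \<in> borel_measurable borel" "\<And>x. \<bar>b x\<bar> \<le> B" shows "L2 (\<lambda>x. b x * f x)"
proof (rule L2_bound[OF L2_cmult[OF assms(1), of B]])
  show "\<bar>b x * f x\<bar> \<le> \<bar>B * f x\<bar>" for x
    using assms(3)[of x] by (auto simp: abs_mult intro!: mult_right_mono)
qed (use assms in auto)

lemma L2_add: assumes "L2 f" "L2 g" shows "L2 (\<lambda>x. f x + g x)"
  unfolding L2_def
proof
  show "integrable lborel (\<lambda>x. (f x + g x)\<^sup>2)"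
    using assms L2_integrable_mult[OF assms] by (auto simp: L2_def power2_sum mult.assoc)
qed (use assms in \<open>auto simp: L2_def\<close>)

lemma L2_diff: "L2 f \<Longrightarrow> L2 g \<Longrightarrow> L2 (\<lambda>x. f x - g x)"
  using L2_add[OF _ L2_uminus, of f g] by simp

lemma L2_indicator: "A \<in> sets borel \<Longrightarrow> emeasure lborel A < \<infinity> \<Longrightarrow> L2 (indicator A)"
  by (auto simp: L2_def power2_eq_square indicator_inter_arith[symmetric])

lemma L2_shift: assumes "L2 f" shows "L2 (\<lambda>x. f (x - c))"
proof -
  have "integrable lborel (\<lambda>x. (f (- c + 1 * x))\<^sup>2)"
    by (rule lborel_integrable_real_affine[OF L2_square_integrable[OF assms]]) simp
  then show ?thesis using assms by (auto simp: L2_def)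
qed

lemma lborel_integral_shift: "(LBINT x. f (x - c)) = (LBINT x. f x)" for f :: "real \<Rightarrow> real"
  using lborel_integral_real_affine[of 1 f "-c"] by simp

lemma norm2_shift: "norm2 (\<lambda>x. f (x - c)) = norm2 f"
  unfolding norm2_def by (subst lborel_integral_shift[of "\<lambda>x. (f x)\<^sup>2"]) simp

text \<open>The squared norm of s f - t g is a nonnegative quadratic form in s and t; the
  discriminant inequality is read off from particular values.\<close>

lemma Cauchy_Schwarz_L2: assumes "L2 f" "L2 g" shows "\<bar>LBINT x. f x * g x\<bar> \<le> norm2 f * norm2 g"
proof -
  define a b c where "a = (LBINT x. (f x)\<^sup>2)" and "b = (LBINT x. f x * g x)"
    and "c = (LBINT x. (g x)\<^sup>2)"
  note int = L2_integrable_mult[OF assms] L2_square_integrable[OF assms(1)] L2_square_integrable[OF assms(2)]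
  have q: "0 \<le> s\<^sup>2 * a - 2 * s * t * b + t\<^sup>2 * c" for s t
  proof -
    have "0 \<le> (LBINT x. (s * f x - t * g x)\<^sup>2)" by simp
    also have "(\<lambda>x. (s * f x - t * g x)\<^sup>2) = (\<lambda>x. s\<^sup>2 * (f x)\<^sup>2 - 2 * s * t * (f x * g x) + t\<^sup>2 * (g x)\<^sup>2)"
      by (auto simp: power2_eq_square algebra_simps)
    also have "(LBINT x. \<dots> x) = s\<^sup>2 * a - 2 * s * t * b + t\<^sup>2 * c"
      using int by (simp add: a_def b_def c_def)
    finally show ?thesis .
  qed
  have nn: "a \<ge> 0" "c \<ge> 0" by (auto simp: a_def c_def)
  have "b\<^sup>2 \<le> a * c"
  proof (cases "c = 0")
    case True
    have "b = 0"
    proof (rule ccontr)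
      assume "b \<noteq> 0"
      \<comment> \<open>For c = 0 the form is affine in t, and this t drives it to -1.\<close>
      have "0 \<le> a - 2 * ((a + 1) / (2 * b)) * b" using q[of 1 "(a + 1) / (2 * b)"] True by simp
      also have "\<dots> = -1" using \<open>b \<noteq> 0\<close> by (simp add: field_simps)
      finally show False by simp
    qed
    then show ?thesis using True by simp
  next
    case False
    \<comment> \<open>The values s = c and t = b turn the form into c (a c - b^2).\<close>
    have "0 \<le> c * (a * c - b\<^sup>2)"
      using q[of c b] by (simp add: power2_eq_square algebra_simps)
    then show ?thesis using nn False by (simp add: zero_le_mult_iff)
  qed
  then have "sqrt (b\<^sup>2) \<le> sqrt (a * c)" by (rule real_sqrt_le_mono)
  then show ?thesis by (simp add: real_sqrt_mult norm2_def a_def b_def c_def)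
qed

lemma norm2_triangle: assumes "L2 f" "L2 g" shows "norm2 (\<lambda>x. f x + g x) \<le> norm2 f + norm2 g"
proof (rule power2_le_imp_le)
  have "(norm2 (\<lambda>x. f x + g x))\<^sup>2 = (LBINT x. (f x)\<^sup>2 + (g x)\<^sup>2 + 2 * (f x * g x))"
    unfolding norm2_power2 by (simp add: power2_sum mult.assoc)
  also have "\<dots> = (norm2 f)\<^sup>2 + (norm2 g)\<^sup>2 + 2 * (LBINT x. f x * g x)"
    using assms L2_integrable_mult[OF assms] by (simp add: norm2_power2 L2_square_integrable)
  also have "\<dots> \<le> (norm2 f + norm2 g)\<^sup>2"
    using Cauchy_Schwarz_L2[OF assms] by (simp add: power2_sum)
  finally show "(norm2 (\<lambda>x. f x + g x))\<^sup>2 \<le> (norm2 f + norm2 g)\<^sup>2" .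
qed simp

lemma norm2_cmult: "norm2 (\<lambda>x. c * f x) = \<bar>c\<bar> * norm2 f"
  by (simp add: norm2_def power_mult_distrib real_sqrt_mult)

lemma norm2_uminus: "norm2 (\<lambda>x. - f x) = norm2 f"
  by (simp add: norm2_def)

lemma norm2_commute: "norm2 (\<lambda>x. f x - g x) = norm2 (\<lambda>x. g x - f x)"
  by (simp add: norm2_def power2_commute)

lemma norm2_diff: assumes "L2 f" "L2 g" shows "norm2 (\<lambda>x. f x - g x) \<le> norm2 f + norm2 g"
  using norm2_triangle[OF assms(1) L2_uminus[OF assms(2)]] by (simp add: norm2_uminus)

lemma norm2_triangle_sub: assumes "L2 f" "L2 g" shows "norm2 f \<le> norm2 g + norm2 (\<lambda>x. f x - g x)"
  using norm2_triangle[OF assms(2) L2_diff[OF assms]] by simp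

lemma norm2_diff_trans: assumes "L2 f" "L2 g" "L2 h"
  shows "norm2 (\<lambda>x. f x - h x) \<le> norm2 (\<lambda>x. f x - g x) + norm2 (\<lambda>x. g x - h x)"
  using norm2_triangle[OF L2_diff[OF assms(1,2)] L2_diff[OF assms(2,3)]] by simp

lemma norm2_AE_cong: assumes "f \<in> borel_measurable borel" "g \<in> borel_measurable borel" 
  "AE x in lborel. f x = g x" shows "norm2 f = norm2 g"
  unfolding norm2_def by (rule arg_cong[of _ _ sqrt], rule integral_cong_AE) (use assms in auto)

lemma norm2_mono: assumes "L2 g" "f \<in> borel_measurable borel" "AE x in lborel. \<bar>f x\<bar> \<le> \<bar>g x\<bar>"
  shows "norm2 f \<le> norm2 g"
  unfolding norm2_def
  by (rule real_sqrt_le_mono, rule integral_mono_AE')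
    (use assms in \<open>auto simp: L2_square_integrable abs_le_square_iff\<close>)

lemma norm2_mult_bounded: assumes "L2 f" "b \<in> borel_measurable borel" "AE x in lborel. \<bar>b x\<bar> \<le> B" "B \<ge> 0"
  shows "norm2 (\<lambda>x. b x * f x) \<le> B * norm2 f"
proof -
  have "norm2 (\<lambda>x. b x * f x) \<le> norm2 (\<lambda>x. B * f x)"
    using assms by (intro norm2_mono L2_cmult) (auto simp: abs_mult intro!: mult_right_mono elim!: eventually_mono)
  then show ?thesis using assms(4) by (simp add: norm2_cmult)
qed

lemma norm2_eq_0_AE: assumes "L2 f" "norm2 f = 0" shows "AE x in lborel. f x = 0"
  using assms integral_nonneg_eq_0_iff_AE[OF L2_square_integrable[OF assms(1)]] by (auto simp: norm2_def)

lemma tendsto_norm2: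
  assumes "L2 f" "eventually (\<lambda>i. L2 (F i)) A" "((\<lambda>i. norm2 (\<lambda>x. F i x - f x)) \<longlongrightarrow> 0) A"
  shows "((\<lambda>i. norm2 (F i)) \<longlongrightarrow> norm2 f) A"
proof (rule tendsto_dist_iff[THEN iffD2])
  show "((\<lambda>i. dist (norm2 (F i)) (norm2 f)) \<longlongrightarrow> 0) A"
  proof (rule tendsto_sandwich[OF _ _ tendsto_const assms(3)])
    show "\<forall>\<^sub>F i in A. dist (norm2 (F i)) (norm2 f) \<le> norm2 (\<lambda>x. F i x - f x)"
      using assms(2)
    proof eventually_elim
      case (elim i)
      then show ?case using norm2_triangle_sub[OF elim assms(1)] norm2_triangle_sub[OF assms(1) elim]
        by (simp add: dist_real_def norm2_commute[of f])
    qed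
  qed auto
qed

text \<open>From F G - f g = F (G - g) + (F - f) g, where \<open>norm2 (F i)\<close> stays bounded
  because it converges. Strong convergence of both factors is the mechanism by which bilinear
  integrals pass from mollified to original functions below.\<close>

lemma tendsto_inner_L2:
  assumes "L2 f" "eventually (\<lambda>i. L2 (F i)) A" "((\<lambda>i. norm2 (\<lambda>x. F i x - f x)) \<longlongrightarrow> 0) A"
    and "L2 g" "eventually (\<lambda>i. L2 (G i)) A" "((\<lambda>i. norm2 (\<lambda>x. G i x - g x)) \<longlongrightarrow> 0) A"
  shows "((\<lambda>i. LBINT x. F i x * G i x) \<longlongrightarrow> (LBINT x. f x * g x)) A"
proof (rule tendsto_dist_iff[THEN iffD2])
  show "((\<lambda>i. dist (LBINT x. F i x * G i x) (LBINT x. f x * g x)) \<longlongrightarrow> 0) A"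
  proof (rule tendsto_sandwich[OF _ _ tendsto_const])
    show "((\<lambda>i. norm2 (F i) * norm2 (\<lambda>x. G i x - g x) + norm2 (\<lambda>x. F i x - f x) * norm2 g) \<longlongrightarrow> 0) A"
      using tendsto_add[OF tendsto_mult[OF tendsto_norm2[OF assms(1-3)] assms(6)] tendsto_mult_right[OF assms(3)], of "norm2 g"]
      by (simp add: mult.commute)
    show "\<forall>\<^sub>F i in A. dist (LBINT x. F i x * G i x) (LBINT x. f x * g x)
        \<le> norm2 (F i) * norm2 (\<lambda>x. G i x - g x) + norm2 (\<lambda>x. F i x - f x) * norm2 g"
      using assms(2,5)
    proof eventually_elim
      case (elim i)
      have "(LBINT x. F i x * G i x) - (LBINT x. f x * g x)
          = (LBINT x. F i x * G i x - f x * g x)"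
        using L2_integrable_mult elim assms by (intro Bochner_Integration.integral_diff[symmetric]) auto
      also have "\<dots> = (LBINT x. F i x * (G i x - g x) + (F i x - f x) * g x)"
        by (simp add: algebra_simps)
      also have "\<dots> = (LBINT x. F i x * (G i x - g x)) + (LBINT x. (F i x - f x) * g x)"
        using L2_integrable_mult elim assms L2_diff by (intro Bochner_Integration.integral_add) auto
      finally show ?case
        using Cauchy_Schwarz_L2[OF elim(1) L2_diff[OF elim(2) assms(4)]]
          Cauchy_Schwarz_L2[OF L2_diff[OF elim(1) assms(1)] assms(4)]
        by (simp add: dist_real_def)
    qed
  qed auto
qed

section \<open>Locally integrable functions\<close>

lemma loc_integrable_continuous: "continuous_on UNIV f \<Longrightarrow> loc_integrable f"
  unfolding loc_integrable_def
  by (meson borel_integrable_atLeastAtMost' continuous_on_subset subset_UNIV)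

lemma loc_integrable_measurable:
  assumes "loc_integrable f" shows "f \<in> borel_measurable borel"
proof (rule borel_measurable_LIMSEQ_metric)
  show "(\<lambda>x. indicator {-real n..real n} x *\<^sub>R f x) \<in> borel_measurable borel" for n
  proof -
    have "integrable lborel (\<lambda>x. indicator {-real n..real n} x *\<^sub>R f x)"
      using assms unfolding loc_integrable_def set_integrable_def by blast
    from borel_measurable_integrable[OF this] show ?thesis by simp
  qed
  show "(\<lambda>n. indicator {-real n..real n} x *\<^sub>R f x) \<longlonglongrightarrow> f x" for x
  proof (rule tendsto_eventually)
    obtain N where "\<bar>x\<bar> \<le> real N" using real_arch_simple by blast
    then show "\<forall>\<^sub>F n in sequentially. indicator {-real n..real n} x *\<^sub>R f x = f x"
      by (intro eventually_sequentiallyI[of N]) (auto simp: indicator_def)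
  qed
qed

lemma loc_integrable_mult_compact:
  assumes f: "loc_integrable f" and k: "k \<in> borel_measurable borel" "\<And>x. \<bar>k x\<bar> \<le> B" "\<And>x. R < \<bar>x\<bar> \<Longrightarrow> k x = 0"
  shows "integrable lborel (\<lambda>x. f x * k x)"
proof (rule Bochner_Integration.integrable_bound)
  show "integrable lborel (\<lambda>x. B * (indicator {-R..R} x *\<^sub>R f x))"
    using f unfolding loc_integrable_def set_integrable_def by (intro integrable_mult_right) auto
  show "(\<lambda>x. f x * k x) \<in> borel_measurable lborel"
    using loc_integrable_measurable[OF f] k(1) by simp
  have "\<bar>f x * k x\<bar> \<le> \<bar>B * (indicator {-R..R} x *\<^sub>R f x)\<bar>" for x
  proof (cases "R < \<bar>x\<bar>")
    case False
    then have "x \<in> {-R..R}" by auto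
    then show ?thesis using k(2)[of x] by (simp add: abs_mult mult.commute[of B] mult_left_mono)
  qed (simp add: k(3))
  then show "AE x in lborel. norm (f x * k x) \<le> norm (B * (indicator {-R..R} x *\<^sub>R f x))" by simp
qed

lemma loc_integrable_mult_test:
  assumes "loc_integrable f" "test_fun k" shows "integrable lborel (\<lambda>x. f x * k x)"
  by (rule test_fun_bounded[OF assms(2)], rule test_fun_support[OF assms(2)],
      rule loc_integrable_mult_compact[OF assms(1)]) (use assms(2) in auto)

lemma L2_compact_support:
  assumes "continuous_on UNIV f" "\<And>x. R < \<bar>x\<bar> \<Longrightarrow> f x = 0" shows "L2 f"
  unfolding L2_def
proof
  show "f \<in> borel_measurable lborel" using borel_measurable_continuous_onI[OF assms(1)] by simp
  show "integrable lborel (\<lambda>x. (f x)\<^sup>2)"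
    by (rule integrable_compact_support[where R=R]) (use assms in \<open>auto intro!: continuous_intros\<close>)
qed

lemma L2_test_fun: assumes "test_fun k" shows "L2 k"
  by (rule test_fun_support[OF assms], rule L2_compact_support)
    (auto intro: smooth_fun_continuous test_fun_smooth assms)

lemma L2_loc_integrable: assumes "L2 f" shows "loc_integrable f"
  unfolding loc_integrable_def set_integrable_def
proof (intro allI)
  fix a b :: real
  have "L2 (indicator {a..b})" by (rule L2_indicator) (auto simp: emeasure_lborel_Icc_eq)
  then show "integrable lborel (\<lambda>x. indicator {a..b} x *\<^sub>R f x)"
    using L2_integrable_mult assms by simp
qed

lemma loc_integrable_add: "loc_integrable f \<Longrightarrow> loc_integrable g \<Longrightarrow> loc_integrable (\<lambda>x. f x + g x)"
  and loc_integrable_diff: "loc_integrable f \<Longrightarrow> loc_integrable g \<Longrightarrow> loc_integrable (\<lambda>x. f x - g x)"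
  unfolding loc_integrable_def by (auto intro: set_integral_add set_integral_diff)

section \<open>Convolution with a test function\<close>

definition conv :: "(real \<Rightarrow> real) \<Rightarrow> (real \<Rightarrow> real) \<Rightarrow> real \<Rightarrow> real" where
  "conv f k x = (LBINT z. f z * k (x - z))"

lemma conv_integrable: "loc_integrable f \<Longrightarrow> test_fun k \<Longrightarrow> integrable lborel (\<lambda>z. f z * k (x - z))"
  by (intro loc_integrable_mult_test test_fun_reflect)

lemma conv_diff: "loc_integrable f \<Longrightarrow> loc_integrable g \<Longrightarrow> test_fun k \<Longrightarrow>
    conv (\<lambda>x. f x - g x) k x = conv f k x - conv g k x"
  by (simp add: conv_def left_diff_distrib conv_integrable)

lemma conv_cmult: "conv (\<lambda>x. c * f x) k x = c * conv f k x"
  by (simp add: conv_def mult.assoc)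

lemma conv_shift: "conv (\<lambda>z. f (z - c)) k x = conv f k (x - c)"
  unfolding conv_def by (subst lborel_integral_shift[of "\<lambda>z. f z * k (x - c - z)" c, symmetric]) simp

text \<open>Dominated convergence along an arbitrary null sequence h: the quotients of k are bounded
  by a bound for k' and vanish outside a ball that does not depend on the index, and f is integrable
  on that ball.\<close>

lemma conv_DERIV:
  assumes f: "loc_integrable f" and k: "test_fun k"
  shows "(conv f k has_real_derivative conv f (deriv k) x) (at x)"
  unfolding DERIV_def tendsto_at_iff_sequentially comp_def
proof (intro allI impI)
  fix h :: "nat \<Rightarrow> real" assume h: "\<forall>i. h i \<in> UNIV - {0}" "h \<longlonglongrightarrow> 0"
  obtain H where H: "\<And>i. \<bar>h i\<bar> \<le> H"
    using convergent_imp_Bseq[OF convergentI[OF h(2)]] by (auto simp: Bseq_def)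
  obtain R where R: "R > 0" "\<And>x. R < \<bar>x\<bar> \<Longrightarrow> k x = 0" using test_fun_support[OF k] by blast
  obtain B where B: "B > 0" "\<And>x. \<bar>deriv k x\<bar> \<le> B" using test_fun_bounded[OF test_fun_deriv[OF k]] by blast
  have [measurable]: "f \<in> borel_measurable borel" by (rule loc_integrable_measurable[OF f])
  have [measurable]: "k \<in> borel_measurable borel" "deriv k \<in> borel_measurable borel"
    using k by (auto intro: test_fun_measurable test_fun_deriv)
  let ?q = "\<lambda>i z. (k (x + h i - z) - k (x - z)) / h i"
  have lip: "\<bar>k a - k b\<bar> \<le> B * \<bar>a - b\<bar>" for a b
    using field_differentiable_bound[of UNIV k "deriv k" B a b] test_fun_DERIV[OF k] B
    by (auto intro: has_field_derivative_at_within)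
  have qb: "\<bar>?q i z\<bar> \<le> B" for i z
    using lip[of "x + h i - z" "x - z"] h(1) by (simp add: field_simps)
  have q0: "?q i z = 0" if "\<bar>x\<bar> + H + R < \<bar>z\<bar>" for i z
    using that H[of i] R(2)[of "x + h i - z"] R(2)[of "x - z"] by auto
  have "(\<lambda>i. LBINT z. f z * ?q i z) \<longlonglongrightarrow> (LBINT z. f z * deriv k (x - z))"
  proof (rule integral_dominated_convergence)
    show "integrable lborel (\<lambda>z. \<bar>f z\<bar> * (B * indicator {-(\<bar>x\<bar> + H + R)..\<bar>x\<bar> + H + R} z))"
    proof (rule loc_integrable_mult_compact[where B=B and R="\<bar>x\<bar> + H + R"])
      show "loc_integrable (\<lambda>z. \<bar>f z\<bar>)"
        using f unfolding loc_integrable_def by (auto intro: set_integrable_abs)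
    qed (use B(1) in \<open>auto simp: indicator_def\<close>)
    show "AE z in lborel. (\<lambda>i. f z * ?q i z) \<longlonglongrightarrow> f z * deriv k (x - z)"
    proof (rule AE_I2, rule tendsto_mult_left)
      fix z
      have "((\<lambda>i. (k (x - z + i) - k (x - z)) / i) \<longlongrightarrow> deriv k (x - z)) (at 0)"
        using test_fun_DERIV[OF k, of "x - z"] unfolding DERIV_def .
      then show "(\<lambda>i. ?q i z) \<longlonglongrightarrow> deriv k (x - z)"
        using h unfolding tendsto_at_iff_sequentially comp_def by (simp add: algebra_simps)
    qed
    show "AE z in lborel. norm (f z * ?q i z) \<le> \<bar>f z\<bar> * (B * indicator {-(\<bar>x\<bar> + H + R)..\<bar>x\<bar> + H + R} z)" for i
    proof (rule AE_I2)
      fix z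
      show "norm (f z * ?q i z) \<le> \<bar>f z\<bar> * (B * indicator {-(\<bar>x\<bar> + H + R)..\<bar>x\<bar> + H + R} z)"
      proof (cases "\<bar>x\<bar> + H + R < \<bar>z\<bar>")
        case True
        then show ?thesis using B(1) by (simp only: q0) simp
      next
        case False
        then have "z \<in> {-(\<bar>x\<bar> + H + R)..\<bar>x\<bar> + H + R}" by auto
        then have "indicator {-(\<bar>x\<bar> + H + R)..\<bar>x\<bar> + H + R} z = (1::real)" by (rule indicator_simps)
        then show ?thesis
          using mult_left_mono[OF qb[of i z] abs_ge_zero[of "f z"]]
          by (simp only: abs_mult real_norm_def mult_1_right)
      qed
    qed
  qed (measurable)
  moreover have "(LBINT z. f z * ?q i z) = (conv f k (x + h i) - conv f k x) / h i" for i
    using conv_integrable[OF f k] unfolding conv_def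
    by (subst Bochner_Integration.integral_diff[symmetric]) (simp_all add: right_diff_distrib)
  ultimately show "(\<lambda>i. (conv f k (x + h i) - conv f k x) / h i) \<longlonglongrightarrow> conv f (deriv k) x"
    using h(1) by (simp add: conv_def[of f "deriv k"])
qed

lemma lborel_integral_reflect: "(LBINT z. f (x - z)) = (LBINT z. f z)" for f :: "real \<Rightarrow> real"
  using lborel_integral_real_affine[of "-1" f x] by simp

lemma L2_nn_integral: "L2 f \<Longrightarrow> (\<integral>\<^sup>+x. ennreal ((f x)\<^sup>2) \<partial>lborel) = ennreal ((norm2 f)\<^sup>2)"
  by (simp add: norm2_power2 nn_integral_eq_integral L2_square_integrable)

lemma L2_nn_integralI:
  assumes "f \<in> borel_measurable borel" "(\<integral>\<^sup>+x. ennreal ((f x)\<^sup>2) \<partial>lborel) \<le> ennreal (C\<^sup>2)" "C \<ge> 0"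
  shows "L2 f" "norm2 f \<le> C"
proof -
  show *: "L2 f" unfolding L2_def
  proof
    show "integrable lborel (\<lambda>x. (f x)\<^sup>2)"
      using assms(1,2) by (intro integrableI_bounded) (auto intro: le_less_trans)
  qed (use assms in simp)
  show "norm2 f \<le> C"
    using assms(2,3) unfolding L2_nn_integral[OF *] by (simp add: abs_le_square_iff[symmetric])
qed

lemma conv_continuous: "loc_integrable f \<Longrightarrow> test_fun k \<Longrightarrow> continuous_on A (conv f k)"
  by (meson DERIV_isCont continuous_at_imp_continuous_on conv_DERIV)

lemma conv_measurable: "loc_integrable f \<Longrightarrow> test_fun k \<Longrightarrow> conv f k \<in> borel_measurable borel"
  by (rule borel_measurable_continuous_onI) (rule conv_continuous)

text \<open>Young's inequality with an integrable kernel. Writing |f k| as (sqrt |k| |f|) (sqrt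
  |k|), Cauchy-Schwarz bounds the square of the convolution pointwise, and Tonelli integrates the
  bound over x.\<close>

lemma
  assumes f: "L2 f" and k: "test_fun k"
  shows L2_conv: "L2 (conv f k)" and norm2_conv: "norm2 (conv f k) \<le> (LBINT x. \<bar>k x\<bar>) * norm2 f"
proof -
  have [measurable]: "f \<in> borel_measurable borel" "k \<in> borel_measurable borel"
    using f k by (auto intro: L2_measurable test_fun_measurable)
  define c where "c = (LBINT x. \<bar>k x\<bar>)"
  have c: "c \<ge> 0" by (simp add: c_def)
  obtain B where B: "B > 0" "\<And>x. \<bar>k x\<bar> \<le> B" using test_fun_bounded[OF k] by blast
  have ki: "integrable lborel (\<lambda>z. \<bar>k (x - z)\<bar>)" for x
    by (intro test_fun_integral_abs test_fun_reflect k)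
  have pt: "(conv f k x)\<^sup>2 \<le> c * (LBINT z. (f z)\<^sup>2 * \<bar>k (x - z)\<bar>)"
    and i2: "integrable lborel (\<lambda>z. (f z)\<^sup>2 * \<bar>k (x - z)\<bar>)" for x
  proof -
    let ?a = "\<lambda>z. sqrt \<bar>k (x - z)\<bar> * \<bar>f z\<bar>" and ?b = "\<lambda>z. sqrt \<bar>k (x - z)\<bar>"
    have a: "L2 ?a"
    proof (rule L2_mult_bounded)
      show "L2 (\<lambda>z. \<bar>f z\<bar>)" by (rule L2_bound[OF f]) auto
      show "\<bar>sqrt \<bar>k (x - z)\<bar>\<bar> \<le> sqrt B" for z using B(2) by simp
    qed measurable
    have b: "L2 ?b" using ki by (auto simp: L2_def)
    have a2: "(\<lambda>z. (?a z)\<^sup>2) = (\<lambda>z. (f z)\<^sup>2 * \<bar>k (x - z)\<bar>)"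
      by (simp add: power_mult_distrib mult.commute)
    show "integrable lborel (\<lambda>z. (f z)\<^sup>2 * \<bar>k (x - z)\<bar>)"
      using L2_square_integrable[OF a] unfolding a2 .
    have "(norm2 ?b)\<^sup>2 = c"
      unfolding norm2_power2 c_def using lborel_integral_reflect[of "\<lambda>z. \<bar>k z\<bar>" x] by simp
    have "\<bar>conv f k x\<bar> \<le> (LBINT z. ?a z * ?b z)"
    proof -
      have "\<bar>conv f k x\<bar> \<le> (LBINT z. \<bar>f z * k (x - z)\<bar>)" unfolding conv_def by (rule integral_abs_bound)
      also have "(\<lambda>z. \<bar>f z * k (x - z)\<bar>) = (\<lambda>z. ?a z * ?b z)"
      proof
        fix z
        have "?a z * ?b z = (sqrt \<bar>k (x - z)\<bar>)\<^sup>2 * \<bar>f z\<bar>" unfolding power2_eq_square by (simp only: mult_ac)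
        then show "\<bar>f z * k (x - z)\<bar> = ?a z * ?b z" by (simp add: abs_mult)
      qed
      finally show ?thesis .
    qed
    also have "\<dots> \<le> norm2 ?a * norm2 ?b" using Cauchy_Schwarz_L2[OF a b] by linarith
    finally have "\<bar>conv f k x\<bar>\<^sup>2 \<le> (norm2 ?a * norm2 ?b)\<^sup>2" by (rule power_mono) simp
    then show "(conv f k x)\<^sup>2 \<le> c * (LBINT z. (f z)\<^sup>2 * \<bar>k (x - z)\<bar>)"
      using \<open>(norm2 ?b)\<^sup>2 = c\<close> by (simp add: power_mult_distrib norm2_power2 a2[unfolded fun_eq_iff] mult.commute del: a2)
  qed
  have nk: "(\<integral>\<^sup>+x. ennreal \<bar>k (x - z)\<bar> \<partial>lborel) = ennreal c" for z
  proof -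
    have "integrable lborel (\<lambda>x. \<bar>k (x - z)\<bar>)"
      using test_fun_integral_abs[OF test_fun_affine[OF k, of 1 "-z"]] by simp
    then show ?thesis
      using lborel_integral_shift[of "\<lambda>x. \<bar>k x\<bar>" z] by (simp add: nn_integral_eq_integral c_def)
  qed
  have "(\<integral>\<^sup>+x. ennreal ((conv f k x)\<^sup>2) \<partial>lborel)
      \<le> (\<integral>\<^sup>+x. ennreal c * (\<integral>\<^sup>+z. ennreal ((f z)\<^sup>2 * \<bar>k (x - z)\<bar>) \<partial>lborel) \<partial>lborel)"
  proof (rule nn_integral_mono)
    fix x
    have "ennreal ((conv f k x)\<^sup>2) \<le> ennreal (c * (LBINT z. (f z)\<^sup>2 * \<bar>k (x - z)\<bar>))"
      using pt by (rule ennreal_leI)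
    also have "\<dots> = ennreal c * (\<integral>\<^sup>+z. ennreal ((f z)\<^sup>2 * \<bar>k (x - z)\<bar>) \<partial>lborel)"
      using c by (subst nn_integral_eq_integral[OF i2]) (auto simp: ennreal_mult)
    finally show "ennreal ((conv f k x)\<^sup>2) \<le> ennreal c * (\<integral>\<^sup>+z. ennreal ((f z)\<^sup>2 * \<bar>k (x - z)\<bar>) \<partial>lborel)" .
  qed
  also have "\<dots> = ennreal c * (\<integral>\<^sup>+x. (\<integral>\<^sup>+z. ennreal ((f z)\<^sup>2 * \<bar>k (x - z)\<bar>) \<partial>lborel) \<partial>lborel)"
    by (rule nn_integral_cmult) measurable
  also have "(\<integral>\<^sup>+x. (\<integral>\<^sup>+z. ennreal ((f z)\<^sup>2 * \<bar>k (x - z)\<bar>) \<partial>lborel) \<partial>lborel)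
      = (\<integral>\<^sup>+z. (\<integral>\<^sup>+x. ennreal ((f z)\<^sup>2 * \<bar>k (x - z)\<bar>) \<partial>lborel) \<partial>lborel)"
    by (rule lborel_pair.Fubini') measurable
  also have "\<dots> = (\<integral>\<^sup>+z. ennreal ((f z)\<^sup>2) * ennreal c \<partial>lborel)"
    by (simp add: ennreal_mult nn_integral_cmult nk)
  also have "\<dots> = ennreal ((norm2 f)\<^sup>2) * ennreal c"
    by (simp add: nn_integral_multc L2_nn_integral[OF f])
  finally have *: "(\<integral>\<^sup>+x. ennreal ((conv f k x)\<^sup>2) \<partial>lborel) \<le> ennreal ((c * norm2 f)\<^sup>2)"
    using c by (simp add: ennreal_mult[symmetric] power2_eq_square algebra_simps)
  show "L2 (conv f k)" "norm2 (conv f k) \<le> (LBINT x. \<bar>k x\<bar>) * norm2 f"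
    using L2_nn_integralI[OF conv_measurable[OF L2_loc_integrable[OF f] k] *] c by (auto simp: c_def)
qed

lemma norm2_conv_mollifier: "L2 f \<Longrightarrow> norm2 (conv f (mollifier n)) \<le> norm2 f"
  using norm2_conv[of f "mollifier n"] by (simp add: mollifier)

section \<open>Density of compactly supported Lipschitz functions\<close>

definition lip_cs :: "(real \<Rightarrow> real) \<Rightarrow> bool" where
  "lip_cs g \<longleftrightarrow> (\<exists>L. \<forall>x y. \<bar>g x - g y\<bar> \<le> L * \<bar>x - y\<bar>) \<and> (\<exists>R. \<forall>x. R < \<bar>x\<bar> \<longrightarrow> g x = 0)"

lemma lip_cs_continuous: assumes "lip_cs g" shows "continuous_on A g"
proof -
  obtain L where L: "\<And>x y. \<bar>g x - g y\<bar> \<le> L * \<bar>x - y\<bar>" using assms by (auto simp: lip_cs_def)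
  have "L \<ge> 0" using L[of 0 1] by simp
  then have "L-lipschitz_on A g" using L by (intro lipschitz_onI) (auto simp: dist_real_def)
  then show ?thesis by (rule lipschitz_on_continuous_on)
qed

lemma lip_cs_measurable: "lip_cs g \<Longrightarrow> g \<in> borel_measurable borel"
  by (rule borel_measurable_continuous_onI) (rule lip_cs_continuous)

lemma lip_cs_integrable: assumes "lip_cs g" shows "integrable lborel g" "L2 g"
proof -
  obtain R where "\<And>x. R < \<bar>x\<bar> \<Longrightarrow> g x = 0" using assms by (auto simp: lip_cs_def)
  then show "integrable lborel g" "L2 g"
    using integrable_compact_support L2_compact_support lip_cs_continuous[OF assms] by blast+
qed

lemma lip_cs_add: assumes "lip_cs f" "lip_cs g" shows "lip_cs (\<lambda>x. f x + g x)"
proof -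
  obtain L R where 1: "\<And>x y. \<bar>f x - f y\<bar> \<le> L * \<bar>x - y\<bar>" "\<And>x. R < \<bar>x\<bar> \<Longrightarrow> f x = 0"
    using assms(1) by (auto simp: lip_cs_def)
  obtain L' R' where 2: "\<And>x y. \<bar>g x - g y\<bar> \<le> L' * \<bar>x - y\<bar>" "\<And>x. R' < \<bar>x\<bar> \<Longrightarrow> g x = 0"
    using assms(2) by (auto simp: lip_cs_def)
  have "\<bar>f x + g x - (f y + g y)\<bar> \<le> (L + L') * \<bar>x - y\<bar>" for x y
    using 1(1)[of x y] 2(1)[of x y] by (simp add: distrib_right)
  moreover have "f x + g x = 0" if "max R R' < \<bar>x\<bar>" for x using that 1(2) 2(2) by simp
  ultimately show ?thesis unfolding lip_cs_def by blast
qed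

lemma lip_cs_cmult: assumes "lip_cs f" shows "lip_cs (\<lambda>x. f x * c)"
proof -
  obtain L R where 1: "\<And>x y. \<bar>f x - f y\<bar> \<le> L * \<bar>x - y\<bar>" "\<And>x. R < \<bar>x\<bar> \<Longrightarrow> f x = 0"
    using assms(1) by (auto simp: lip_cs_def)
  have "\<bar>f x * c - f y * c\<bar> \<le> (L * \<bar>c\<bar>) * \<bar>x - y\<bar>" for x y
    using mult_right_mono[OF 1(1)[of x y] abs_ge_zero[of c]]
    unfolding left_diff_distrib[symmetric] abs_mult by (simp only: mult_ac)
  then show ?thesis unfolding lip_cs_def using 1(2) by fastforce
qed

text \<open>Mollification moves a Lipschitz function by at most its Lipschitz constant times the
  support radius 1/(n + 1), and the error lives on a fixed interval. This explicit rate makes the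
  Lipschitz functions a convenient dense class.\<close>

lemma lip_cs_mollify:
  assumes "lip_cs g" shows "(\<lambda>n. norm2 (\<lambda>x. conv g (mollifier n) x - g x)) \<longlonglongrightarrow> 0"
proof -
  obtain L R where L: "\<And>x y. \<bar>g x - g y\<bar> \<le> L * \<bar>x - y\<bar>" and R: "\<And>x. R < \<bar>x\<bar> \<Longrightarrow> g x = 0"
    using assms by (auto simp: lip_cs_def)
  have L0: "L \<ge> 0" using L[of 0 1] by simp
  have gl: "loc_integrable g" by (rule L2_loc_integrable[OF lip_cs_integrable(2)[OF assms]])
  have b: "\<bar>conv g (mollifier n) x - g x\<bar> \<le> L * (1 / real (Suc n)) * indicator {-(R + 1)..R + 1} x" for n x
  proof (cases "R + 1 < \<bar>x\<bar>")
    case True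
    have "g z * mollifier n (x - z) = 0" for z
    proof (cases "R < \<bar>z\<bar>")
      case False
      have "1 / real (Suc n) \<le> 1" by simp
      then have "1 / real (Suc n) \<le> \<bar>x - z\<bar>" using True False by linarith
      then show ?thesis by (simp only: mollifier(3))
    qed (simp add: R)
    then have "conv g (mollifier n) x = 0" unfolding conv_def by (simp only: Bochner_Integration.integral_zero)
    then show ?thesis using R[of x] True L0 by (auto simp: indicator_def)
  next
    case False
    have m: "integrable lborel (\<lambda>z. mollifier n (x - z))" "(LBINT z. mollifier n (x - z)) = 1"
      using test_fun_integrable[OF test_fun_reflect[OF mollifier(1)]]
        lborel_integral_reflect[of "mollifier n" x] by (auto simp: mollifier(4))
    have i: "integrable lborel (\<lambda>z. g z * mollifier n (x - z))"
      by (rule conv_integrable[OF gl mollifier(1)])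
    have "conv g (mollifier n) x - g x = (LBINT z. g z * mollifier n (x - z)) - (LBINT z. g x * mollifier n (x - z))"
      using m by (simp add: conv_def)
    also have "\<dots> = (LBINT z. (g z - g x) * mollifier n (x - z))"
      using m i by (simp add: left_diff_distrib)
    also have "\<bar>\<dots>\<bar> \<le> (LBINT z. L * (1 / real (Suc n)) * mollifier n (x - z))"
    proof (rule order_trans[OF integral_abs_bound], rule integral_mono)
      show "integrable lborel (\<lambda>z. \<bar>(g z - g x) * mollifier n (x - z)\<bar>)"
        using m i by (auto simp: left_diff_distrib)
      show "integrable lborel (\<lambda>z. L * (1 / real (Suc n)) * mollifier n (x - z))"
        using m by (intro integrable_mult_right) auto
      fix z
      show "\<bar>(g z - g x) * mollifier n (x - z)\<bar> \<le> L * (1 / real (Suc n)) * mollifier n (x - z)"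
      proof (cases "1 / real (Suc n) \<le> \<bar>x - z\<bar>")
        case True
        then show ?thesis by (simp only: mollifier(3) mult_zero_right abs_zero order_refl)
      next
        case False
        have "\<bar>g z - g x\<bar> \<le> L * (1 / real (Suc n))"
          using L[of z x] mult_left_mono[OF _ L0, of "\<bar>z - x\<bar>" "1 / real (Suc n)"] False
          by (simp only: abs_minus_commute) linarith
        then show ?thesis using mollifier(2)[of n "x - z"] mult_right_mono by (simp only: abs_mult) fastforce
      qed
    qed
    also have "\<dots> = L * (1 / real (Suc n))" using m by (simp del: times_divide_eq_right)
    finally show ?thesis using False by (auto simp: indicator_def)
  qed
  let ?I = "indicator {-(R + 1)..R + 1} :: real \<Rightarrow> real"
  have I: "L2 ?I" by (rule L2_indicator) (auto simp: emeasure_lborel_Icc_eq)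
  have "norm2 (\<lambda>x. conv g (mollifier n) x - g x) \<le> L * (1 / real (Suc n)) * norm2 ?I" for n
  proof -
    have "norm2 (\<lambda>x. conv g (mollifier n) x - g x) \<le> norm2 (\<lambda>x. L * (1 / real (Suc n)) * ?I x)"
      using b[of n] L0 conv_measurable[OF gl mollifier(1)] lip_cs_measurable[OF assms]
      by (intro norm2_mono L2_cmult I) (auto intro!: order_trans[OF b] simp del: times_divide_eq_right)
    then show ?thesis using L0 by (simp add: norm2_cmult del: times_divide_eq_right)
  qed
  moreover have "(\<lambda>n. L * (1 / real (Suc n)) * norm2 ?I) \<longlonglongrightarrow> 0"
  proof -
    have "(\<lambda>n. L * (1 / real (Suc n)) * norm2 ?I) \<longlonglongrightarrow> L * 0 * norm2 ?I"
      by (intro tendsto_intros LIMSEQ_Suc[OF lim_1_over_n])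
    then show ?thesis by (simp only: mult_zero_right mult_zero_left)
  qed
  ultimately show ?thesis
    by (rule_tac tendsto_sandwich[OF always_eventually always_eventually tendsto_const]) (simp_all only: norm2_nonneg simp_thms)
qed

text \<open>Membership in the L1-closure of the compactly supported Lipschitz functions, phrased as
  a predicate so that the induction rule for integrable functions applies.\<close>

definition L1_lip_approx :: "(real \<Rightarrow> real) \<Rightarrow> bool" where
  "L1_lip_approx f \<longleftrightarrow> integrable lborel f \<and> (\<forall>e>0. \<exists>g. lip_cs g \<and> (LBINT x. \<bar>f x - g x\<bar>) < e)"

lemma L1_lip_approx_closed:
  assumes f: "integrable lborel f"
    and h: "\<And>e. e > 0 \<Longrightarrow> \<exists>h. L1_lip_approx h \<and> (LBINT x. \<bar>f x - h x\<bar>) < e"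
  shows "L1_lip_approx f"
  unfolding L1_lip_approx_def
proof (intro conjI allI impI f)
  fix e :: real assume "e > 0"
  then obtain h where h1: "L1_lip_approx h" "(LBINT x. \<bar>f x - h x\<bar>) < e / 2" using h[of "e/2"] by auto
  then obtain g where g: "lip_cs g" "(LBINT x. \<bar>h x - g x\<bar>) < e / 2"
    using \<open>e > 0\<close> half_gt_zero unfolding L1_lip_approx_def by blast
  have hi: "integrable lborel h" using h1 by (simp add: L1_lip_approx_def)
  have gi: "integrable lborel g" by (rule lip_cs_integrable[OF g(1)])
  have "(LBINT x. \<bar>f x - g x\<bar>) \<le> (LBINT x. \<bar>f x - h x\<bar> + \<bar>h x - g x\<bar>)"
    using f hi gi by (intro integral_mono) auto
  also have "\<dots> = (LBINT x. \<bar>f x - h x\<bar>) + (LBINT x. \<bar>h x - g x\<bar>)"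
    using f hi gi by (intro Bochner_Integration.integral_add) auto
  finally show "\<exists>g. lip_cs g \<and> (LBINT x. \<bar>f x - g x\<bar>) < e" using h1(2) g by (intro exI[of _ g]) auto
qed

lemma L1_lip_approx_seq:
  assumes f: "integrable lborel f" and s: "\<And>n. L1_lip_approx (s n)"
    and lim: "\<And>x. (\<lambda>n. s n x) \<longlonglongrightarrow> f x" and w: "integrable lborel w" "\<And>n x. \<bar>s n x\<bar> \<le> w x"
  shows "L1_lip_approx f"
proof (rule L1_lip_approx_closed[OF f])
  fix e :: real assume "e > 0"
  have si: "integrable lborel (s n)" for n using s by (simp add: L1_lip_approx_def)
  have "(\<lambda>n. LBINT x. \<bar>f x - s n x\<bar>) \<longlonglongrightarrow> (\<integral>x. 0 \<partial>(lborel :: real measure))"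
  proof (rule integral_dominated_convergence)
    show "integrable lborel (\<lambda>x. \<bar>f x\<bar> + w x)" using f w by auto
    show "AE x in lborel. (\<lambda>n. \<bar>f x - s n x\<bar>) \<longlonglongrightarrow> 0"
    proof (rule AE_I2)
      fix x
      have "(\<lambda>n. \<bar>f x - s n x\<bar>) \<longlonglongrightarrow> \<bar>f x - f x\<bar>" by (intro tendsto_intros lim)
      then show "(\<lambda>n. \<bar>f x - s n x\<bar>) \<longlonglongrightarrow> 0" by simp
    qed
    show "AE x in lborel. norm \<bar>f x - s n x\<bar> \<le> \<bar>f x\<bar> + w x" for n
    proof (rule AE_I2)
      fix x show "norm \<bar>f x - s n x\<bar> \<le> \<bar>f x\<bar> + w x" using w(2)[of n x] by simp
    qed
  qed (use f si in auto)
  then have "(\<lambda>n. LBINT x. \<bar>f x - s n x\<bar>) \<longlonglongrightarrow> 0" by simp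
  then have "\<forall>\<^sub>F n in sequentially. (LBINT x. \<bar>f x - s n x\<bar>) < e"
    using \<open>e > 0\<close> order_tendstoD(2) by blast
  then obtain n where "(LBINT x. \<bar>f x - s n x\<bar>) < e" by (auto simp: eventually_sequentially)
  then show "\<exists>h. L1_lip_approx h \<and> (LBINT x. \<bar>f x - h x\<bar>) < e" using s by blast
qed

lemma L1_lip_approx_lip_cs: "lip_cs g \<Longrightarrow> L1_lip_approx g"
  unfolding L1_lip_approx_def using lip_cs_integrable by (auto intro!: exI[of _ g])

text \<open>The tent functions max 0 (1 - (n + 1) dist(x, K)) are Lipschitz, vanish at distance 1 or
  more from K and converge pointwise to the indicator because K is closed.\<close>

lemma L1_lip_approx_compact: assumes "compact K" shows "L1_lip_approx (indicator K)"
proof (cases "K = {}")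
  case True
  have "lip_cs (\<lambda>x. 0)" unfolding lip_cs_def by (auto intro: exI[of _ 0])
  then show ?thesis using L1_lip_approx_lip_cs True by (simp add: indicator_def[abs_def])
next
  case False
  obtain R where R: "\<And>x. x \<in> K \<Longrightarrow> \<bar>x\<bar> \<le> R"
    using compact_imp_bounded[OF assms] by (auto simp: bounded_iff)
  define s where "s = (\<lambda>n x. max 0 (1 - real (Suc n) * infdist x K))"
  have far: "infdist x K > 1" if "R + 1 < \<bar>x\<bar>" for x
  proof -
    obtain a where "a \<in> K" "infdist x K = dist x a"
      using infdist_attains_inf[OF compact_imp_closed[OF assms] False] by blast
    then show ?thesis using R[of a] that by (auto simp: dist_real_def)
  qed
  have s0: "s n x = 0" if "R + 1 < \<bar>x\<bar>" for n x
  proof -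
    have "1 * 1 \<le> real (Suc n) * infdist x K" using far[OF that] by (intro mult_mono) auto
    then show ?thesis by (simp add: s_def)
  qed
  show ?thesis
  proof (rule L1_lip_approx_seq[where s=s and w="indicator {-(R + 1)..R + 1}"])
    show "L1_lip_approx (s n)" for n
    proof (rule L1_lip_approx_lip_cs)
      have "\<bar>s n x - s n y\<bar> \<le> real (Suc n) * \<bar>x - y\<bar>" for x y
      proof -
        have "\<bar>s n x - s n y\<bar> \<le> \<bar>real (Suc n) * infdist x K - real (Suc n) * infdist y K\<bar>"
          unfolding s_def by linarith
        also have "\<dots> = real (Suc n) * \<bar>infdist x K - infdist y K\<bar>"
          by (simp add: right_diff_distrib[symmetric] abs_mult del: of_nat_Suc)
        also have "\<dots> \<le> real (Suc n) * \<bar>x - y\<bar>"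
          using infdist_triangle_abs[of x K y] by (intro mult_left_mono) (auto simp: dist_real_def)
        finally show ?thesis .
      qed
      then show "lip_cs (s n)" unfolding lip_cs_def using s0 by blast
    qed
    show "(\<lambda>n. s n x) \<longlonglongrightarrow> indicator K x" for x
    proof (cases "x \<in> K")
      case True
      then show ?thesis by (simp add: s_def)
    next
      case F: False
      then have p: "infdist x K > 0"
        using infdist_pos_not_in_closed[OF compact_imp_closed[OF assms] False] by blast
      obtain N where "real N * infdist x K > 1" using reals_Archimedean3[OF p] by blast
      then have "s n x = 0" if "n \<ge> N" for n
      proof -
        have "real N * infdist x K \<le> real (Suc n) * infdist x K"
          using that p by (intro mult_right_mono) auto
        then show ?thesis using \<open>real N * infdist x K > 1\<close> by (simp add: s_def)
      qed
      then have "\<forall>\<^sub>F n in sequentially. s n x = indicator K x"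
        using F by (auto simp: eventually_sequentially)
      then show ?thesis by (rule tendsto_eventually)
    qed
    show "\<bar>s n x\<bar> \<le> indicator {-(R + 1)..R + 1} x" for n x
      using s0[of x n] infdist_nonneg[of x K]
      by (cases "R + 1 < \<bar>x\<bar>") (auto simp: s_def indicator_def)
  next
    show "integrable lborel (indicator K :: real \<Rightarrow> real)"
      using borel_compact[OF assms] emeasure_compact_finite[OF assms] by (intro integrable_real_indicator) auto
  qed (auto simp: emeasure_lborel_Icc_eq)
qed

text \<open>Outer regularity applied to the complement yields a closed set C inside A of almost full
  measure; intersecting C with [-n, n] reduces to the compact case.\<close>

lemma L1_lip_approx_indicator:
  assumes A: "A \<in> sets lborel" "emeasure lborel A < \<infinity>" shows "L1_lip_approx (indicator A)"
proof (rule L1_lip_approx_closed)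
  show iA: "integrable lborel (indicator A :: real \<Rightarrow> real)" using A by (simp add: integrable_real_indicator)
  fix e :: real assume "e > 0"
  have "- A \<in> sets borel" using A(1) by auto
  from outer_regular_lborel[OF this \<open>e > 0\<close>] obtain V where
    V: "open V" "- A \<subseteq> V" "emeasure lborel (V - - A) < ennreal e" by blast
  define C where "C = - V"
  have C: "closed C" "C \<subseteq> A" "A - C = V - - A" using V by (auto simp: C_def closed_def)
  have Cb: "C \<in> sets borel" using C(1) by (rule borel_closed)
  have Cf: "emeasure lborel C < \<infinity>"
    using A emeasure_mono[OF C(2) A(1)] by (auto intro: le_less_trans)
  have iC: "integrable lborel (indicator C :: real \<Rightarrow> real)" using Cb Cf by (simp add: integrable_real_indicator)
  have "L1_lip_approx (indicator C)"
  proof (rule L1_lip_approx_seq[where s="\<lambda>n. indicator (C \<inter> {-real n..real n})" and w="indicator C"])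
    show "L1_lip_approx (indicator (C \<inter> {-real n..real n}))" for n
      by (rule L1_lip_approx_compact) (use C(1) in \<open>auto intro: closed_Int_compact\<close>)
    show "(\<lambda>n. indicator (C \<inter> {-real n..real n}) x) \<longlonglongrightarrow> (indicator C x :: real)" for x
    proof (rule tendsto_eventually)
      obtain N where "\<bar>x\<bar> \<le> real N" using real_arch_simple by blast
      then show "\<forall>\<^sub>F n in sequentially. indicator (C \<inter> {-real n..real n}) x = (indicator C x :: real)"
        by (intro eventually_sequentiallyI[of N]) (auto simp: indicator_def)
    qed
  qed (auto simp: indicator_def iC)
  moreover have "(LBINT x. \<bar>indicator A x - indicator C x\<bar>) < e"
  proof -
    have "(\<lambda>x. \<bar>indicator A x - indicator C x\<bar>) = (indicator (A - C) :: real \<Rightarrow> real)"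
      using C(2) by (auto simp: indicator_def fun_eq_iff)
    then have "(LBINT x. \<bar>indicator A x - indicator C x\<bar>) = measure lborel (A - C)" by simp
    also have "\<dots> < e"
    proof -
      have "emeasure lborel (A - C) = ennreal (measure lborel (A - C))"
        using V(3) C(3) by (intro emeasure_eq_ennreal_measure) (auto simp: top_unique)
      then show ?thesis using V(3) C(3) by (simp add: ennreal_less_iff)
    qed
    finally show ?thesis .
  qed
  ultimately show "\<exists>h. L1_lip_approx h \<and> (LBINT x. \<bar>indicator A x - h x\<bar>) < e" by blast
qed

lemma L1_lip_approx_integrable: "integrable lborel f \<Longrightarrow> L1_lip_approx f"
proof (induction rule: integrable_induct)
  case (base A c)
  show ?case
  proof (rule L1_lip_approx_closed)
    show "integrable lborel (\<lambda>x. indicator A x *\<^sub>R c)" using base by (simp add: integrable_real_indicator)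
    fix e :: real assume "e > 0"
    then obtain g where g: "lip_cs g" "(LBINT x. \<bar>indicator A x - g x\<bar>) < e / (\<bar>c\<bar> + 1)"
      using L1_lip_approx_indicator[OF base] unfolding L1_lip_approx_def by (meson abs_ge_zero add_nonneg_pos divide_pos_pos zero_less_one)
    have "(LBINT x. \<bar>indicator A x *\<^sub>R c - g x * c\<bar>) = (LBINT x. \<bar>indicator A x - g x\<bar> * \<bar>c\<bar>)"
      by (simp add: left_diff_distrib[symmetric] abs_mult)
    also have "\<dots> = (LBINT x. \<bar>indicator A x - g x\<bar>) * \<bar>c\<bar>" by simp
    also have "\<dots> \<le> (LBINT x. \<bar>indicator A x - g x\<bar>) * (\<bar>c\<bar> + 1)" by (intro mult_left_mono) auto
    also have "\<dots> < e" using g(2) by (simp add: pos_less_divide_eq)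
    finally show "\<exists>h. L1_lip_approx h \<and> (LBINT x. \<bar>indicator A x *\<^sub>R c - h x\<bar>) < e"
      using L1_lip_approx_lip_cs[OF lip_cs_cmult[OF g(1), of c]] by blast
  qed
next
  case (add f g)
  show ?case
  proof (rule L1_lip_approx_closed)
    fix e :: real assume "e > 0"
    then obtain f1 g1 where fg: "lip_cs f1" "(LBINT x. \<bar>f x - f1 x\<bar>) < e / 2"
       "lip_cs g1" "(LBINT x. \<bar>g x - g1 x\<bar>) < e / 2"
      using add unfolding L1_lip_approx_def by (meson half_gt_zero)
    note i = lip_cs_integrable(1)[OF fg(1)] lip_cs_integrable(1)[OF fg(3)] add(1,2)
    have "(LBINT x. \<bar>f x + g x - (f1 x + g1 x)\<bar>) \<le> (LBINT x. \<bar>f x - f1 x\<bar> + \<bar>g x - g1 x\<bar>)"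
      using i add by (intro integral_mono) auto
    also have "\<dots> = (LBINT x. \<bar>f x - f1 x\<bar>) + (LBINT x. \<bar>g x - g1 x\<bar>)"
      using i add by (intro Bochner_Integration.integral_add) auto
    finally show "\<exists>h. L1_lip_approx h \<and> (LBINT x. \<bar>f x + g x - h x\<bar>) < e"
      using fg L1_lip_approx_lip_cs[OF lip_cs_add[OF fg(1,3)]] by (intro exI[of _ "\<lambda>x. f1 x + g1 x"]) auto
  qed (use add in auto)
next
  case (lim f s)
  show ?case
    by (rule L1_lip_approx_seq[where s=s and w="\<lambda>x. 2 * \<bar>f x\<bar>"]) (use lim in auto)
qed

section \<open>Density, integration by parts, weak derivatives\<close>

text \<open>Density is transferred from L1 to L2: f is truncated both in x and in value, the
  truncation is approximated in L1, and the approximant is clipped at the same height N, so that the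
  squared error is at most 2 N times the L1 error. Clipping preserves the Lipschitz bound and the
  support.\<close>

lemma L2_lip_approx:
  assumes f: "L2 f" and e: "e > 0" shows "\<exists>g. lip_cs g \<and> norm2 (\<lambda>x. f x - g x) < e"
proof -
  have [measurable]: "f \<in> borel_measurable borel" by (rule L2_measurable[OF f])
  define h where "h = (\<lambda>n x. if \<bar>x\<bar> \<le> real n \<and> \<bar>f x\<bar> \<le> real n then f x else 0)"
  have [measurable]: "h n \<in> borel_measurable borel" for n unfolding h_def by measurable
  have hf: "\<bar>h n x\<bar> \<le> \<bar>f x\<bar>" for n x by (simp add: h_def)
  have hL: "L2 (h n)" for n by (rule L2_bound[OF f]) (use hf in auto)
  have "(\<lambda>n. LBINT x. (f x - h n x)\<^sup>2) \<longlonglongrightarrow> (\<integral>x. 0 \<partial>(lborel :: real measure))"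
  proof (rule integral_dominated_convergence)
    show "integrable lborel (\<lambda>x. (f x)\<^sup>2)" by (rule L2_square_integrable[OF f])
    show "AE x in lborel. (\<lambda>n. (f x - h n x)\<^sup>2) \<longlonglongrightarrow> 0"
    proof (rule AE_I2, rule tendsto_eventually)
      fix x
      obtain N where "max \<bar>x\<bar> \<bar>f x\<bar> \<le> real N" using real_arch_simple by blast
      then show "\<forall>\<^sub>F n in sequentially. (f x - h n x)\<^sup>2 = 0"
        by (intro eventually_sequentiallyI[of N]) (auto simp: h_def)
    qed
    show "AE x in lborel. norm ((f x - h n x)\<^sup>2) \<le> (f x)\<^sup>2" for n by (rule AE_I2) (simp add: h_def)
  qed auto
  then have "(\<lambda>n. norm2 (\<lambda>x. f x - h n x)) \<longlonglongrightarrow> sqrt 0"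
    unfolding norm2_def by (intro tendsto_real_sqrt) simp
  then have "\<forall>\<^sub>F n in sequentially. norm2 (\<lambda>x. f x - h n x) < e / 2"
    using e order_tendstoD(2)[of _ "sqrt 0" _ "e / 2"] by simp
  then obtain n where n: "norm2 (\<lambda>x. f x - h n x) < e / 2" by (auto simp: eventually_sequentially)
  define N where "N = real n"
  have N: "N \<ge> 0" by (simp add: N_def)
  have hi: "integrable lborel (h n)"
  proof (rule Bochner_Integration.integrable_bound)
    show "integrable lborel (\<lambda>x. N * indicator {-N..N} x)"
      by (intro integrable_mult_right integrable_real_indicator) (auto simp: emeasure_lborel_Icc_eq)
    show "AE x in lborel. norm (h n x) \<le> norm (N * indicator {-N..N} x)"
      by (rule AE_I2) (auto simp: h_def N_def indicator_def abs_le_iff)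
  qed simp
  \<comment> \<open>Chosen so that 2 N d < (e / 2)^2; the summand 1 keeps the denominator positive
    when N = 0.\<close>
  define d where "d = (e / 2)\<^sup>2 / (2 * N + 1)"
  have d: "d > 0" using e N by (simp add: d_def)
  then obtain g0 where g0: "lip_cs g0" "(LBINT x. \<bar>h n x - g0 x\<bar>) < d"
    using L1_lip_approx_integrable[OF hi] unfolding L1_lip_approx_def by blast
  define g where "g = (\<lambda>x. max (-N) (min N (g0 x)))"
  have gl: "lip_cs g"
  proof -
    obtain L R where LR: "\<And>x y. \<bar>g0 x - g0 y\<bar> \<le> L * \<bar>x - y\<bar>" "\<And>x. R < \<bar>x\<bar> \<Longrightarrow> g0 x = 0"
      using g0(1) by (auto simp: lip_cs_def)
    have "\<bar>g x - g y\<bar> \<le> L * \<bar>x - y\<bar>" for x y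
    proof -
      have "\<bar>g x - g y\<bar> \<le> \<bar>g0 x - g0 y\<bar>" unfolding g_def using N by linarith
      then show ?thesis using LR(1)[of x y] by linarith
    qed
    moreover have "g x = 0" if "R < \<bar>x\<bar>" for x using LR(2)[OF that] N by (simp add: g_def)
    ultimately show ?thesis unfolding lip_cs_def by blast
  qed
  note gL = lip_cs_integrable(2)[OF gl]
  have hN: "\<bar>h n x\<bar> \<le> N" for x by (simp add: h_def N_def)
  have "(norm2 (\<lambda>x. h n x - g x))\<^sup>2 = (LBINT x. (h n x - g x)\<^sup>2)" by (rule norm2_power2)
  also have "\<dots> \<le> (LBINT x. 2 * N * \<bar>h n x - g0 x\<bar>)"
  proof (rule integral_mono)
    show "integrable lborel (\<lambda>x. (h n x - g x)\<^sup>2)" by (intro L2_square_integrable L2_diff hL gL)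
    show "integrable lborel (\<lambda>x. 2 * N * \<bar>h n x - g0 x\<bar>)"
      using hi lip_cs_integrable(1)[OF g0(1)] by auto
    fix x
    have "\<bar>h n x - g x\<bar> \<le> \<bar>h n x - g0 x\<bar>" "\<bar>h n x - g x\<bar> \<le> 2 * N"
      using hN[of x] N unfolding g_def by linarith+
    then have "\<bar>h n x - g x\<bar> * \<bar>h n x - g x\<bar> \<le> 2 * N * \<bar>h n x - g0 x\<bar>" by (intro mult_mono) auto
    then show "(h n x - g x)\<^sup>2 \<le> 2 * N * \<bar>h n x - g0 x\<bar>" by (simp add: power2_eq_square)
  qed
  also have "\<dots> = 2 * N * (LBINT x. \<bar>h n x - g0 x\<bar>)" by simp
  also have "\<dots> \<le> 2 * N * d" using g0(2) N by (intro mult_left_mono) auto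
  also have "\<dots> < (e / 2)\<^sup>2" using e N by (simp add: d_def field_simps)
  finally have "norm2 (\<lambda>x. h n x - g x) < e / 2" using e by (meson half_gt_zero less_imp_le power_less_imp_less_base)
  then have "norm2 (\<lambda>x. f x - g x) < e"
    using n norm2_diff_trans[OF f hL[of n] gL] by linarith
  then show ?thesis using gl by blast
qed

text \<open>An e/3 argument: convolution with a mollifier does not increase the L2 norm, so
  replacing f by a Lipschitz g costs no more after mollification than before.\<close>

lemma mollify_tendsto:
  assumes f: "L2 f" shows "(\<lambda>n. norm2 (\<lambda>x. conv f (mollifier n) x - f x)) \<longlonglongrightarrow> 0"
proof (rule LIMSEQ_I)
  fix e :: real assume e: "e > 0"
  obtain g where g: "lip_cs g" "norm2 (\<lambda>x. f x - g x) < e / 3" using L2_lip_approx[OF f, of "e/3"] e by auto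
  note gL = lip_cs_integrable(2)[OF g(1)]
  obtain N where N: "\<And>n. n \<ge> N \<Longrightarrow> norm2 (\<lambda>x. conv g (mollifier n) x - g x) < e / 3"
    using LIMSEQ_D[OF lip_cs_mollify[OF g(1)], of "e / 3"] e by auto
  have "norm2 (\<lambda>x. conv f (mollifier n) x - f x) < e" if "n \<ge> N" for n
  proof -
    have c: "L2 (conv f (mollifier n))" "L2 (conv g (mollifier n))"
      by (intro L2_conv f gL mollifier)+
    have "norm2 (\<lambda>x. conv f (mollifier n) x - conv g (mollifier n) x) = norm2 (conv (\<lambda>x. f x - g x) (mollifier n))"
      using conv_diff[OF L2_loc_integrable[OF f] L2_loc_integrable[OF gL] mollifier(1)]
      by (simp add: norm2_def)
    also have "\<dots> < e / 3"
      using norm2_conv_mollifier[OF L2_diff[OF f gL], of n] g(2) by linarith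
    finally have "norm2 (\<lambda>x. conv f (mollifier n) x - conv g (mollifier n) x) < e / 3" .
    then show ?thesis
      using norm2_diff_trans[OF c f] norm2_diff_trans[OF c(2) gL f] N[OF that] g(2)
      by (simp add: norm2_commute[of f g])
  qed
  then show "\<exists>N. \<forall>n\<ge>N. norm (norm2 (\<lambda>x. conv f (mollifier n) x - f x) - 0) < e" by auto
qed

section \<open>Integration by parts on the line\<close>

lemma FTC_indicator:
  fixes F :: "real \<Rightarrow> real"
  assumes "\<And>x. (F has_real_derivative F' x) (at x)" "continuous_on UNIV F'" "a \<le> b"
  shows "(LBINT x. indicator {a..b} x * F' x) = F b - F a"
  using integral_FTC_atLeastAtMost[OF assms(3), of F F'] assms
  by (auto intro: continuous_on_subset has_field_derivative_at_within simp: has_real_derivative_iff_has_vector_derivative[symmetric])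

lemma integral_shifted_window_tendsto_0:
  fixes F :: "real \<Rightarrow> real"
  assumes F: "integrable lborel F" and s: "filterlim (\<lambda>n. \<bar>s n\<bar>) at_top sequentially"
  shows "(\<lambda>n. LBINT x. indicator {0..1} x * F (x + s n)) \<longlonglongrightarrow> 0"
proof -
  have "(\<lambda>n. LBINT x. indicator {0..1} (x - s n) * F x) \<longlonglongrightarrow> (\<integral>x. 0 \<partial>(lborel :: real measure))"
  proof (rule integral_dominated_convergence)
    show "integrable lborel (\<lambda>x. \<bar>F x\<bar>)" using F by simp
    show "AE x in lborel. (\<lambda>n. indicator {0..1} (x - s n) * F x) \<longlonglongrightarrow> 0"
    proof (rule AE_I2, rule tendsto_eventually)
      fix x
      have "\<forall>\<^sub>F n in sequentially. \<bar>x\<bar> + 2 \<le> \<bar>s n\<bar>" using s by (auto simp: filterlim_at_top)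
      then show "\<forall>\<^sub>F n in sequentially. indicator {0..1} (x - s n) * F x = 0"
        by eventually_elim (auto simp: indicator_def)
    qed
  qed (use F in \<open>auto simp: indicator_def\<close>)
  moreover have "(LBINT x. indicator {0..1} (x - s n) * F x) = (LBINT x. indicator {0..1} x * F (x + s n))" for n
    using lborel_integral_shift[of "\<lambda>x. indicator {0..1} x * F (x + s n)" "s n"] by simp
  ultimately show ?thesis by simp
qed

lemma integral_window_tendsto:
  fixes h :: "real \<Rightarrow> real"
  assumes h: "integrable lborel h"
  shows "(\<lambda>n. LBINT y. indicator {x - real n..x + real n} y * h y) \<longlonglongrightarrow> (LBINT y. h y)"
proof (rule integral_dominated_convergence)
  show "integrable lborel (\<lambda>y. \<bar>h y\<bar>)" using h by simp
  show "AE y in lborel. (\<lambda>n. indicator {x - real n..x + real n} y * h y) \<longlonglongrightarrow> h y"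
  proof (rule AE_I2, rule tendsto_eventually)
    fix y
    obtain N where "\<bar>y - x\<bar> \<le> real N" using real_arch_simple by blast
    then show "\<forall>\<^sub>F n in sequentially. indicator {x - real n..x + real n} y * h y = h y"
      by (intro eventually_sequentiallyI[of N]) (auto simp: indicator_def)
  qed
qed (use h in \<open>auto simp: indicator_def\<close>)

text \<open>No limits of F at infinity are known. For every x the difference F(x + n) - F(x - n)
  tends to the integral of F'; averaging over x in [0,1] replaces the point values by integrals of F
  over unit windows that escape to infinity, and these tend to 0.\<close>

lemma integral_derivative_eq_0:
  fixes F :: "real \<Rightarrow> real"
  assumes d: "\<And>x. (F has_real_derivative F' x) (at x)" and c: "continuous_on UNIV F'"
    and F: "integrable lborel F" and F': "integrable lborel F'"
  shows "(LBINT x. F' x) = 0"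
proof -
  define I where "I = (LBINT x. F' x)"
  have Fc: "continuous_on UNIV F" using d by (meson DERIV_isCont continuous_at_imp_continuous_on)
  then have [measurable]: "F \<in> borel_measurable borel" by (rule borel_measurable_continuous_onI)
  have w: "F (x + real n) - F (x - real n) = (LBINT y. indicator {x - real n..x + real n} y * F' y)" for x n
    using FTC_indicator[OF d c, of "x - real n" "x + real n"] by simp
  have lim: "(\<lambda>n. F (x + real n) - F (x - real n)) \<longlonglongrightarrow> I" for x
    unfolding w I_def by (rule integral_window_tendsto[OF F'])
  have B: "\<bar>F (x + real n) - F (x - real n)\<bar> \<le> (LBINT y. \<bar>F' y\<bar>)" for x n
  proof -
    have "integrable lborel (\<lambda>y. indicator {x - real n..x + real n} y *\<^sub>R F' y)"
      by (rule integrable_mult_indicator[OF _ F']) auto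
    then show ?thesis
      unfolding w
      by (intro order_trans[OF integral_abs_bound] integral_mono integrable_abs F') (auto simp: indicator_def)
  qed
  have i01: "integrable lborel (\<lambda>x. indicator {0..1::real} x * c)" for c :: real
    by (intro integrable_mult_left integrable_real_indicator) auto
  have "(\<lambda>n. LBINT x. indicator {0..1} x * (F (x + real n) - F (x - real n))) \<longlonglongrightarrow> (LBINT x. indicator {0..1::real} x * I)"
  proof (rule integral_dominated_convergence)
    show "integrable lborel (\<lambda>x. indicator {0..1::real} x * (LBINT y. \<bar>F' y\<bar>))" by (rule i01)
    show "AE x in lborel. (\<lambda>n. indicator {0..1} x * (F (x + real n) - F (x - real n))) \<longlonglongrightarrow> indicator {0..1} x * I"
      by (intro AE_I2 tendsto_mult_left lim)
    show "AE x in lborel. norm (indicator {0..1} x * (F (x + real n) - F (x - real n))) \<le> indicator {0..1} x * (LBINT y. \<bar>F' y\<bar>)" for n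
      using B by (auto intro!: AE_I2 simp: indicator_def)
  qed auto
  moreover have "(\<lambda>n. LBINT x. indicator {0..1} x * (F (x + real n) - F (x - real n))) \<longlonglongrightarrow> 0 - 0"
  proof -
    have sp: "(LBINT x. indicator {0..1} x * (F (x + real n) - F (x - real n)))
        = (LBINT x. indicator {0..1} x * F (x + real n)) - (LBINT x. indicator {0..1} x * F (x + (- real n)))" for n
    proof -
      have "set_integrable lborel {0..1} (\<lambda>x. F (x + c))" for c
        by (intro borel_integrable_atLeastAtMost' continuous_on_compose2[OF Fc] continuous_intros) auto
      then have "integrable lborel (\<lambda>x. indicator {0..1} x * F (x + c))" for c by (simp add: set_integrable_def)
      from this[of "real n"] this[of "- real n"] show ?thesis by (simp add: right_diff_distrib)
    qed
    show ?thesis unfolding sp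
      by (intro tendsto_diff integral_shifted_window_tendsto_0 F)
        (auto simp: filterlim_real_sequentially)
  qed
  ultimately have "(LBINT x. indicator {0..1::real} x * I) = 0" using LIMSEQ_unique by fastforce
  then show ?thesis by (simp add: I_def)
qed

lemma integration_by_parts_L2:
  assumes F: "\<And>x. (F has_real_derivative F' x) (at x)" "continuous_on UNIV F'" "L2 F" "L2 F'"
    and G: "\<And>x. (G has_real_derivative G' x) (at x)" "continuous_on UNIV G'" "L2 G" "L2 G'"
  shows "(LBINT x. F' x * G x) = - (LBINT x. F x * G' x)"
proof -
  have c: "continuous_on UNIV F" "continuous_on UNIV G"
    using F(1) G(1) by (meson DERIV_isCont continuous_at_imp_continuous_on)+
  have "(LBINT x. F' x * G x + F x * G' x) = 0"
  proof (rule integral_derivative_eq_0)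
    show "((\<lambda>x. F x * G x) has_real_derivative F' x * G x + F x * G' x) (at x)" for x
      using DERIV_mult[OF F(1) G(1), of x] by (simp add: algebra_simps)
  qed (use F G c in \<open>auto intro!: continuous_intros L2_integrable_mult Bochner_Integration.integrable_add\<close>)
  then show ?thesis using L2_integrable_mult F G by simp
qed

lemma integration_by_parts_test:
  assumes F: "\<And>x. (F has_real_derivative F' x) (at x)" "continuous_on UNIV F'" and p: "test_fun p"
  shows "(LBINT x. F x * deriv p x) = - (LBINT x. F' x * p x)"
proof -
  have c: "continuous_on UNIV F" using F(1) by (meson DERIV_isCont continuous_at_imp_continuous_on)
  note i = loc_integrable_mult_test[OF loc_integrable_continuous[OF c] p]
    loc_integrable_mult_test[OF loc_integrable_continuous[OF c] test_fun_deriv[OF p]]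
    loc_integrable_mult_test[OF loc_integrable_continuous[OF F(2)] p]
  have pc: "continuous_on UNIV p" "continuous_on UNIV (deriv p)"
    using p by (auto intro: smooth_fun_continuous test_fun_smooth test_fun_deriv)
  have "(LBINT x. F' x * p x + F x * deriv p x) = 0"
  proof (rule integral_derivative_eq_0)
    show "((\<lambda>x. F x * p x) has_real_derivative F' x * p x + F x * deriv p x) (at x)" for x
      using DERIV_mult[OF F(1) test_fun_DERIV[OF p], of x] by (simp add: algebra_simps)
  qed (use i c F(2) pc in \<open>auto intro!: continuous_intros\<close>)
  then show ?thesis using i by simp
qed

section \<open>Weak derivatives: calculus, mollification, uniqueness\<close>

lemma weak_deriv_C1:
  assumes "\<And>x. (f has_real_derivative f' x) (at x)" "continuous_on UNIV f'" shows "weak_deriv f f'"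
proof -
  have "continuous_on UNIV f" using assms(1) by (meson DERIV_isCont continuous_at_imp_continuous_on)
  then show ?thesis unfolding weak_deriv_def
    using assms integration_by_parts_test[OF assms] by (auto intro: loc_integrable_continuous)
qed

lemma weak_deriv_loc_integrable: "weak_deriv f g \<Longrightarrow> loc_integrable f" "weak_deriv f g \<Longrightarrow> loc_integrable g"
  by (simp_all add: weak_deriv_def)

lemma weak_deriv_test:
  "weak_deriv f g \<Longrightarrow> test_fun p \<Longrightarrow> (LBINT x. f x * deriv p x) = - (LBINT x. g x * p x)"
  by (simp add: weak_deriv_def)

lemma
  assumes "weak_deriv f f'" "weak_deriv g g'"
  shows weak_deriv_add: "weak_deriv (\<lambda>x. f x + g x) (\<lambda>x. f' x + g' x)"
  and weak_deriv_diff: "weak_deriv (\<lambda>x. f x - g x) (\<lambda>x. f' x - g' x)"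
proof -
  note l = weak_deriv_loc_integrable[OF assms(1)] weak_deriv_loc_integrable[OF assms(2)]
  note i = loc_integrable_mult_test[OF l(1)] loc_integrable_mult_test[OF l(2)]
    loc_integrable_mult_test[OF l(3)] loc_integrable_mult_test[OF l(4)]
  show "weak_deriv (\<lambda>x. f x + g x) (\<lambda>x. f' x + g' x)" "weak_deriv (\<lambda>x. f x - g x) (\<lambda>x. f' x - g' x)"
    unfolding weak_deriv_def
    using l i assms by (auto simp: loc_integrable_add loc_integrable_diff distrib_right left_diff_distrib
        test_fun_deriv weak_deriv_test)
qed

text \<open>The reflected kernel is itself a test function, and the sign from its derivative cancels
  the sign in the definition of the weak derivative. Derivatives can thus be moved between the
  kernel and the function.\<close>

lemma conv_weak_deriv:
  assumes "weak_deriv f g" "test_fun k" shows "conv f (deriv k) x = conv g k x"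
  using weak_deriv_test[OF assms(1) test_fun_reflect[OF assms(2), of x]] test_fun_smooth[OF assms(2)]
  by (simp add: conv_def deriv_reflect)

lemma smooth_fun_conv:
  assumes f: "loc_integrable f" and k: "test_fun k" shows "smooth_fun (conv f k)"
proof (rule smooth_fun_coinduct[of _ "conv f ` Collect test_fun"])
  fix g assume "g \<in> conv f ` Collect test_fun"
  then obtain l where g: "g = conv f l" "test_fun l" by blast
  have "deriv g = conv f (deriv l)" unfolding g by (auto intro!: DERIV_imp_deriv conv_DERIV f g)
  moreover have "\<forall>x. g differentiable at x" unfolding g using conv_DERIV[OF f g(2)] real_differentiable_def by blast
  ultimately show "(\<forall>x. g differentiable at x) \<and> deriv g \<in> conv f ` Collect test_fun"
    using g(2) test_fun_deriv by blast
qed (use k in auto)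

text \<open>Mollified indicators are test functions bounded by 1 with a common compact support, and
  they converge to the indicator away from the two endpoints, which form a null set.\<close>

lemma test_fun_integral_eq_0_imp_interval:
  assumes g: "loc_integrable g" and z: "\<And>p. test_fun p \<Longrightarrow> (LBINT x. g x * p x) = 0"
  shows "(LBINT x. g x * indicator {a<..b} x) = 0"
proof -
  let ?I = "indicator {a<..b} :: real \<Rightarrow> real"
  have I: "loc_integrable ?I"
    by (rule L2_loc_integrable, rule L2_indicator, simp, cases "a \<le> b") auto
  have m: "integrable lborel (\<lambda>z. mollifier n (x - z))" "(LBINT z. mollifier n (x - z)) = 1" for n x
    using test_fun_integrable[OF test_fun_reflect[OF mollifier(1)]]
      lborel_integral_reflect[of "mollifier n" x] by (auto simp: mollifier(4))
  define R where "R = \<bar>a\<bar> + \<bar>b\<bar> + 1"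
  have out: "conv ?I (mollifier n) x = 0" if "\<And>z. z \<in> {a<..b} \<Longrightarrow> 1 / real (Suc n) \<le> \<bar>x - z\<bar>" for n x
  proof -
    have "?I z * mollifier n (x - z) = 0" for z
      using mollifier(3)[OF that, of z] by (cases "z \<in> {a<..b}") (auto simp del: of_nat_Suc)
    then show ?thesis unfolding conv_def by (simp only: Bochner_Integration.integral_zero)
  qed
  have inside: "conv ?I (mollifier n) x = 1" if "\<And>z. z \<notin> {a<..b} \<Longrightarrow> 1 / real (Suc n) \<le> \<bar>x - z\<bar>" for n x
  proof -
    have "?I z * mollifier n (x - z) = mollifier n (x - z)" for z
      using mollifier(3)[OF that, of z] by (cases "z \<in> {a<..b}") (auto simp del: of_nat_Suc)
    then show ?thesis unfolding conv_def by (simp only: m)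
  qed
  have R0: "conv ?I (mollifier n) x = 0" if "R < \<bar>x\<bar>" for n x
  proof (rule out)
    fix z assume "z \<in> {a<..b}"
    then have "1 \<le> \<bar>x - z\<bar>" using that unfolding R_def greaterThanAtMost_iff by linarith
    moreover have "1 / real (Suc n) \<le> 1" by simp
    ultimately show "1 / real (Suc n) \<le> \<bar>x - z\<bar>" by linarith
  qed
  have B: "\<bar>conv ?I (mollifier n) x\<bar> \<le> 1" for n x
  proof -
    have "\<bar>conv ?I (mollifier n) x\<bar> \<le> (LBINT z. \<bar>?I z * mollifier n (x - z)\<bar>)"
      unfolding conv_def by (rule integral_abs_bound)
    also have "\<dots> \<le> (LBINT z. mollifier n (x - z))"
      using conv_integrable[OF I mollifier(1)[of n], of x] m mollifier(2)
      by (intro integral_mono) (auto simp: indicator_def)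
    finally show ?thesis by (simp add: m)
  qed
  have t: "test_fun (conv ?I (mollifier n))" for n
    unfolding test_fun_def using smooth_fun_conv[OF I mollifier(1)] R0 by blast
  have [measurable]: "g \<in> borel_measurable borel" by (rule loc_integrable_measurable[OF g])
  have [measurable]: "conv ?I (mollifier n) \<in> borel_measurable borel" for n by (rule test_fun_measurable[OF t])
  have "(\<lambda>n. LBINT x. g x * conv ?I (mollifier n) x) \<longlonglongrightarrow> (LBINT x. g x * ?I x)"
  proof (rule integral_dominated_convergence)
    show "integrable lborel (\<lambda>x. \<bar>g x * indicator {-R..R} x\<bar>)"
      by (rule integrable_abs, rule loc_integrable_mult_compact[OF g, where B=1 and R=R]) (auto simp: indicator_def)
    have "AE x in lborel. x \<noteq> a \<and> x \<noteq> b" by (intro AE_conjI AE_lborel_singleton)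
    then show "AE x in lborel. (\<lambda>n. g x * conv ?I (mollifier n) x) \<longlonglongrightarrow> g x * ?I x"
    proof (eventually_elim, intro tendsto_mult_left tendsto_eventually)
      fix x assume x: "x \<noteq> a \<and> x \<noteq> b"
      define d where "d = min \<bar>x - a\<bar> \<bar>x - b\<bar>"
      have "d > 0" using x by (auto simp: d_def)
      then obtain N where N: "1 / real (Suc N) < d" using nat_approx_posE by (metis)
      have dn: "1 / real (Suc n) \<le> d" if "n \<ge> N" for n
      proof -
        have "1 / real (Suc n) \<le> 1 / real (Suc N)" using that by (simp add: frac_le)
        then show ?thesis using N by linarith
      qed
      show "\<forall>\<^sub>F n in sequentially. conv ?I (mollifier n) x = ?I x"
      proof (rule eventually_sequentiallyI[of N])
        fix n assume n: "N \<le> n"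
        show "conv ?I (mollifier n) x = ?I x"
        proof (cases "x \<in> {a<..b}")
          case True
          have "conv ?I (mollifier n) x = 1"
          proof (rule inside)
            fix z assume "z \<notin> {a<..b}"
            then have "d \<le> \<bar>x - z\<bar>" using True x unfolding d_def greaterThanAtMost_iff by linarith
            then show "1 / real (Suc n) \<le> \<bar>x - z\<bar>" using dn[OF n] by linarith
          qed
          then show ?thesis using True by simp
        next
          case False
          have "conv ?I (mollifier n) x = 0"
          proof (rule out)
            fix z assume "z \<in> {a<..b}"
            then have "d \<le> \<bar>x - z\<bar>" using False x unfolding d_def greaterThanAtMost_iff by linarith
            then show "1 / real (Suc n) \<le> \<bar>x - z\<bar>" using dn[OF n] by linarith
          qed
          then show ?thesis using False by simp
        qed
      qed
    qed
    show "AE x in lborel. norm (g x * conv ?I (mollifier n) x) \<le> \<bar>g x * indicator {-R..R} x\<bar>" for n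
    proof (rule AE_I2)
      fix x
      show "norm (g x * conv ?I (mollifier n) x) \<le> \<bar>g x * indicator {-R..R} x\<bar>"
      proof (cases "R < \<bar>x\<bar>")
        case False
        then have "x \<in> {-R..R}" by auto
        then show ?thesis using mult_left_mono[OF B[of n x] abs_ge_zero[of "g x"]] by (simp add: abs_mult)
      qed (simp add: R0)
    qed
  qed auto
  then show ?thesis using z[OF t] LIMSEQ_unique[OF tendsto_const] by fastforce
qed

text \<open>The positive and negative parts of g on a bounded window are densities of finite
  measures that agree on all rays \<open>{c<..}\<close> and hence coincide. Uniqueness of densities
  makes the two parts equal almost everywhere, so both vanish.\<close>

lemma loc_integrable_eq_0_AE:
  assumes g: "loc_integrable g" and z: "\<And>a b. (LBINT x. g x * indicator {a<..b} x) = 0"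
  shows "AE x in lborel. g x = 0"
proof -
  have [measurable]: "g \<in> borel_measurable borel" by (rule loc_integrable_measurable[OF g])
  have "AE x in lborel. \<bar>x\<bar> < real n \<longrightarrow> g x = 0" for n
  proof -
    define N where "N = real n"
    define P where "P = (\<lambda>x. ennreal (max 0 (g x * indicator {-N<..N} x)))"
    define Q where "Q = (\<lambda>x. ennreal (max 0 (- (g x * indicator {-N<..N} x))))"
    have [measurable]: "P \<in> borel_measurable borel" "Q \<in> borel_measurable borel" by (auto simp: P_def Q_def)
    have i: "integrable lborel (\<lambda>x. g x * indicator {s<..N} x)" for s
      by (rule loc_integrable_mult_compact[OF g, where B=1 and R="max \<bar>s\<bar> \<bar>N\<bar>"]) (auto simp: indicator_def abs_le_iff)
    have PQ: "(\<integral>\<^sup>+x. P x * indicator {c<..} x \<partial>lborel) = ennreal (LBINT x. max 0 (g x * indicator {max c (-N)<..N} x))"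
        "(\<integral>\<^sup>+x. Q x * indicator {c<..} x \<partial>lborel) = ennreal (LBINT x. max 0 (- (g x * indicator {max c (-N)<..N} x)))" for c
      using i[of "max c (-N)"]
      by (subst nn_integral_eq_integral[symmetric];
          auto simp: P_def Q_def indicator_def intro!: nn_integral_cong integrable_max)+
    have eq: "(LBINT x. max 0 (g x * indicator {s<..N} x)) = (LBINT x. max 0 (- (g x * indicator {s<..N} x)))" for s
    proof -
      have "(LBINT x. max 0 (g x * indicator {s<..N} x)) - (LBINT x. max 0 (- (g x * indicator {s<..N} x)))
          = (LBINT x. max 0 (g x * indicator {s<..N} x) - max 0 (- (g x * indicator {s<..N} x)))"
        using i[of s] by (intro Bochner_Integration.integral_diff[symmetric]) (auto intro!: integrable_max)
      also have "(\<lambda>x. max 0 (g x * indicator {s<..N} x) - max 0 (- (g x * indicator {s<..N} x))) = (\<lambda>x. g x * indicator {s<..N} x)"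
        by (auto simp: max_def)
      finally show ?thesis using z by simp
    qed
    have "density lborel P = density lborel Q"
    proof (rule measure_eqI_lessThan)
      show "emeasure (density lborel P) {c<..} < \<infinity>" for c by (simp add: emeasure_density PQ)
      show "emeasure (density lborel P) {c<..} = emeasure (density lborel Q) {c<..}" for c
        by (simp add: emeasure_density PQ eq)
    qed auto
    then have "AE x in lborel. P x = Q x"
      by (intro sigma_finite_measure.density_unique[OF sigma_finite_lborel]) auto
    then show ?thesis
      by eventually_elim (auto simp: P_def Q_def N_def max_def indicator_def split: if_splits)
  qed
  then have "AE x in lborel. \<forall>n::nat. \<bar>x\<bar> < real n \<longrightarrow> g x = 0" unfolding AE_all_countable by blast
  then show ?thesis by eventually_elim (use reals_Archimedean2 in blast)
qed

lemma weak_deriv_unique: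
  assumes "weak_deriv f g" "weak_deriv f h" shows "AE x in lborel. g x = h x"
proof -
  note l = weak_deriv_loc_integrable(2)[OF assms(1)] weak_deriv_loc_integrable(2)[OF assms(2)]
  have "(LBINT x. (g x - h x) * p x) = 0" if "test_fun p" for p
    using weak_deriv_test[OF assms(1) that] weak_deriv_test[OF assms(2) that]
      loc_integrable_mult_test[OF l(1) that] loc_integrable_mult_test[OF l(2) that]
    by (simp add: left_diff_distrib)
  then have "AE x in lborel. g x - h x = 0"
    by (intro loc_integrable_eq_0_AE test_fun_integral_eq_0_imp_interval loc_integrable_diff l)
  then show ?thesis by simp
qed

section \<open>Sobolev functions on the line\<close>

text \<open>Supplies the base point in Agmon's inequality: an integrable square takes arbitrarily
  small values, although it is not known to tend to 0.\<close>

lemma integrable_small_value: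
  fixes h :: "real \<Rightarrow> real"
  assumes "integrable lborel h" "e > 0" shows "\<exists>y. h y < e"
proof (rule ccontr)
  assume "\<nexists>y. h y < e"
  then have h: "e \<le> h y" for y by (meson not_le)
  obtain n :: nat where n: "(LBINT y. h y) / e < real n" using reals_Archimedean2 by blast
  have "e * real n = (LBINT y. e * indicator {0..real n} y)" by simp
  also have "\<dots> \<le> (LBINT y. h y)"
  proof (rule integral_mono)
    show "integrable lborel (\<lambda>y. e * indicator {0..real n} y)"
      by (intro integrable_mult_right integrable_real_indicator) auto
    show "e * indicator {0..real n} y \<le> h y" for y using h[of y] assms(2) by (auto simp: indicator_def)
  qed fact
  finally show False using n assms(2) by (simp add: field_simps)
qed

lemma DERIV_at_continuous_on: "(\<And>x. (F has_real_derivative F' x) (at x)) \<Longrightarrow> continuous_on A F"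
  by (meson DERIV_isCont continuous_at_imp_continuous_on)

text \<open>F(x)^2 - F(y)^2 is the integral of 2 F F' between the two points, bounded by
  Cauchy-Schwarz, and y can be chosen with F(y)^2 below any e.\<close>

lemma Agmon_C1:
  assumes d: "\<And>x. (F has_real_derivative F' x) (at x)" and c: "continuous_on UNIV F'" and L: "L2 F" "L2 F'"
  shows "(F x)\<^sup>2 \<le> 2 * norm2 F * norm2 F'"
proof (rule field_le_epsilon)
  fix e :: real assume "e > 0"
  then obtain y where y: "(F y)\<^sup>2 < e" using integrable_small_value[OF L2_square_integrable[OF L(1)]] by blast
  have Fc: "continuous_on UNIV F" by (rule DERIV_at_continuous_on[OF d])
  have d2: "((\<lambda>x. (F x)\<^sup>2) has_real_derivative 2 * F x * F' x) (at x)" for x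
    by (auto intro!: derivative_eq_intros d)
  have c2: "continuous_on UNIV (\<lambda>x. 2 * F x * F' x)" using Fc c by (intro continuous_intros)
  have i: "integrable lborel (\<lambda>x. 2 * F x * F' x)"
    using integrable_mult_right[OF L2_integrable_mult[OF L], of 2] by (simp add: mult.assoc)
  have "\<bar>(LBINT z. indicator {a..b} z * (2 * F z * F' z))\<bar> \<le> 2 * norm2 F * norm2 F'" for a b
  proof -
    have "L2 (\<lambda>z. \<bar>F z\<bar>)" "L2 (\<lambda>z. \<bar>F' z\<bar>)" using L by (auto simp: L2_def)
    note abs = this
    have "\<bar>(LBINT z. indicator {a..b} z * (2 * F z * F' z))\<bar> \<le> (LBINT z. \<bar>indicator {a..b} z * (2 * F z * F' z)\<bar>)"
      by (rule integral_abs_bound)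
    also have "\<dots> \<le> (LBINT z. 2 * (\<bar>F z\<bar> * \<bar>F' z\<bar>))"
    proof (rule integral_mono)
      show "integrable lborel (\<lambda>z. \<bar>indicator {a..b} z * (2 * F z * F' z)\<bar>)"
        using integrable_mult_indicator[OF _ i, of "{a..b}"] by (intro integrable_abs) simp
      show "integrable lborel (\<lambda>z. 2 * (\<bar>F z\<bar> * \<bar>F' z\<bar>))" by (intro integrable_mult_right L2_integrable_mult abs)
    qed (auto simp: indicator_def abs_mult)
    also have "\<dots> \<le> 2 * (norm2 F * norm2 F')"
      using Cauchy_Schwarz_L2[OF abs] by (simp add: norm2_def)
    finally show ?thesis by simp
  qed
  note B = this
  have "(F x)\<^sup>2 - (F y)\<^sup>2 \<le> 2 * norm2 F * norm2 F'"
  proof (cases "y \<le> x")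
    case True
    then show ?thesis using B[of y x] FTC_indicator[OF d2 c2 True] by linarith
  next
    case False
    then show ?thesis using B[of x y] FTC_indicator[OF d2 c2, of x y] by linarith
  qed
  then show "(F x)\<^sup>2 \<le> 2 * norm2 F * norm2 F' + e" using y by linarith
qed

lemma conv_DERIV_weak:
  assumes "weak_deriv f g" "test_fun k" shows "(conv f k has_real_derivative conv g k x) (at x)"
  using conv_DERIV[OF weak_deriv_loc_integrable(1)[OF assms(1)] assms(2)] conv_weak_deriv[OF assms] by simp

text \<open>The mollified functions obey the classical bound with the same constant M. The excess of
  |f| over M is therefore dominated by the mollification error, whose norm tends to 0.\<close>

lemma Agmon_AE:
  assumes w: "weak_deriv f g" and L: "L2 f" "L2 g"
  shows "AE x in lborel. \<bar>f x\<bar> \<le> sqrt (2 * norm2 f * norm2 g)"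
proof -
  define M where "M = sqrt (2 * norm2 f * norm2 g)"
  have M: "M \<ge> 0" by (simp add: M_def)
  have [measurable]: "f \<in> borel_measurable borel" by (rule L2_measurable[OF L(1)])
  define h where "h = (\<lambda>x. max 0 (\<bar>f x\<bar> - M))"
  have hm: "h \<in> borel_measurable borel" unfolding h_def by measurable
  have hL: "L2 h" by (rule L2_bound[OF L(1) hm]) (use M in \<open>auto simp: h_def\<close>)
  have "norm2 h \<le> norm2 (\<lambda>x. conv f (mollifier n) x - f x)" for n
  proof (rule norm2_mono)
    have "(conv f (mollifier n) x)\<^sup>2 \<le> M\<^sup>2" for x
    proof -
      have "(conv f (mollifier n) x)\<^sup>2 \<le> 2 * norm2 (conv f (mollifier n)) * norm2 (conv g (mollifier n))"
        by (intro Agmon_C1 conv_DERIV_weak[OF w] conv_continuous L2_loc_integrable L2_conv mollifier L)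
      also have "\<dots> \<le> 2 * norm2 f * norm2 g"
        using norm2_conv_mollifier[OF L(1), of n] norm2_conv_mollifier[OF L(2), of n] by (intro mult_mono) auto
      finally show ?thesis by (simp add: M_def)
    qed
    then have "\<bar>conv f (mollifier n) x\<bar> \<le> M" for x using M by (simp add: abs_le_square_iff[symmetric])
    then have "\<bar>h x\<bar> \<le> \<bar>conv f (mollifier n) x - f x\<bar>" for x unfolding h_def by (smt (verit))
    then show "AE x in lborel. \<bar>h x\<bar> \<le> \<bar>conv f (mollifier n) x - f x\<bar>" by simp
  qed (auto intro: hm L2_diff L2_conv L mollifier)
  then have "norm2 h \<le> 0"
    using LIMSEQ_le_const[OF mollify_tendsto[OF L(1)]] by blast
  then have "norm2 h = 0" by (simp add: order_antisym)
  from norm2_eq_0_AE[OF hL this] show ?thesis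
    by eventually_elim (auto simp: h_def M_def max_def split: if_splits)
qed

section \<open>Product rules and exact derivatives for weakly differentiable functions\<close>

lemma norm2_bounded_mult_tendsto_0:
  assumes "\<And>n. L2 (D n)" "(\<lambda>n. norm2 (D n)) \<longlonglongrightarrow> 0" "\<And>n. b n \<in> borel_measurable borel"
    "\<And>n. AE x in lborel. \<bar>b n x\<bar> \<le> B" "B \<ge> 0"
  shows "(\<lambda>n. norm2 (\<lambda>x. b n x * D n x)) \<longlonglongrightarrow> 0"
proof (rule tendsto_sandwich[OF _ _ tendsto_const])
  show "\<forall>\<^sub>F n in sequentially. norm2 (\<lambda>x. b n x * D n x) \<le> B * norm2 (D n)"
    using norm2_mult_bounded[OF assms(1,3,4,5)] by simp
  show "(\<lambda>n. B * norm2 (D n)) \<longlonglongrightarrow> 0" using tendsto_mult_right[OF assms(2), of B] by (simp add: mult.commute tendsto_mult_right_zero assms(2))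
qed simp

lemma L2_mult_AE_bounded:
  assumes "L2 f" "b \<in> borel_measurable borel" "AE x in lborel. \<bar>b x\<bar> \<le> B" "B \<ge> 0"
  shows "L2 (\<lambda>x. b x * f x)"
proof (rule L2_AE_cong)
  have [measurable]: "b \<in> borel_measurable borel" by fact
  show "L2 (\<lambda>x. (max (-B) (min B (b x))) * f x)"
    by (rule L2_mult_bounded[OF assms(1), of _ B]) (use assms(4) in \<open>measurable, auto simp: abs_le_iff\<close>)
  show "AE x in lborel. max (-B) (min B (b x)) * f x = b x * f x"
    using assms(3) by eventually_elim (auto simp: abs_le_iff max_def min_def)
qed (use assms in auto)

text \<open>The product rule holds for the mollified functions. The test function and its derivative
  are bounded multipliers, so both sides converge as bilinear integrals.\<close>

lemma weak_deriv_square: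
  assumes w: "weak_deriv f g" and L: "L2 f" "L2 g"
  shows "weak_deriv (\<lambda>x. (f x)\<^sup>2 / 2) (\<lambda>x. f x * g x)"
  unfolding weak_deriv_def
proof (intro conjI allI impI)
  have li: "integrable lborel h \<Longrightarrow> loc_integrable h" for h :: "real \<Rightarrow> real"
    unfolding loc_integrable_def set_integrable_def by (intro allI integrable_mult_indicator) auto
  show "loc_integrable (\<lambda>x. (f x)\<^sup>2 / 2)" "loc_integrable (\<lambda>x. f x * g x)"
    using L by (auto intro!: li L2_square_integrable L2_integrable_mult)
  fix p assume p: "test_fun p"
  let ?F = "\<lambda>n. conv f (mollifier n)" and ?G = "\<lambda>n. conv g (mollifier n)"
  have FL: "L2 (?F n)" "L2 (?G n)" for n by (intro L2_conv L mollifier)+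
  have FG: "(?F n has_real_derivative ?G n x) (at x)" for n x by (rule conv_DERIV_weak[OF w mollifier(1)])
  have Gc: "continuous_on UNIV (?G n)" for n by (intro conv_continuous L2_loc_integrable L mollifier)
  have mb: "L2 (\<lambda>x. q x * h x)" if "L2 h" "test_fun q" for q h
    using test_fun_bounded[OF that(2)] L2_mult_bounded[OF that(1) test_fun_measurable[OF that(2)]] by metis
  have md: "(\<lambda>n. norm2 (\<lambda>x. q x * conv f (mollifier n) x - q x * f x)) \<longlonglongrightarrow> 0" if q: "test_fun q" for q
  proof -
    obtain B where "B > 0" "\<And>x. \<bar>q x\<bar> \<le> B" using test_fun_bounded[OF q] by blast
    then have "(\<lambda>n. norm2 (\<lambda>x. q x * (conv f (mollifier n) x - f x))) \<longlonglongrightarrow> 0"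
      by (intro norm2_bounded_mult_tendsto_0[where B=B] L2_diff FL L mollify_tendsto test_fun_measurable q) auto
    then show ?thesis by (simp add: right_diff_distrib)
  qed
  have 1: "(\<lambda>n. LBINT x. ?F n x * (deriv p x * ?F n x)) \<longlonglongrightarrow> (LBINT x. f x * (deriv p x * f x))"
    by (rule tendsto_inner_L2) (auto intro!: L FL mollify_tendsto mb md test_fun_deriv p always_eventually)
  have 2: "(\<lambda>n. LBINT x. ?G n x * (p x * ?F n x)) \<longlonglongrightarrow> (LBINT x. g x * (p x * f x))"
    by (rule tendsto_inner_L2) (auto intro!: L FL mollify_tendsto mb md p always_eventually)
  have e: "(LBINT x. ?F n x * (deriv p x * ?F n x)) = - 2 * (LBINT x. ?G n x * (p x * ?F n x))" for n
  proof -
    have "(LBINT x. (?F n x)\<^sup>2 * deriv p x) = - (LBINT x. (2 * ?F n x * ?G n x) * p x)"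
    proof (rule integration_by_parts_test[OF _ _ p])
      show "((\<lambda>x. (?F n x)\<^sup>2) has_real_derivative 2 * ?F n x * ?G n x) (at x)" for x
        by (auto intro!: derivative_eq_intros FG)
      show "continuous_on UNIV (\<lambda>x. 2 * ?F n x * ?G n x)"
        by (intro continuous_intros Gc DERIV_at_continuous_on[OF FG])
    qed
    moreover have "(LBINT x. (2 * ?F n x * ?G n x) * p x) = (LBINT x. 2 * (?G n x * (p x * ?F n x)))"
      by (simp only: mult_ac)
    moreover have "\<dots> = 2 * (LBINT x. ?G n x * (p x * ?F n x))" by (rule integral_mult_right_zero)
    moreover have "(LBINT x. ?F n x * (deriv p x * ?F n x)) = (LBINT x. (?F n x)\<^sup>2 * deriv p x)"
      by (simp only: power2_eq_square mult_ac)
    ultimately show ?thesis by simp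
  qed
  have "(LBINT x. f x * (deriv p x * f x)) = - 2 * (LBINT x. g x * (p x * f x))"
    using LIMSEQ_unique[OF 1[unfolded e] tendsto_mult_left[OF 2]] .
  then show "(LBINT x. (f x)\<^sup>2 / 2 * deriv p x) = - (LBINT x. f x * g x * p x)"
    by (simp add: power2_eq_square mult_ac)
qed

lemma conv_mollifier_inner:
  assumes "L2 h" "L2 r"
  shows "(\<lambda>n. LBINT x. conv h (mollifier n) x * r x) \<longlonglongrightarrow> (LBINT x. h x * r x)"
  by (rule tendsto_inner_L2[OF assms(1) _ mollify_tendsto[OF assms(1)] assms(2)])
    (auto simp: assms L2_conv mollifier norm2_def)

text \<open>All factors other than the mollified one are fixed L2 functions, so
  \<open>conv_mollifier_inner\<close> is enough to pass to the limit in the classical product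
  rule.\<close>

lemma weak_deriv_mult_C1:
  assumes w: "weak_deriv f g" and L: "L2 f" "L2 g"
    and b: "\<And>x. (b has_real_derivative b' x) (at x)" "continuous_on UNIV b'" "\<And>x. \<bar>b x\<bar> \<le> B" "\<And>x. \<bar>b' x\<bar> \<le> B"
  shows "weak_deriv (\<lambda>x. b x * f x) (\<lambda>x. b x * g x + b' x * f x)"
  unfolding weak_deriv_def
proof (intro conjI allI impI)
  have bc: "continuous_on UNIV b" by (rule DERIV_at_continuous_on[OF b(1)])
  have bm: "b \<in> borel_measurable borel" "b' \<in> borel_measurable borel"
    using bc b(2) by (auto intro: borel_measurable_continuous_onI)
  note mb = L2_mult_bounded[OF _ bm(1) b(3)] L2_mult_bounded[OF _ bm(2) b(4)]
  show "loc_integrable (\<lambda>x. b x * f x)" "loc_integrable (\<lambda>x. b x * g x + b' x * f x)"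
    by (intro L2_loc_integrable L2_add mb L)+
  fix p assume p: "test_fun p"
  have pc: "continuous_on A p" "continuous_on A (deriv p)" for A
    using p by (auto intro: smooth_fun_continuous test_fun_smooth test_fun_deriv)
  let ?F = "\<lambda>n. conv f (mollifier n)" and ?G = "\<lambda>n. conv g (mollifier n)"
  have FL: "L2 (?F n)" "L2 (?G n)" for n by (intro L2_conv L mollifier)+
  have FG: "(?F n has_real_derivative ?G n x) (at x)" for n x by (rule conv_DERIV_weak[OF w mollifier(1)])
  have Gc: "continuous_on UNIV (?G n)" for n by (intro conv_continuous L2_loc_integrable L mollifier)
  have e: "(LBINT x. ?F n x * (b x * deriv p x)) = - ((LBINT x. ?G n x * (b x * p x)) + (LBINT x. ?F n x * (b' x * p x)))" for n
  proof -
    have "(LBINT x. (b x * ?F n x) * deriv p x) = - (LBINT x. (b' x * ?F n x + b x * ?G n x) * p x)"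
    proof (rule integration_by_parts_test[OF _ _ p])
      show "((\<lambda>x. b x * ?F n x) has_real_derivative b' x * ?F n x + b x * ?G n x) (at x)" for x
        by (auto intro!: derivative_eq_intros FG b(1))
      show "continuous_on UNIV (\<lambda>x. b' x * ?F n x + b x * ?G n x)"
        by (intro continuous_intros Gc DERIV_at_continuous_on[OF FG] bc b(2))
    qed
    moreover have "(LBINT x. (b' x * ?F n x + b x * ?G n x) * p x)
      = (LBINT x. ?G n x * (b x * p x) + ?F n x * (b' x * p x))" by (simp add: algebra_simps)
    moreover have "\<dots> = (LBINT x. ?G n x * (b x * p x)) + (LBINT x. ?F n x * (b' x * p x))"
      by (intro Bochner_Integration.integral_add L2_integrable_mult FL mb L2_test_fun p)
    ultimately show ?thesis by (simp add: mult_ac)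
  qed
  have "(LBINT x. f x * (b x * deriv p x)) = - ((LBINT x. g x * (b x * p x)) + (LBINT x. f x * (b' x * p x)))"
    by (rule LIMSEQ_unique[OF conv_mollifier_inner[where h=f and r="\<lambda>x. b x * deriv p x", unfolded e]])
      (intro L mb L2_test_fun test_fun_deriv p tendsto_intros conv_mollifier_inner)+
  moreover have "(LBINT x. (b x * g x + b' x * f x) * p x) = (LBINT x. g x * (b x * p x) + f x * (b' x * p x))"
    by (simp add: algebra_simps)
  moreover have "\<dots> = (LBINT x. g x * (b x * p x)) + (LBINT x. f x * (b' x * p x))"
    by (intro Bochner_Integration.integral_add L2_integrable_mult L mb L2_test_fun p)
  ultimately show "(LBINT x. b x * f x * deriv p x) = - (LBINT x. (b x * g x + b' x * f x) * p x)"
    by (simp add: mult_ac)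
qed

text \<open>The integrand is the derivative of f^3 / 3. Agmon's bound makes f^2 square integrable
  and bounds the mollified functions uniformly, so the identity survives the limit. It removes the
  self-interaction of the perturbation from the L2 energy, whatever its size.\<close>

lemma integral_cube_deriv:
  assumes w: "weak_deriv f g" and L: "L2 f" "L2 g"
  shows "(LBINT x. g x * (f x * f x)) = 0"
proof -
  define M where "M = sqrt (2 * norm2 f * norm2 g)"
  have M: "M \<ge> 0" by (simp add: M_def)
  let ?F = "\<lambda>n. conv f (mollifier n)" and ?G = "\<lambda>n. conv g (mollifier n)"
  have [measurable]: "f \<in> borel_measurable borel" "g \<in> borel_measurable borel" using L by (auto intro: L2_measurable)
  have FL: "L2 (?F n)" "L2 (?G n)" for n by (intro L2_conv L mollifier)+
  have [measurable]: "?F n \<in> borel_measurable borel" for n by (rule L2_measurable[OF FL(1)])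
  have FG: "(?F n has_real_derivative ?G n x) (at x)" for n x by (rule conv_DERIV_weak[OF w mollifier(1)])
  have Gc: "continuous_on UNIV (?G n)" for n by (intro conv_continuous L2_loc_integrable L mollifier)
  have fM: "AE x in lborel. \<bar>f x\<bar> \<le> M" unfolding M_def by (rule Agmon_AE[OF w L])
  have FM: "\<bar>?F n x\<bar> \<le> M" for n x
  proof -
    have "(?F n x)\<^sup>2 \<le> 2 * norm2 (?F n) * norm2 (?G n)"
      by (intro Agmon_C1 FG Gc FL)
    also have "\<dots> \<le> 2 * norm2 f * norm2 g"
      using norm2_conv_mollifier[OF L(1), of n] norm2_conv_mollifier[OF L(2), of n] by (intro mult_mono) auto
    finally show ?thesis using M by (simp add: M_def real_le_rsqrt)
  qed
  have ff: "L2 (\<lambda>x. f x * f x)" by (rule L2_mult_AE_bounded[OF L(1) _ fM M]) simp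
  have FF: "L2 (\<lambda>x. ?F n x * ?F n x)" for n by (rule L2_mult_bounded[OF FL(1) _ FM]) simp
  have d: "(\<lambda>n. norm2 (\<lambda>x. ?F n x * ?F n x - f x * f x)) \<longlonglongrightarrow> 0"
  proof -
    have "(\<lambda>n. norm2 (\<lambda>x. (?F n x + f x) * (?F n x - f x))) \<longlonglongrightarrow> 0"
    proof (rule norm2_bounded_mult_tendsto_0[where B="2 * M"])
      show "AE x in lborel. \<bar>?F n x + f x\<bar> \<le> 2 * M" for n
        using fM
      proof eventually_elim
        case (elim x)
        then show ?case using FM[of n x] by linarith
      qed
    qed (use M in \<open>auto intro: L2_diff FL L mollify_tendsto\<close>)
    then show ?thesis by (simp add: algebra_simps)
  qed
  have "(\<lambda>n. LBINT x. ?G n x * (?F n x * ?F n x)) \<longlonglongrightarrow> (LBINT x. g x * (f x * f x))"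
    by (rule tendsto_inner_L2) (auto intro!: L FL FF ff d mollify_tendsto always_eventually)
  moreover have "(LBINT x. ?G n x * (?F n x * ?F n x)) = 0" for n
  proof (rule integral_derivative_eq_0)
    show "((\<lambda>x. (?F n x) ^ 3 / 3) has_real_derivative ?G n x * (?F n x * ?F n x)) (at x)" for x
      by (auto intro!: derivative_eq_intros FG simp: power2_eq_square)
    show "integrable lborel (\<lambda>x. (?F n x) ^ 3 / 3)"
      using L2_integrable_mult[OF FL(1) FF, of n n] by (simp add: power3_eq_cube mult.assoc)
  qed (intro continuous_intros Gc DERIV_at_continuous_on[OF FG] L2_integrable_mult FL FF)+
  ultimately have "(\<lambda>n. 0) \<longlonglongrightarrow> (LBINT x. g x * (f x * f x))" by (simp only:)
  then show ?thesis by (simp only: LIMSEQ_const_iff)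
qed

text \<open>The integrated form of (b f^2)' = b' f^2 + 2 b f f'. With b the shock profile it
  converts the transport term into an integral weighted by the slope of the profile.\<close>

lemma integral_weight_deriv:
  assumes w: "weak_deriv f g" and L: "L2 f" "L2 g"
    and b: "\<And>x. (b has_real_derivative b' x) (at x)" "continuous_on UNIV b'" "\<And>x. \<bar>b x\<bar> \<le> B" "\<And>x. \<bar>b' x\<bar> \<le> B"
  shows "2 * (LBINT x. (b x * f x) * g x) = - (LBINT x. b' x * (f x)\<^sup>2)"
proof -
  have bc: "continuous_on UNIV b" by (rule DERIV_at_continuous_on[OF b(1)])
  have bm: "b \<in> borel_measurable borel" "b' \<in> borel_measurable borel"
    using bc b(2) by (auto intro: borel_measurable_continuous_onI)
  note mb = L2_mult_bounded[OF _ bm(1) b(3)] L2_mult_bounded[OF _ bm(2) b(4)]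
  have B: "B \<ge> 0" using b(3)[of 0] by linarith
  let ?F = "\<lambda>n. conv f (mollifier n)" and ?G = "\<lambda>n. conv g (mollifier n)"
  have FL: "L2 (?F n)" "L2 (?G n)" for n by (intro L2_conv L mollifier)+
  have FG: "(?F n has_real_derivative ?G n x) (at x)" for n x by (rule conv_DERIV_weak[OF w mollifier(1)])
  have Gc: "continuous_on UNIV (?G n)" for n by (intro conv_continuous L2_loc_integrable L mollifier)
  have md: "(\<lambda>n. norm2 (\<lambda>x. c x * ?F n x - c x * f x)) \<longlonglongrightarrow> 0"
    if "c \<in> borel_measurable borel" "\<And>x. \<bar>c x\<bar> \<le> B" for c
  proof -
    have "(\<lambda>n. norm2 (\<lambda>x. c x * (?F n x - f x))) \<longlonglongrightarrow> 0"
      using that B by (intro norm2_bounded_mult_tendsto_0[where B=B] L2_diff FL L mollify_tendsto) auto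
    then show ?thesis by (simp add: right_diff_distrib)
  qed
  have 1: "(\<lambda>n. LBINT x. (b x * ?F n x) * ?G n x) \<longlonglongrightarrow> (LBINT x. (b x * f x) * g x)"
    by (rule tendsto_inner_L2) (auto intro!: L FL mb md bm b mollify_tendsto always_eventually)
  have 2: "(\<lambda>n. LBINT x. (b' x * ?F n x) * ?F n x) \<longlonglongrightarrow> (LBINT x. (b' x * f x) * f x)"
    by (rule tendsto_inner_L2) (auto intro!: L FL mb md bm b mollify_tendsto always_eventually)
  have e: "(LBINT x. (b' x * ?F n x) * ?F n x) = - 2 * (LBINT x. (b x * ?F n x) * ?G n x)" for n
  proof -
    have i: "integrable lborel (\<lambda>x. (b' x * ?F n x) * ?F n x)" "integrable lborel (\<lambda>x. (b x * ?F n x) * ?G n x)"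
      by (intro L2_integrable_mult mb FL)+
    have "(LBINT x. (b' x * ?F n x) * ?F n x + 2 * ((b x * ?F n x) * ?G n x)) = 0"
    proof (rule integral_derivative_eq_0)
      show "((\<lambda>x. (b x * ?F n x) * ?F n x) has_real_derivative (b' x * ?F n x) * ?F n x + 2 * ((b x * ?F n x) * ?G n x)) (at x)" for x
        by (auto intro!: derivative_eq_intros FG b(1) simp: algebra_simps)
    qed (intro continuous_intros Gc DERIV_at_continuous_on[OF FG] bc b(2) L2_integrable_mult mb FL
        Bochner_Integration.integrable_add integrable_mult_right i)+
    then show ?thesis using i by simp
  qed
  have "(LBINT x. (b' x * f x) * f x) = - 2 * (LBINT x. (b x * f x) * g x)"
    using LIMSEQ_unique[OF 2[unfolded e] tendsto_mult_left[OF 1]] .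
  then show ?thesis by (simp add: power2_eq_square mult.assoc)
qed

section \<open>Weighted Poincare inequality\<close>

lemma min_tail_tendsto_0:
  assumes "(y \<longlongrightarrow> (0::real)) at_bot" "(y \<longlongrightarrow> 1) at_top"
  shows "((\<lambda>x. min (y x) (1 - y x)) \<longlongrightarrow> 0) at_bot" "((\<lambda>x. min (y x) (1 - y x)) \<longlongrightarrow> 0) at_top"
  using tendsto_min[OF assms(1) tendsto_diff[OF tendsto_const assms(1), of 1]]
    tendsto_min[OF assms(2) tendsto_diff[OF tendsto_const assms(2), of 1]] by simp_all

text \<open>In the coordinate \<open>y\<close> the dual statement is a Hardy inequality with weight \<open>1 / (y (1 - y))\<close> and extremal \<open>y (1 - y)\<close>: with \<open>G\<close> the primitive
  of \<open>q (F - m)\<close>, both steps of the estimate are completions of squares up to the exact derivative of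
  \<open>2 G (F - m) - (1 - 2 y) G\<^sup>2 / (y (1 - y))\<close>.\<close>

lemma weighted_Poincare_C1:
  assumes y: "\<And>x. (y has_real_derivative q x) (at x)" "continuous_on UNIV q"
    and y01: "\<And>x. 0 < y x" "\<And>x. y x < 1" and ylim: "(y \<longlongrightarrow> 0) at_bot" "(y \<longlongrightarrow> 1) at_top"
    and k: "k > 0" "\<And>x. k * (y x * (1 - y x)) \<le> q x"
    and q: "integrable lborel q" "(LBINT x. q x) = 1"
    and F: "\<And>x. (F has_real_derivative F' x) (at x)" "continuous_on UNIV F'" "L2 F" "L2 F'"
  shows "(LBINT x. q x * (F x)\<^sup>2) - (LBINT x. q x * F x)\<^sup>2 \<le> 1 / (2 * k) * (LBINT x. (F' x)\<^sup>2)"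
proof -
  \<comment> \<open>The factor 2 is the first nonzero eigenvalue of the Legendre operator g |-> - (y
    (1 - y) g')' on [0,1]; its eigenfunction is 1 - 2 y.\<close>
  define l where "l = 1 / (2 * k)"
  have l: "l > 0" using k by (simp add: l_def)
  define m where "m = (LBINT x. q x * F x)"
  define f where "f = (\<lambda>x. F x - m)"
  have Y: "y x * (1 - y x) > 0" for x using y01[of x] by simp
  have q0: "q x > 0" for x using k(1) Y[of x] k(2)[of x] by (smt (verit) mult_pos_pos)
  have Fc: "continuous_on A F" for A by (rule DERIV_at_continuous_on[OF F(1)])
  have yc: "continuous_on A y" for A by (rule DERIV_at_continuous_on[OF y(1)])
  have fc: "continuous_on A f" for A unfolding f_def by (intro continuous_intros Fc)
  have [measurable]: "F \<in> borel_measurable borel" "q \<in> borel_measurable borel" "f \<in> borel_measurable borel"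
    by (intro borel_measurable_continuous_onI Fc fc y(2))+
  define C where "C = sqrt (2 * norm2 F * norm2 F')"
  have C: "\<bar>F x\<bar> \<le> C" for x
    using real_sqrt_le_mono[OF Agmon_C1[OF F, of x]] by (simp add: C_def)
  define B where "B = C + \<bar>m\<bar>"
  have B: "\<bar>f x\<bar> \<le> B" for x using C[of x] unfolding f_def B_def by linarith
  have B0: "B \<ge> 0" using B[of 0] by linarith
  have iq: "integrable lborel (\<lambda>x. q x * h x)" if "h \<in> borel_measurable borel" "\<And>x. \<bar>h x\<bar> \<le> D" for h D
  proof (rule Bochner_Integration.integrable_bound[OF integrable_mult_right[OF q(1), of D]])
    show "AE x in lborel. norm (q x * h x) \<le> norm (D * q x)"
    proof (rule AE_I2)
      fix x
      have "q x * \<bar>h x\<bar> \<le> q x * D" using that(2)[of x] q0[of x] by (intro mult_left_mono) auto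
      also have "\<dots> \<le> \<bar>D * q x\<bar>" by (simp add: mult.commute)
      finally show "norm (q x * h x) \<le> norm (D * q x)" using q0[of x] by (simp add: abs_mult)
    qed
  qed (use that in auto)
  have iqF: "integrable lborel (\<lambda>x. q x * F x)" by (rule iq[OF _ C]) simp
  have iqf: "integrable lborel (\<lambda>x. q x * f x)" by (rule iq[OF _ B]) simp
  have iqf2: "integrable lborel (\<lambda>x. q x * (f x)\<^sup>2)"
    by (rule iq[of _ "B\<^sup>2"]) (use B B0 in \<open>auto simp: abs_le_square_iff[symmetric]\<close>)
  have iqF2: "integrable lborel (\<lambda>x. q x * (F x)\<^sup>2)"
  proof (rule iq[of _ "C\<^sup>2"])
    show "\<bar>(F x)\<^sup>2\<bar> \<le> C\<^sup>2" for x using C[of x] C[of 0] by (simp add: abs_le_square_iff[symmetric])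
  qed simp
  have qf0: "(LBINT x. q x * f x) = 0"
    using iqF q by (simp add: f_def right_diff_distrib m_def)
  have "continuous_on UNIV (\<lambda>x. q x * f x)" by (intro continuous_intros y(2) fc)
  then obtain K where K: "\<And>x. (K has_real_derivative q x * f x) (at x)"
    using einterval_antiderivative[of "-\<infinity>" "\<infinity>" "\<lambda>x. q x * f x"]
    by (auto simp: continuous_on_eq_continuous_at has_real_derivative_iff_has_vector_derivative)
  \<comment> \<open>K' = q f with |f| \<le> B, and y' = q, so increments of K are dominated by those
    of B y. Both the limit of K at minus infinity and the tail bounds for G come from this.\<close>
  have KB: "\<bar>K b - K a\<bar> \<le> B * (y b - y a)" if "a \<le> b" for a b
  proof -
    have "B * y a - K a \<le> B * y b - K b" "B * y a + K a \<le> B * y b + K b"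
    proof -
      have d: "((\<lambda>x. B * y x - K x) has_real_derivative q x * (B - f x)) (at x)"
        "((\<lambda>x. B * y x + K x) has_real_derivative q x * (B + f x)) (at x)" for x
        by (auto intro!: derivative_eq_intros y(1) K simp: algebra_simps)
      have n: "q x * (B - f x) \<ge> 0" "q x * (B + f x) \<ge> 0" for x
        using q0[of x] B[of x] by (auto intro!: mult_nonneg_nonneg simp: abs_le_iff)
      show "B * y a - K a \<le> B * y b - K b" "B * y a + K a \<le> B * y b + K b"
        using DERIV_nonneg_imp_nondecreasing[OF that] d n by blast+
    qed
    then show ?thesis by (simp add: abs_le_iff algebra_simps)
  qed
  have "\<exists>K0. ((\<lambda>n. K (- real n)) \<longlongrightarrow> K0) sequentially"
  proof -
    have "Cauchy (\<lambda>n. K (- real n))"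
    proof (rule CauchyI)
      fix e :: real assume e: "e > 0"
      have "(\<lambda>n. B * y (- real n)) \<longlonglongrightarrow> B * 0"
        by (intro tendsto_intros filterlim_compose[OF ylim(1)] filterlim_compose[OF filterlim_uminus_at_bot_at_top filterlim_real_sequentially])
      then have "\<forall>\<^sub>F n in sequentially. B * y (- real n) < e" using e order_tendstoD(2) by fastforce
      then obtain N where N: "B * y (- real n) < e" if "n \<ge> N" for n by (auto simp: eventually_sequentially)
      have "\<bar>K (- real i) - K (- real j)\<bar> < e" if "i \<ge> N" "j \<ge> N" for i j
      proof -
        have *: "\<bar>K (- real i) - K (- real j)\<bar> < e" if "i \<ge> N" "i \<le> j" for i j
        proof -
          have "\<bar>K (- real i) - K (- real j)\<bar> \<le> B * (y (- real i) - y (- real j))" using KB[of "- real j" "- real i"] that by simp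
          also have "\<dots> \<le> B * y (- real i)" using B0 y01(1)[of "- real j"] by (intro mult_left_mono) auto
          also have "\<dots> < e" using N that by blast
          finally show ?thesis .
        qed
        show ?thesis using *[of i j] *[of j i] that by (cases "i \<le> j") (auto simp: abs_minus_commute)
      qed
      then show "\<exists>M. \<forall>m\<ge>M. \<forall>n\<ge>M. norm (K (- real m) - K (- real n)) < e" by auto
    qed
    then show ?thesis by (simp add: Cauchy_convergent_iff convergent_def)
  qed
  then obtain K0 where K0: "(\<lambda>n. K (- real n)) \<longlonglongrightarrow> K0" by blast
  \<comment> \<open>Normalised to vanish at minus infinity; since f has q-mean 0, it vanishes at
    plus infinity as well.\<close>
  define G where "G = (\<lambda>x. K x - K0)"
  have G: "(G has_real_derivative q x * f x) (at x)" for x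
    unfolding G_def by (auto intro!: derivative_eq_intros K)
  have yneg: "(\<lambda>n. y (- real n)) \<longlonglongrightarrow> 0"
    by (rule filterlim_compose[OF ylim(1) filterlim_compose[OF filterlim_uminus_at_bot_at_top filterlim_real_sequentially]])
  have ypos: "(\<lambda>n. y (real n)) \<longlonglongrightarrow> 1"
    by (rule filterlim_compose[OF ylim(2) filterlim_real_sequentially])
  have G1: "\<bar>G x\<bar> \<le> B * y x" for x
  proof (rule tendsto_le[OF sequentially_bot])
    show "(\<lambda>n. \<bar>K x - K (- real n)\<bar>) \<longlonglongrightarrow> \<bar>G x\<bar>" unfolding G_def by (intro tendsto_intros K0)
    show "(\<lambda>n. B * (y x - y (- real n))) \<longlonglongrightarrow> B * y x"
      using tendsto_mult_left[OF tendsto_diff[OF tendsto_const yneg], of B "y x"] by simp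
    obtain N where N: "- x \<le> real N" using real_arch_simple by blast
    show "\<forall>\<^sub>F n in sequentially. \<bar>K x - K (- real n)\<bar> \<le> B * (y x - y (- real n))"
      by (rule eventually_sequentiallyI[of N], rule KB) (use N in linarith)
  qed
  have K1: "(\<lambda>n. K (real n)) \<longlonglongrightarrow> K0"
  proof -
    have "(\<lambda>n. K (real n) - K (- real n)) \<longlonglongrightarrow> 0"
      using integral_window_tendsto[OF iqf, of 0] FTC_indicator[OF K, of "- real _" "real _"]
        \<open>continuous_on UNIV (\<lambda>x. q x * f x)\<close> by (simp add: qf0)
    from tendsto_add[OF this K0] show ?thesis by simp
  qed
  have G2: "\<bar>G x\<bar> \<le> B * (1 - y x)" for x
  proof (rule tendsto_le[OF sequentially_bot])
    show "(\<lambda>n. \<bar>K (real n) - K x\<bar>) \<longlonglongrightarrow> \<bar>G x\<bar>"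
      unfolding G_def abs_minus_commute[of "K x"] by (intro tendsto_intros K1)
    show "(\<lambda>n. B * (y (real n) - y x)) \<longlonglongrightarrow> B * (1 - y x)"
      by (intro tendsto_intros ypos)
    obtain N where N: "x \<le> real N" using real_arch_simple by blast
    show "\<forall>\<^sub>F n in sequentially. \<bar>K (real n) - K x\<bar> \<le> B * (y (real n) - y x)"
      by (rule eventually_sequentiallyI[of N], rule KB) (use N in linarith)
  qed
  have Gm: "\<bar>G x\<bar> \<le> B * min (y x) (1 - y x)" for x using G1[of x] G2[of x] by (simp add: min_def)
  define Z where "Z = (\<lambda>x. 2 * G x * f x - (1 - 2 * y x) * (G x)\<^sup>2 / (y x * (1 - y x)))"
  define Z' where "Z' = (\<lambda>x. q x * (f x)\<^sup>2 + 2 * G x * F' x + 2 * q x * (G x)\<^sup>2 / (y x * (1 - y x))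
      + q x * (f x - (1 - 2 * y x) * G x / (y x * (1 - y x)))\<^sup>2)"
  have Gc: "continuous_on A G" for A by (rule DERIV_at_continuous_on[OF G])
  have ne: "y x * (1 - y x) \<noteq> 0" for x by (rule less_imp_neq[OF Y, symmetric])
  have Zd: "(Z has_real_derivative Z' x) (at x)" for x
  proof -
    have "(f has_real_derivative F' x) (at x)" unfolding f_def by (auto intro!: derivative_eq_intros F(1))
    note d = this G[of x] y(1)[of x]
    have "((\<lambda>x. 2 * G x * f x - (1 - 2 * y x) * (G x)\<^sup>2 / (y x * (1 - y x))) has_real_derivative
        2 * (q x * f x) * f x + 2 * G x * F' x
        - (((- 2 * q x) * (G x)\<^sup>2 + (1 - 2 * y x) * (2 * G x * (q x * f x))) * (y x * (1 - y x))
           - (1 - 2 * y x) * (G x)\<^sup>2 * (q x * (1 - 2 * y x))) / ((y x * (1 - y x)) * (y x * (1 - y x)))) (at x)"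
      by (rule derivative_eq_intros d ne refl | simp add: algebra_simps)+
    also have "2 * (q x * f x) * f x + 2 * G x * F' x
        - (((- 2 * q x) * (G x)\<^sup>2 + (1 - 2 * y x) * (2 * G x * (q x * f x))) * (y x * (1 - y x))
           - (1 - 2 * y x) * (G x)\<^sup>2 * (q x * (1 - 2 * y x))) / ((y x * (1 - y x)) * (y x * (1 - y x))) = Z' x"
    proof -
      define P where "P = y x * (1 - y x)"
      have P: "P \<noteq> 0" using ne by (simp add: P_def)
      show ?thesis unfolding Z'_def P_def[symmetric] using P by (simp add: field_simps power2_eq_square)
    qed
    finally show ?thesis unfolding Z_def .
  qed
  have Z'c: "continuous_on UNIV Z'"
    unfolding Z'_def by (intro continuous_intros y(2) fc Gc F(2) yc) (use ne in auto)
  \<comment> \<open>The gap is (l F' + G)^2 / l, plus the square in \<open>Z'\<close>, plus 2 (q /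
    (y (1 - y)) - k) G^2, which is nonnegative by the lower bound on q.\<close>
  have pt: "q x * (f x)\<^sup>2 - l * (F' x)\<^sup>2 \<le> Z' x" for x
  proof -
    have "0 \<le> (l * F' x + G x)\<^sup>2 / l" using l by simp
    also have "\<dots> = l * (F' x)\<^sup>2 + 2 * G x * F' x + (G x)\<^sup>2 / l"
      using l by (simp add: power2_eq_square field_simps)
    also have "(G x)\<^sup>2 / l = 2 * k * (G x)\<^sup>2" by (simp add: l_def)
    also have "2 * k * (G x)\<^sup>2 \<le> 2 * q x * (G x)\<^sup>2 / (y x * (1 - y x))"
    proof -
      have "k \<le> q x / (y x * (1 - y x))" using k(2)[of x] Y[of x] by (simp add: pos_le_divide_eq)
      from mult_right_mono[OF this, of "2 * (G x)\<^sup>2"] show ?thesis by (simp add: mult_ac)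
    qed
    finally have "0 \<le> l * (F' x)\<^sup>2 + 2 * G x * F' x + 2 * q x * (G x)\<^sup>2 / (y x * (1 - y x))" by simp
    moreover have "0 \<le> q x * (f x - (1 - 2 * y x) * G x / (y x * (1 - y x)))\<^sup>2" using q0[of x] by simp
    ultimately show ?thesis unfolding Z'_def by linarith
  qed
  \<comment> \<open>Both terms of Z are controlled by the distance of y to the nearer endpoint: |G|
    \<le> B min(y, 1 - y) and y (1 - y) \<ge> min(y, 1 - y) / 2, so the quotient is not singular in
    the tails.\<close>
  have Zb: "\<bar>Z x\<bar> \<le> 4 * B\<^sup>2 * min (y x) (1 - y x)" for x
  proof -
    define mn where "mn = min (y x) (1 - y x)"
    have mn: "mn > 0" "y x * (1 - y x) \<ge> mn / 2"
      using y01[of x] mult_left_mono[of "1/2" "1 - y x" "y x"] mult_right_mono[of "1/2" "y x" "1 - y x"]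
      by (auto simp: mn_def min_def)
    have "\<bar>2 * G x * f x\<bar> \<le> 2 * (B * mn) * B"
      unfolding abs_mult using Gm[of x] B[of x] B0 mn by (intro mult_mono) (auto simp: mn_def)
    moreover have "\<bar>(1 - 2 * y x) * (G x)\<^sup>2 / (y x * (1 - y x))\<bar> \<le> 2 * B\<^sup>2 * mn"
    proof -
      have "\<bar>(1 - 2 * y x) * (G x)\<^sup>2 / (y x * (1 - y x))\<bar> = \<bar>1 - 2 * y x\<bar> * ((G x)\<^sup>2 / (y x * (1 - y x)))"
        using y01[of x] by (simp add: abs_mult)
      also have "\<dots> \<le> 1 * ((B * mn)\<^sup>2 / (mn / 2))"
      proof (intro mult_mono frac_le)
        show "(G x)\<^sup>2 \<le> (B * mn)\<^sup>2" using Gm[of x] by (simp add: mn_def abs_le_square_iff[symmetric])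
      qed (use y01[of x] mn in auto)
      also have "\<dots> = 2 * B\<^sup>2 * mn" using mn by (simp add: power2_eq_square)
      finally show ?thesis .
    qed
    moreover have "2 * (B * mn) * B = 2 * B\<^sup>2 * mn" by (simp add: power2_eq_square)
    moreover have "\<bar>Z x\<bar> \<le> \<bar>2 * G x * f x\<bar> + \<bar>(1 - 2 * y x) * (G x)\<^sup>2 / (y x * (1 - y x))\<bar>"
      unfolding Z_def by (rule abs_triangle_ineq4)
    ultimately show ?thesis unfolding mn_def[symmetric] by linarith
  qed
  have Zlim: "(\<lambda>n. Z (real n) - Z (- real n)) \<longlonglongrightarrow> 0 - 0"
  proof (rule tendsto_diff)
    have z: "(Z \<longlongrightarrow> 0) FF" if "((\<lambda>x. min (y x) (1 - y x)) \<longlongrightarrow> 0) FF" for FF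
      by (rule Lim_null_comparison[OF _ tendsto_mult_right_zero[OF that, of "4 * B\<^sup>2"]]) (use Zb in simp)
    show "(\<lambda>n. Z (real n)) \<longlonglongrightarrow> 0"
      by (rule filterlim_compose[OF z[OF min_tail_tendsto_0(2)[OF ylim]] filterlim_real_sequentially])
    show "(\<lambda>n. Z (- real n)) \<longlonglongrightarrow> 0"
      by (rule filterlim_compose[OF z[OF min_tail_tendsto_0(1)[OF ylim]]
          filterlim_compose[OF filterlim_uminus_at_bot_at_top filterlim_real_sequentially]])
  qed
  have ih: "integrable lborel (\<lambda>x. q x * (f x)\<^sup>2 - l * (F' x)\<^sup>2)"
    using iqf2 L2_square_integrable[OF F(4)] by auto
  have "(LBINT x. q x * (f x)\<^sup>2 - l * (F' x)\<^sup>2) \<le> 0 - 0"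
  proof (rule tendsto_le[OF sequentially_bot Zlim integral_window_tendsto[OF ih, of 0]])
    have "(LBINT x. indicator {0 - real n..0 + real n} x * (q x * (f x)\<^sup>2 - l * (F' x)\<^sup>2)) \<le> Z (real n) - Z (- real n)" for n
    proof -
      have "(LBINT x. indicator {0 - real n..0 + real n} x * (q x * (f x)\<^sup>2 - l * (F' x)\<^sup>2))
          \<le> (LBINT x. indicator {- real n..real n} x * Z' x)"
      proof (rule integral_mono)
        show "integrable lborel (\<lambda>x. indicator {0 - real n..0 + real n} x * (q x * (f x)\<^sup>2 - l * (F' x)\<^sup>2))"
          using integrable_mult_indicator[OF _ ih, of "{0 - real n..0 + real n}"] by simp
        show "integrable lborel (\<lambda>x. indicator {- real n..real n} x * Z' x)"
          using borel_integrable_atLeastAtMost'[OF continuous_on_subset[OF Z'c subset_UNIV]]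
          by (simp add: set_integrable_def)
      qed (use pt in \<open>auto simp: indicator_def\<close>)
      also have "\<dots> = Z (real n) - Z (- real n)" by (rule FTC_indicator[OF Zd Z'c]) simp
      finally show ?thesis .
    qed
    then show "\<forall>\<^sub>F n in sequentially. (LBINT x. indicator {0 - real n..0 + real n} x * (q x * (f x)\<^sup>2 - l * (F' x)\<^sup>2)) \<le> Z (real n) - Z (- real n)"
      by simp
  qed
  then have "(LBINT x. q x * (f x)\<^sup>2) \<le> l * (LBINT x. (F' x)\<^sup>2)"
    using iqf2 L2_square_integrable[OF F(4)] by simp
  moreover have "(LBINT x. q x * (f x)\<^sup>2) = (LBINT x. q x * (F x)\<^sup>2) - m\<^sup>2"
  proof -
    have "(\<lambda>x. q x * (f x)\<^sup>2) = (\<lambda>x. q x * (F x)\<^sup>2 - 2 * m * (q x * F x) + m\<^sup>2 * q x)"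
      by (auto simp: f_def power2_eq_square algebra_simps)
    then have "(LBINT x. q x * (f x)\<^sup>2) = (LBINT x. q x * (F x)\<^sup>2) - 2 * m * m + m\<^sup>2 * 1"
      using iqF2 iqF q by (simp add: m_def)
    then show ?thesis by (simp add: power2_eq_square)
  qed
  ultimately show ?thesis by (simp add: m_def l_def)
qed

section \<open>The shock profile\<close>

text \<open>Passage from C1 to weakly differentiable functions: q is bounded and square integrable,
  so the weighted moments of the mollified functions converge, and mollification does not increase
  the norm of the derivative.\<close>

lemma weighted_Poincare:
  assumes y: "\<And>x. (y has_real_derivative q x) (at x)" "continuous_on UNIV q"
    and y01: "\<And>x. 0 < y x" "\<And>x. y x < 1" and ylim: "(y \<longlongrightarrow> 0) at_bot" "(y \<longlongrightarrow> 1) at_top"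
    and k: "k > 0" "\<And>x. k * (y x * (1 - y x)) \<le> q x"
    and q: "integrable lborel q" "(LBINT x. q x) = 1" "L2 q" "\<And>x. \<bar>q x\<bar> \<le> B"
    and w: "weak_deriv f g" and L: "L2 f" "L2 g"
  shows "(LBINT x. q x * (f x)\<^sup>2) - (LBINT x. q x * f x)\<^sup>2 \<le> 1 / (2 * k) * (norm2 g)\<^sup>2"
proof -
  let ?F = "\<lambda>n. conv f (mollifier n)" and ?G = "\<lambda>n. conv g (mollifier n)"
  have qm: "q \<in> borel_measurable borel" by (rule L2_measurable[OF q(3)])
  have B: "B \<ge> 0" using q(4)[of 0] by linarith
  have FL: "L2 (?F n)" "L2 (?G n)" for n by (intro L2_conv L mollifier)+
  have FG: "(?F n has_real_derivative ?G n x) (at x)" for n x by (rule conv_DERIV_weak[OF w mollifier(1)])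
  have Gc: "continuous_on UNIV (?G n)" for n by (intro conv_continuous L2_loc_integrable L mollifier)
  have md: "(\<lambda>n. norm2 (\<lambda>x. q x * ?F n x - q x * f x)) \<longlonglongrightarrow> 0"
  proof -
    have "(\<lambda>n. norm2 (\<lambda>x. q x * (?F n x - f x))) \<longlonglongrightarrow> 0"
      using q B qm by (intro norm2_bounded_mult_tendsto_0[where B=B] L2_diff FL L mollify_tendsto) auto
    then show ?thesis by (simp add: right_diff_distrib)
  qed
  note mb = L2_mult_bounded[OF _ qm q(4)]
  have 1: "(\<lambda>n. LBINT x. (q x * ?F n x) * ?F n x) \<longlonglongrightarrow> (LBINT x. (q x * f x) * f x)"
    by (rule tendsto_inner_L2) (auto intro!: L FL mb md mollify_tendsto always_eventually)
  have 2: "(\<lambda>n. LBINT x. ?F n x * q x) \<longlonglongrightarrow> (LBINT x. f x * q x)"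
    by (rule conv_mollifier_inner[OF L(1) q(3)])
  have "(LBINT x. (q x * f x) * f x) - (LBINT x. f x * q x)\<^sup>2 \<le> 1 / (2 * k) * (norm2 g)\<^sup>2"
  proof (rule LIMSEQ_le_const2)
    show "(\<lambda>n. (LBINT x. (q x * ?F n x) * ?F n x) - (LBINT x. ?F n x * q x)\<^sup>2)
      \<longlonglongrightarrow> (LBINT x. (q x * f x) * f x) - (LBINT x. f x * q x)\<^sup>2"
      by (intro tendsto_intros 1 2)
    have "(LBINT x. (q x * ?F n x) * ?F n x) - (LBINT x. ?F n x * q x)\<^sup>2 \<le> 1 / (2 * k) * (norm2 g)\<^sup>2" for n
    proof -
      have "(LBINT x. q x * (?F n x)\<^sup>2) - (LBINT x. q x * ?F n x)\<^sup>2 \<le> 1 / (2 * k) * (LBINT x. (?G n x)\<^sup>2)"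
        by (rule weighted_Poincare_C1[OF y y01 ylim k q(1,2) FG Gc FL])
      also have "\<dots> \<le> 1 / (2 * k) * (norm2 g)\<^sup>2"
        unfolding norm2_power2[symmetric] using k(1) norm2_conv_mollifier[OF L(2), of n]
        by (intro mult_left_mono power_mono) auto
      finally show ?thesis by (simp add: power2_eq_square mult_ac)
    qed
    then show "\<exists>N. \<forall>n\<ge>N. (LBINT x. (q x * ?F n x) * ?F n x) - (LBINT x. ?F n x * q x)\<^sup>2 \<le> 1 / (2 * k) * (norm2 g)\<^sup>2"
      by blast
  qed
  then show ?thesis by (simp add: power2_eq_square mult_ac)
qed

text \<open>Gronwall in both directions: E exp(- C x) is nonincreasing and E exp(C x) is
  nondecreasing, so a zero of E spreads to the whole line.\<close>

lemma differential_inequality_zero: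
  fixes E :: "real \<Rightarrow> real"
  assumes d: "\<And>x. (E has_real_derivative E' x) (at x)" and b: "\<And>x. \<bar>E' x\<bar> \<le> C * E x" "\<And>x. E x \<ge> 0"
    and a: "E a = 0"
  shows "E x = 0"
proof (cases "a \<le> x")
  case True
  have "E x * exp (- C * x) \<le> E a * exp (- C * a)"
  proof (rule DERIV_nonpos_imp_nonincreasing[OF True, where f="\<lambda>x. E x * exp (- C * x)"])
    fix z
    have "((\<lambda>x. E x * exp (- C * x)) has_real_derivative (E' z - C * E z) * exp (- C * z)) (at z)"
      by (auto intro!: derivative_eq_intros d simp: algebra_simps)
    moreover have "(E' z - C * E z) * exp (- C * z) \<le> 0"
      using b(1)[of z] by (intro mult_nonpos_nonneg) (auto simp: abs_le_iff)
    ultimately show "\<exists>y. ((\<lambda>x. E x * exp (- C * x)) has_real_derivative y) (at z) \<and> y \<le> 0" by blast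
  qed
  then show ?thesis using a b(2)[of x] by (simp add: mult_le_0_iff not_le[symmetric])
next
  case False
  have "E x * exp (C * x) \<le> E a * exp (C * a)"
  proof (rule DERIV_nonneg_imp_nondecreasing[where f="\<lambda>x. E x * exp (C * x)"])
    fix z
    have "((\<lambda>x. E x * exp (C * x)) has_real_derivative (E' z + C * E z) * exp (C * z)) (at z)"
      by (auto intro!: derivative_eq_intros d simp: algebra_simps)
    moreover have "(E' z + C * E z) * exp (C * z) \<ge> 0"
      using b(1)[of z] by (intro mult_nonneg_nonneg) (auto simp: abs_le_iff)
    ultimately show "\<exists>y. ((\<lambda>x. E x * exp (C * x)) has_real_derivative y) (at z) \<and> y \<ge> 0" by blast
  qed (use False in simp)
  then show ?thesis using a b(2)[of x] by (simp add: mult_le_0_iff not_le[symmetric])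
qed

locale monotone_shock =
  fixes eps delta um up :: real and ut :: "real \<Rightarrow> real"
  assumes eps: "eps > 0" and delta: "delta > 0" and ums: "um > up"
    and small: "delta * (um - up) / (2 * eps\<^sup>2) \<le> 1 / 4"
    and shock: "vd_shock eps delta um up ut"
    and shock_mono: "mono ut \<or> antimono ut"
begin

definition "A = um - up"
definition "\<sigma> = (um + up) / 2"
definition "ut1 = deriv ut"
definition "ut2 = deriv ut1"
definition "ut3 = deriv ut2"
definition "y x = (um - ut x) / A"
definition "q x = - ut1 x / A"
definition "q' x = - ut2 x / A"
text \<open>\<open>k0 = \<kappa> A / (2 eps)\<close> with \<open>\<kappa> = 4 / 5\<close>: the lower bound \<open>q_lower\<close> needs \<open>\<kappa> + \<kappa>\<^sup>2 / 4 \<le> 1\<close>, and the contraction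
  needs \<open>1 / (2 \<kappa>) \<le> 1 - Cstar / 2\<close>.\<close>
definition "k0 = 2 * A / (5 * eps)"
text \<open>The constant in |q'| \<le> \<open>C2\<close> q: it arises from the integrated profile
  equation \<open>q'_eq\<close> when y (1 - y) is bounded by q / \<open>k0\<close>.\<close>

definition "C2 = (eps + A / (2 * k0)) / delta"

section \<open>Regularity, monotonicity and limits of the profile\<close>

lemma A_pos: "A > 0" using ums by (simp add: A_def)
lemma A_neq [simp]: "A \<noteq> 0" using A_pos by simp
lemma k0_pos: "k0 > 0" using A_pos eps by (simp add: k0_def)
lemma C2_pos: "C2 > 0" using A_pos eps delta k0_pos by (auto simp: C2_def intro!: divide_pos_pos add_pos_pos)

lemma ut_smooth: "smooth_fun ut" "smooth_fun ut1" "smooth_fun ut2" "smooth_fun ut3"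
  using shock smooth_fun_deriv by (auto simp: vd_shock_def ut1_def ut2_def ut3_def)

lemma ut_DERIV: "(ut has_real_derivative ut1 x) (at x)" "(ut1 has_real_derivative ut2 x) (at x)"
  "(ut2 has_real_derivative ut3 x) (at x)"
  using ut_smooth smooth_fun_DERIV ut1_def ut2_def ut3_def by metis+

lemma ut_cont: "continuous_on S ut" "continuous_on S ut1" "continuous_on S ut2" "continuous_on S ut3"
  using ut_smooth smooth_fun_continuous by blast+

lemma ut_lim: "(ut \<longlongrightarrow> um) at_bot" "(ut \<longlongrightarrow> up) at_top" "(ut1 \<longlongrightarrow> 0) at_bot" "(ut1 \<longlongrightarrow> 0) at_top"
  using shock by (auto simp: vd_shock_def ut1_def)

lemma ut_ode: "- \<sigma> * ut1 x + ut x * ut1 x = eps * ut2 x - delta * ut3 x"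
  using shock by (simp add: vd_shock_def ut1_def ut2_def ut3_def \<sigma>_def numeral_2_eq_2 numeral_3_eq_3)

lemma ut_antimono: "antimono ut"
proof (rule ccontr)
  assume "\<not> antimono ut"
  then have m: "mono ut" using shock_mono by blast
  have "um \<le> ut 0"
    by (rule tendsto_upperbound[OF ut_lim(1)]) (use m in \<open>auto simp: eventually_at_bot_linorder mono_def intro!: exI[of _ 0]\<close>)
  moreover have "ut 0 \<le> up"
    by (rule tendsto_lowerbound[OF ut_lim(2)]) (use m in \<open>auto simp: eventually_at_top_linorder mono_def intro!: exI[of _ 0]\<close>)
  ultimately show False using ums by simp
qed

lemma ut_bounds: "ut x \<le> um" "up \<le> ut x"
proof -
  show "ut x \<le> um"
    by (rule tendsto_lowerbound[OF ut_lim(1)]) (use ut_antimono in \<open>auto simp: eventually_at_bot_linorder antimono_def intro!: exI[of _ x]\<close>)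
  show "up \<le> ut x"
    by (rule tendsto_upperbound[OF ut_lim(2)]) (use ut_antimono in \<open>auto simp: eventually_at_top_linorder antimono_def intro!: exI[of _ x]\<close>)
qed

lemma ut1_nonpos: "ut1 x \<le> 0"
proof (rule tendsto_upperbound)
  show "((\<lambda>h. (ut (x + h) - ut x) / h) \<longlongrightarrow> ut1 x) (at 0)" using ut_DERIV(1)[of x] by (simp add: DERIV_def)
  have "(ut (x + h) - ut x) / h \<le> 0" for h
  proof (cases "h \<ge> 0")
    case True
    then have "ut (x + h) \<le> ut x" using ut_antimono by (simp add: antimono_def)
    then show ?thesis using True by (simp add: divide_le_0_iff)
  next
    case False
    then have "ut (x + h) \<ge> ut x" using ut_antimono by (simp add: antimono_def)
    then show ?thesis using False by (simp add: divide_le_0_iff)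
  qed
  then show "\<forall>\<^sub>F h in at 0. (ut (x + h) - ut x) / h \<le> 0" by simp
qed simp

lemma y_q: "(y has_real_derivative q x) (at x)" "(q has_real_derivative q' x) (at x)"
  unfolding y_def[abs_def] q_def[abs_def] q'_def
  by (auto intro!: derivative_eq_intros ut_DERIV simp: A_pos less_imp_neq)

lemma y_q_cont: "continuous_on S y" "continuous_on S q" "continuous_on S q'"
  unfolding y_def[abs_def] q_def[abs_def] q'_def[abs_def] by (intro continuous_intros ut_cont; use A_pos in simp)+

lemma ut_y: "ut x = um - A * y x" "ut1 x = - A * q x" "ut2 x = - A * q' x"
  using A_pos by (simp_all add: y_def q_def q'_def)

lemma y_le: "0 \<le> y x" "y x \<le> 1" and q_nonneg: "0 \<le> q x"
  using ut_bounds[of x] ut1_nonpos[of x] A_pos by (auto simp: y_def q_def A_def divide_le_0_iff)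

lemma y_lim: "(y \<longlongrightarrow> 0) at_bot" "(y \<longlongrightarrow> 1) at_top" and q_lim: "(q \<longlongrightarrow> 0) at_bot" "(q \<longlongrightarrow> 0) at_top"
proof -
  have 1: "A \<noteq> 0" using A_pos by simp
  show "(y \<longlongrightarrow> 0) at_bot" using tendsto_divide[OF tendsto_diff[OF tendsto_const ut_lim(1)] tendsto_const 1, of um]
    by (simp add: y_def[abs_def])
  show "(y \<longlongrightarrow> 1) at_top" using tendsto_divide[OF tendsto_diff[OF tendsto_const ut_lim(2)] tendsto_const 1, of um] 1
    by (simp add: y_def[abs_def] A_def[symmetric])
  show "(q \<longlongrightarrow> 0) at_bot" "(q \<longlongrightarrow> 0) at_top"
    using tendsto_divide[OF tendsto_minus[OF ut_lim(3)] tendsto_const 1] tendsto_divide[OF tendsto_minus[OF ut_lim(4)] tendsto_const 1]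
    by (simp_all add: q_def[abs_def])
qed

text \<open>The third order profile equation integrated once, in the coordinate y. The integrated
  quantity H is constant, and its value 0 is found at plus infinity. Convergence is known only for
  the profile and its first derivative, so q' is evaluated at mean value points z n, where it equals
  q(n + 1) - q(n).\<close>

lemma q'_eq: "delta * q' x = eps * q x - A / 2 * (y x * (1 - y x))"
proof -
  define H where "H = (\<lambda>x. delta * q' x - eps * q x + A / 2 * (y x * (1 - y x)))"
  have "(H has_real_derivative 0) (at x)" for x
  proof -
    have dq': "(q' has_real_derivative - ut3 x / A) (at x)"
      unfolding q'_def[abs_def] by (auto intro!: derivative_eq_intros ut_DERIV simp: A_pos less_imp_neq)
    have "(H has_real_derivative delta * (- ut3 x / A) - eps * q' x + A / 2 * (q x * (1 - y x) - y x * q x)) (at x)"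
      unfolding H_def by (auto intro!: derivative_eq_intros dq' y_q simp: algebra_simps)
    also have "delta * (- ut3 x / A) - eps * q' x + A / 2 * (q x * (1 - y x) - y x * q x) = 0"
    proof -
      have "delta * ut3 x = eps * ut2 x + \<sigma> * ut1 x - ut x * ut1 x" using ut_ode[of x] by simp
      also have "\<dots> = - A * eps * q' x - A * \<sigma> * q x + (um - A * y x) * (A * q x)"
        by (simp add: ut_y)
      finally have "delta * ut3 x = A * (- eps * q' x - \<sigma> * q x + (um - A * y x) * q x)" by (simp add: algebra_simps)
      then have "delta * (- ut3 x / A) = - (- eps * q' x - \<sigma> * q x + (um - A * y x) * q x)" using A_pos by simp
      \<comment> \<open>The speed is the midpoint of the end states; this produces the factor y (1 -
        y), which vanishes at both ends.\<close>
      have "um - \<sigma> = A / 2" by (simp add: \<sigma>_def A_def field_simps)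
      then have "um = \<sigma> + A / 2" by simp
      have "(um - A * y x) * q x = \<sigma> * q x + A / 2 * q x - A * (y x * q x)"
        by (subst \<open>um = \<sigma> + A / 2\<close>) (simp add: algebra_simps)
      moreover have "A / 2 * (q x * (1 - y x) - y x * q x) = A / 2 * q x - A * (y x * q x)" by (simp add: algebra_simps)
      ultimately show ?thesis using \<open>delta * (- ut3 x / A) = _\<close> by linarith
    qed
    finally show ?thesis .
  qed
  then have Hc: "H x = H z" for x z using DERIV_isconst_all by blast
  have "\<exists>z. real n < z \<and> z < real n + 1 \<and> q (real n + 1) - q (real n) = q' z" for n
    using MVT2[of "real n" "real n + 1" q q'] y_q(2) by auto
  then obtain z where z: "\<And>n. real n < z n" "\<And>n. q (real n + 1) - q (real n) = q' (z n)" by metis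
  have zt: "filterlim z at_top sequentially"
    by (rule filterlim_at_top_mono[OF filterlim_real_sequentially]) (use z(1) in \<open>auto intro: always_eventually less_imp_le\<close>)
  have q1: "(\<lambda>n. q (real n + 1)) \<longlonglongrightarrow> 0"
    by (rule filterlim_compose[OF q_lim(2)]) (auto intro!: filterlim_tendsto_add_at_top filterlim_real_sequentially tendsto_const simp: add.commute[of _ 1])
  have q'z: "(\<lambda>n. q' (z n)) \<longlonglongrightarrow> 0 - 0"
    unfolding z(2)[symmetric] by (intro tendsto_diff q1 filterlim_compose[OF q_lim(2) filterlim_real_sequentially])
  have "(\<lambda>n. H (z n)) \<longlonglongrightarrow> delta * (0 - 0) - eps * 0 + A / 2 * (1 * (1 - 1))"
    unfolding H_def by (intro tendsto_intros q'z filterlim_compose[OF q_lim(2) zt] filterlim_compose[OF y_lim(2) zt])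
  moreover have "(\<lambda>n. H (z n)) = (\<lambda>n. H x)" using Hc by blast
  ultimately have "(\<lambda>n. H x) \<longlonglongrightarrow> 0" by simp
  then have "H x = 0" by (simp add: LIMSEQ_const_iff)
  then show ?thesis by (simp add: H_def)
qed

lemma Y_nonneg: "y x * (1 - y x) \<ge> 0" using y_le[of x] by simp

text \<open>A comparison argument: \<open>P = q - k0 y (1 - y)\<close> satisfies \<open>P' \<le> c P\<close> with \<open>c > 0\<close>, so that a negative value of
  \<open>P\<close> could not decay at infinity.\<close>
lemma q_lower: "k0 * (y x * (1 - y x)) \<le> q x"
proof (rule ccontr)
  assume n: "\<not> k0 * (y x * (1 - y x)) \<le> q x"
  define P where "P = (\<lambda>x. q x - k0 * (y x * (1 - y x)))"
  define P' where "P' = (\<lambda>x. q' x - k0 * (q x * (1 - y x) - y x * q x))"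
  define c where "c = eps / delta + k0"
  have c: "c > 0" using eps delta k0_pos by (simp add: c_def add_pos_pos)
  have dP: "(P has_real_derivative P' x) (at x)" for x
    unfolding P_def P'_def by (auto intro!: derivative_eq_intros y_q)
  \<comment> \<open>With \<kappa> = 4/5 the left side is (A / 2) (\<kappa> + \<kappa>^2 delta A / (2
    eps^2)), and the smallness hypothesis bounds the last quotient by 1/4.\<close>
  have kk: "delta * k0\<^sup>2 + eps * k0 \<le> A / 2"
  proof -
    have "delta * A \<le> eps\<^sup>2 / 2" using small eps by (simp add: A_def field_simps)
    then have "delta * A / eps\<^sup>2 \<le> 1 / 2" using eps by (simp add: field_simps)
    have "delta * k0\<^sup>2 + eps * k0 = 4 / 25 * (delta * A / eps\<^sup>2) * A + 2 / 5 * A"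
      using eps by (simp add: k0_def field_simps power2_eq_square)
    also have "\<dots> \<le> 4 / 25 * (1 / 2) * A + 2 / 5 * A"
      using \<open>delta * A / eps\<^sup>2 \<le> 1 / 2\<close> A_pos by (intro add_mono mult_right_mono mult_left_mono) auto
    also have "\<dots> \<le> A / 2" using A_pos by simp
    finally show ?thesis .
  qed
  have le: "P' z \<le> c * P z" for z
  proof -
    define Y where "Y = y z * (1 - y z)"
    have Y0: "Y \<ge> 0" using Y_nonneg by (simp add: Y_def)
    have e: "q' z = (eps * q z - A / 2 * Y) / delta" using q'_eq[of z] delta by (simp add: Y_def field_simps)
    \<comment> \<open>With c = eps / delta + \<open>k0\<close> the terms eps q cancel, and the other
      terms linear in q combine to - 2 delta k0 q (1 - y), which has a favourable sign.\<close>
    have "delta * (P' z - c * P z) = (eps * q z - A / 2 * Y) - delta * k0 * q z * (1 - 2 * y z) - (eps + delta * k0) * (q z - k0 * Y)"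
      unfolding P'_def P_def c_def e Y_def[symmetric] using delta by (simp add: field_simps)
    also have "\<dots> = Y * (delta * k0\<^sup>2 + eps * k0 - A / 2) - 2 * (delta * k0 * q z * (1 - y z))"
      by (simp add: algebra_simps power2_eq_square)
    also have "\<dots> \<le> 0"
    proof -
      have "0 \<le> delta * k0 * q z * (1 - y z)"
        using delta k0_pos q_nonneg[of z] y_le(2)[of z] by (intro mult_nonneg_nonneg) auto
      moreover have "Y * (delta * k0\<^sup>2 + eps * k0 - A / 2) \<le> 0" using kk by (intro mult_nonneg_nonpos Y0) simp
      ultimately show ?thesis by linarith
    qed
    finally show ?thesis using delta by (simp add: mult_le_0_iff)
  qed
  have "P z \<le> P x" if z: "x \<le> z" for z
  proof -
    have "P z * exp (- c * z) \<le> P x * exp (- c * x)"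
    proof (rule DERIV_nonpos_imp_nonincreasing[OF z, where f="\<lambda>x. P x * exp (- c * x)"])
      fix s
      have "((\<lambda>x. P x * exp (- c * x)) has_real_derivative (P' s - c * P s) * exp (- c * s)) (at s)"
        by (auto intro!: derivative_eq_intros dP simp: algebra_simps)
      moreover have "(P' s - c * P s) * exp (- c * s) \<le> 0"
        using le[of s] by (intro mult_nonpos_nonneg) auto
      ultimately show "\<exists>y. ((\<lambda>x. P x * exp (- c * x)) has_real_derivative y) (at s) \<and> y \<le> 0" by blast
    qed
    then have "P z \<le> P x * exp (c * (z - x))"
      by (simp add: exp_minus exp_diff right_diff_distrib field_simps)
    also have "\<dots> \<le> P x * 1"
      using n z c by (intro mult_left_mono_neg) (auto simp: P_def)
    finally show ?thesis by simp
  qed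
  moreover have "(P \<longlongrightarrow> 0 - k0 * (1 * (1 - 1))) at_top"
    unfolding P_def by (intro tendsto_intros q_lim y_lim)
  ultimately have "0 \<le> P x"
    using tendsto_upperbound[of P 0 at_top "P x"] by (auto simp: eventually_at_top_linorder)
  then show False using n by (simp add: P_def)
qed

text \<open>At a zero of y the function is minimal, so q vanishes too and (y, q) sits at an
  equilibrium of the planar profile system. Gronwall applied to y^2 + q^2 makes y constant, against
  its limits. The value 1 is excluded in the same way with 1 - y.\<close>

lemma y_strict: "0 < y x" "y x < 1"
proof -
  have q0: "q a = 0" if "\<And>z. y a \<le> y z" for a
    using DERIV_local_min[OF y_q(1), of 1 a] that by simp
  have q1: "q a = 0" if "\<And>z. y z \<le> y a" for a
    using DERIV_local_max[OF y_q(1), of 1 a] that by simp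
  define C where "C = 1 + 2 * eps / delta + A / (2 * delta)"
  \<comment> \<open>One estimate for both equilibria: s stands for y with t = 1, or for 1 - y with t
    = -1.\<close>
  have bound: "\<bar>2 * s * t * q z + 2 * q z * q' z\<bar> \<le> C * (s\<^sup>2 + (q z)\<^sup>2)"
    if t: "\<bar>t\<bar> = 1" and s: "\<bar>y z * (1 - y z)\<bar> \<le> \<bar>s\<bar>" for s t z
  proof -
    have sq: "2 * (\<bar>s\<bar> * \<bar>q z\<bar>) \<le> s\<^sup>2 + (q z)\<^sup>2"
      using sum_squares_bound[of "\<bar>s\<bar>" "\<bar>q z\<bar>"] by (simp add: mult.assoc)
    have e: "q' z = (eps * q z - A / 2 * (y z * (1 - y z))) / delta" using q'_eq[of z] delta by (simp add: field_simps)
    have "\<bar>eps * q z - A / 2 * (y z * (1 - y z))\<bar> \<le> eps * \<bar>q z\<bar> + A / 2 * \<bar>y z * (1 - y z)\<bar>"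
      using eps A_pos by (intro order_trans[OF abs_triangle_ineq4]) (simp add: abs_mult)
    also have "\<dots> \<le> eps * \<bar>q z\<bar> + A / 2 * \<bar>s\<bar>" using s A_pos by simp
    finally have "\<bar>q' z\<bar> \<le> (eps * \<bar>q z\<bar> + A / 2 * \<bar>s\<bar>) / delta" using delta by (simp add: e divide_right_mono)
    then have "2 * \<bar>q z\<bar> * \<bar>q' z\<bar> \<le> 2 * \<bar>q z\<bar> * ((eps * \<bar>q z\<bar> + A / 2 * \<bar>s\<bar>) / delta)"
      by (intro mult_left_mono) auto
    also have "\<dots> = 2 * eps / delta * (q z)\<^sup>2 + A / (2 * delta) * (2 * (\<bar>s\<bar> * \<bar>q z\<bar>))"
      using delta by (simp add: field_simps power2_eq_square abs_mult_self_eq)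
    also have "\<dots> \<le> 2 * eps / delta * (s\<^sup>2 + (q z)\<^sup>2) + A / (2 * delta) * (s\<^sup>2 + (q z)\<^sup>2)"
      using sq eps delta A_pos by (intro add_mono mult_left_mono) auto
    finally have "2 * \<bar>q z\<bar> * \<bar>q' z\<bar> \<le> 2 * eps / delta * (s\<^sup>2 + (q z)\<^sup>2) + A / (2 * delta) * (s\<^sup>2 + (q z)\<^sup>2)" .
    moreover have "\<bar>2 * s * t * q z + 2 * q z * q' z\<bar> \<le> 2 * (\<bar>s\<bar> * \<bar>q z\<bar>) + 2 * \<bar>q z\<bar> * \<bar>q' z\<bar>"
      by (rule order_trans[OF abs_triangle_ineq]) (simp add: abs_mult t)
    ultimately show ?thesis using sq unfolding C_def by (simp add: distrib_right)
  qed
  show "0 < y x"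
  proof (rule ccontr)
    assume "\<not> 0 < y x"
    then have y0: "y x = 0" using y_le(1)[of x] by simp
    have "(y z)\<^sup>2 + (q z)\<^sup>2 = 0" for z
    proof (rule differential_inequality_zero[where C=C and a=x and E="\<lambda>z. (y z)\<^sup>2 + (q z)\<^sup>2"])
      show "((\<lambda>z. (y z)\<^sup>2 + (q z)\<^sup>2) has_real_derivative 2 * y z * 1 * q z + 2 * q z * q' z) (at z)" for z
        by (auto intro!: derivative_eq_intros y_q)
      show "\<bar>2 * y z * 1 * q z + 2 * q z * q' z\<bar> \<le> C * ((y z)\<^sup>2 + (q z)\<^sup>2)" for z
        by (rule bound) (use y_le[of z] in \<open>auto simp: abs_mult mult_left_le\<close>)
      show "(y x)\<^sup>2 + (q x)\<^sup>2 = 0" using q0[of x] y0 y_le by simp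
    qed simp
    then have "y = (\<lambda>_. 0)" by (auto simp: sum_power2_eq_zero_iff)
    then show False using y_lim(2) by (simp add: tendsto_const_iff)
  qed
  show "y x < 1"
  proof (rule ccontr)
    assume "\<not> y x < 1"
    then have y1: "y x = 1" using y_le(2)[of x] by simp
    have "(1 - y z)\<^sup>2 + (q z)\<^sup>2 = 0" for z
    proof (rule differential_inequality_zero[where C=C and a=x and E="\<lambda>z. (1 - y z)\<^sup>2 + (q z)\<^sup>2"])
      show "((\<lambda>z. (1 - y z)\<^sup>2 + (q z)\<^sup>2) has_real_derivative 2 * (1 - y z) * (-1) * q z + 2 * q z * q' z) (at z)" for z
        by (auto intro!: derivative_eq_intros y_q simp: algebra_simps)
      show "\<bar>2 * (1 - y z) * (-1) * q z + 2 * q z * q' z\<bar> \<le> C * ((1 - y z)\<^sup>2 + (q z)\<^sup>2)" for z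
        by (rule bound) (use y_le[of z] in \<open>auto simp: abs_mult mult_left_le_one_le\<close>)
      show "(1 - y x)\<^sup>2 + (q x)\<^sup>2 = 0" using q1[of x] y1 y_le by simp
    qed simp
    then have "y = (\<lambda>_. 1)" by (auto simp: sum_power2_eq_zero_iff)
    then show False using y_lim(1) by (simp add: tendsto_const_iff)
  qed
qed

lemma q'_bound: "\<bar>q' x\<bar> \<le> C2 * q x"
proof -
  have "delta * \<bar>q' x\<bar> = \<bar>eps * q x - A / 2 * (y x * (1 - y x))\<bar>"
    using q'_eq[of x] delta by (metis abs_mult abs_of_pos)
  also have "\<dots> \<le> eps * q x + A / 2 * (y x * (1 - y x))"
    using Y_nonneg[of x] q_nonneg[of x] eps A_pos mult_nonneg_nonneg[of eps "q x"] mult_nonneg_nonneg[of "A / 2" "y x * (1 - y x)"]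
    by linarith
  also have "\<dots> \<le> eps * q x + A / 2 * (q x / k0)"
    using q_lower[of x] k0_pos A_pos by (intro add_left_mono mult_left_mono) (auto simp: field_simps)
  also have "\<dots> = delta * C2 * q x" using delta by (simp add: C2_def distrib_right)
  also have "\<dots> = delta * (C2 * q x)" by simp
  finally show ?thesis using delta by simp
qed

text \<open>\<open>C2\<close> y - q is nondecreasing by \<open>q'_bound\<close> and tends to 0 at
  minus infinity, hence is nonnegative.\<close>

lemma q_le: "q x \<le> C2"
proof -
  have m: "C2 * y a - q a \<le> C2 * y b - q b" if "a \<le> b" for a b
  proof (rule DERIV_nonneg_imp_nondecreasing[OF that, where f="\<lambda>z. C2 * y z - q z"])
    fix z
    have "((\<lambda>z. C2 * y z - q z) has_real_derivative C2 * q z - q' z) (at z)" by (auto intro!: derivative_eq_intros y_q)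
    moreover have "C2 * q z - q' z \<ge> 0" using q'_bound[of z] by linarith
    ultimately show "\<exists>y'. ((\<lambda>z. C2 * y z - q z) has_real_derivative y') (at z) \<and> 0 \<le> y'" by blast
  qed
  have "C2 * 0 - 0 \<le> C2 * y x - q x"
  proof (rule tendsto_upperbound)
    show "((\<lambda>a. C2 * y a - q a) \<longlongrightarrow> C2 * 0 - 0) at_bot" by (intro tendsto_intros y_lim q_lim)
    show "\<forall>\<^sub>F a in at_bot. C2 * y a - q a \<le> C2 * y x - q x"
      using m by (auto simp: eventually_at_bot_linorder)
  qed simp
  also have "C2 * y x \<le> C2" using y_le[of x] C2_pos by (simp add: mult_left_le)
  finally show ?thesis using y_le[of x] C2_pos mult_left_le[of "y x" C2] by linarith
qed

section \<open>Integrability of the profile and the Poincare inequality along it\<close>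

lemma q_integrable: "integrable lborel q" and q_integral: "(LBINT x. q x) = 1"
proof -
  have *: "set_integrable lborel (einterval (-\<infinity>) \<infinity>) q" "(LBINT x=-\<infinity>..\<infinity>. q x) = 1 - 0"
    by (rule interval_integral_FTC_nonneg[of "-\<infinity>" "\<infinity>" y q 0 1];
        auto simp: y_q q_nonneg ereal_tendsto_simps y_lim intro: continuous_on_interior[OF y_q_cont(2)[of UNIV]])+
  show "integrable lborel q" using *(1) by (simp add: set_integrable_def)
  show "(LBINT x. q x) = 1" using *(2) by (simp add: interval_lebesgue_integral_def set_lebesgue_integral_def)
qed

lemma q_L2: "L2 q"
  unfolding L2_def
proof
  show m: "q \<in> borel_measurable lborel" using borel_measurable_integrable[OF q_integrable] .
  show "integrable lborel (\<lambda>x. (q x)\<^sup>2)"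
  proof (rule Bochner_Integration.integrable_bound[OF integrable_mult_right[OF q_integrable, of C2]])
    show "AE x in lborel. norm ((q x)\<^sup>2) \<le> norm (C2 * q x)"
      using q_le q_nonneg C2_pos by (auto intro!: AE_I2 mult_right_mono simp: power2_eq_square)
  qed (use m in simp)
qed

lemma ut1_L2: "L2 ut1" and ut2_L2: "L2 ut2"
proof -
  have m: "ut1 \<in> borel_measurable borel" "ut2 \<in> borel_measurable borel" using ut_smooth smooth_fun_measurable by blast+
  show "L2 ut1" by (rule L2_bound[OF L2_cmult[OF q_L2, of "-A"] m(1)]) (simp add: ut_y)
  show "L2 ut2"
  proof (rule L2_bound[OF L2_cmult[OF q_L2, of "A * C2"] m(2)])
    show "\<bar>ut2 x\<bar> \<le> \<bar>A * C2 * q x\<bar>" for x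
      using mult_left_mono[OF q'_bound[of x], of A] A_pos C2_pos q_nonneg[of x] by (simp add: ut_y abs_mult mult.assoc)
  qed
qed

lemma ut1_bound: "\<bar>ut1 x\<bar> \<le> A * C2"
  using q_le[of x] q_nonneg[of x] A_pos by (simp add: ut_y abs_mult)

definition "M0 = \<bar>um\<bar> + \<bar>up\<bar>"

lemma ut_bound: "\<bar>ut x\<bar> \<le> M0"
  using ut_bounds[of x] unfolding M0_def by linarith

text \<open>In the tails min(y, 1 - y) is at most 2 q / k0 by \<open>q_lower\<close>, so the
  deviation from the end states inherits square integrability from q, without any exponential decay
  rate. On the middle interval the difference is bounded.\<close>

lemma ut_diff_L2:
  assumes c: "continuous_on UNIV b" and b: "\<And>x. x \<le> -1 \<Longrightarrow> b x = um" "\<And>x. x \<ge> 1 \<Longrightarrow> b x = up"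
  shows "L2 (\<lambda>x. ut x - b x)"
proof -
  have half: "(y x \<le> 1 / 2 \<longrightarrow> y x \<le> 2 / k0 * q x) \<and> (y x \<ge> 1 / 2 \<longrightarrow> 1 - y x \<le> 2 / k0 * q x)" for x
  proof -
    have *: "y x * (1 - y x) \<le> q x / k0" using q_lower[of x] k0_pos by (simp add: field_simps)
    have "y x * (1 / 2) \<le> y x * (1 - y x)" if "y x \<le> 1 / 2" using that y_le[of x] by (intro mult_left_mono) auto
    moreover have "(1 / 2) * (1 - y x) \<le> y x * (1 - y x)" if "y x \<ge> 1 / 2" using that y_le[of x] by (intro mult_right_mono) auto
    ultimately show ?thesis using * by auto
  qed
  have "\<forall>\<^sub>F x in at_bot. y x < 1 / 2" "\<forall>\<^sub>F x in at_top. y x > 1 / 2"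
    using order_tendstoD(2)[OF y_lim(1), of "1 / 2"] order_tendstoD(1)[OF y_lim(2), of "1 / 2"] by simp_all
  then obtain a1 a2 where a: "\<And>x. x \<le> a1 \<Longrightarrow> y x < 1 / 2" "\<And>x. x \<ge> a2 \<Longrightarrow> y x > 1 / 2"
    by (auto simp: eventually_at_bot_linorder eventually_at_top_linorder)
  define R where "R = \<bar>a1\<bar> + \<bar>a2\<bar> + 1"
  have dc: "continuous_on UNIV (\<lambda>x. ut x - b x)" by (intro continuous_intros ut_cont c)
  have "compact ((\<lambda>x. ut x - b x) ` {-R..R})"
    by (intro compact_continuous_image continuous_on_subset[OF dc]) auto
  then obtain B where B: "\<And>x. x \<in> {-R..R} \<Longrightarrow> \<bar>ut x - b x\<bar> \<le> B"
    by (meson compact_imp_bounded bounded_real imageI)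
  have B0: "B \<ge> 0" using B[of 0] by (force simp: R_def)
  show ?thesis
  proof (rule L2_bound)
    show "L2 (\<lambda>x. A * (2 / k0) * q x + B * indicator {-R..R} x)"
      by (intro L2_add L2_cmult q_L2 L2_indicator) (auto simp: emeasure_lborel_Icc_eq)
    show "(\<lambda>x. ut x - b x) \<in> borel_measurable borel" by (rule borel_measurable_continuous_onI[OF dc])
    fix x
    have p: "0 \<le> A * (2 / k0) * q x" using A_pos k0_pos q_nonneg by (intro mult_nonneg_nonneg) auto
    consider "x \<in> {-R..R}" | "x < -R" | "x > R" by force
    then show "\<bar>ut x - b x\<bar> \<le> \<bar>A * (2 / k0) * q x + B * indicator {-R..R} x\<bar>"
    proof cases
      case 1
      then have "indicator {-R..R} x = (1::real)" by simp
      then show ?thesis using B[OF 1] p by simp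
    next
      case 2
      then have "x \<le> a1" "x \<le> -1" by (auto simp: R_def)
      then have "\<bar>ut x - b x\<bar> = A * y x" using b(1)[of x] A_pos y_le[of x] by (simp add: ut_y(1) abs_mult)
      also have "\<dots> \<le> A * (2 / k0 * q x)" using half[of x] a(1)[OF \<open>x \<le> a1\<close>] A_pos by (intro mult_left_mono) auto
      finally have "\<bar>ut x - b x\<bar> \<le> A * (2 / k0) * q x" by (simp only: mult.assoc)
      moreover have "indicator {-R..R} x = (0::real)" using 2 by simp
      ultimately show ?thesis using p by (simp only: mult_zero_right add_0_right abs_of_nonneg)
    next
      case 3
      then have "x \<ge> a2" "x \<ge> 1" by (auto simp: R_def)
      then have "ut x - b x = A * (1 - y x)" using b(2)[of x] by (simp add: ut_y(1) A_def algebra_simps)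
      then have "\<bar>ut x - b x\<bar> = A * (1 - y x)" using A_pos y_le[of x] by (simp add: abs_mult)
      also have "\<dots> \<le> A * (2 / k0 * q x)" using half[of x] a(2)[OF \<open>x \<ge> a2\<close>] A_pos by (intro mult_left_mono) auto
      finally have "\<bar>ut x - b x\<bar> \<le> A * (2 / k0) * q x" by (simp only: mult.assoc)
      moreover have "indicator {-R..R} x = (0::real)" using 3 by simp
      ultimately show ?thesis using p by (simp only: mult_zero_right add_0_right abs_of_nonneg)
    qed
  qed
qed

text \<open>The bracket on the left is the variance of f under the translated density q, and the
  constant is (A / 2) / (2 k0) = 5 eps / 8.\<close>

lemma Poincare_shock:
  assumes w: "weak_deriv f g" and L: "L2 f" "L2 g"
  shows "A / 2 * ((LBINT x. q (x - c) * (f x)\<^sup>2) - (LBINT x. q (x - c) * f x)\<^sup>2) \<le> 5 / 8 * eps * (norm2 g)\<^sup>2"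
proof -
  have sh: "filterlim (\<lambda>x. x - c) at_bot at_bot" "filterlim (\<lambda>x. x - c) at_top at_top"
  proof -
    have "\<forall>x\<le>Z + c. x - c \<le> Z" "\<forall>x\<ge>Z + c. Z \<le> x - c" for Z by auto
    then show "filterlim (\<lambda>x. x - c) at_bot at_bot" "filterlim (\<lambda>x. x - c) at_top at_top"
      unfolding filterlim_at_bot filterlim_at_top eventually_at_bot_linorder eventually_at_top_linorder by blast+
  qed
  have "(LBINT x. q (x - c) * (f x)\<^sup>2) - (LBINT x. q (x - c) * f x)\<^sup>2 \<le> 1 / (2 * k0) * (norm2 g)\<^sup>2"
  proof (rule weighted_Poincare[where y="\<lambda>x. y (x - c)" and B=C2])
    show "((\<lambda>x. y (x - c)) has_real_derivative q (x - c)) (at x)" for x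
      using DERIV_shift[of y "q (x - c)" x "-c"] y_q(1)[of "x - c"] by simp
    show "continuous_on UNIV (\<lambda>x. q (x - c))"
      by (intro continuous_on_compose2[OF y_q_cont(2)[of UNIV]] continuous_intros) auto
    show "((\<lambda>x. y (x - c)) \<longlongrightarrow> 0) at_bot" "((\<lambda>x. y (x - c)) \<longlongrightarrow> 1) at_top"
      by (rule filterlim_compose[OF y_lim(1) sh(1)], rule filterlim_compose[OF y_lim(2) sh(2)])
    show "integrable lborel (\<lambda>x. q (x - c))"
      using lborel_integrable_real_affine[OF q_integrable, of 1 "-c"] by simp
    show "(LBINT x. q (x - c)) = 1" by (simp add: lborel_integral_shift q_integral)
    show "\<bar>q (x - c)\<bar> \<le> C2" for x using q_le[of "x - c"] q_nonneg[of "x - c"] by simp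
  qed (use y_strict k0_pos q_lower L2_shift[OF q_L2] w L in auto)
  from mult_left_mono[OF this, of "A / 2"] have
    "A / 2 * ((LBINT x. q (x - c) * (f x)\<^sup>2) - (LBINT x. q (x - c) * f x)\<^sup>2) \<le> A / 2 * (1 / (2 * k0) * (norm2 g)\<^sup>2)"
    using A_pos by simp
  also have "\<dots> = 5 / 8 * eps * (norm2 g)\<^sup>2" using A_pos eps by (simp add: k0_def)
  finally show ?thesis .
qed

text \<open>The profile equation convolved with k, with the derivatives on the right carried by the
  kernel. In this form it can be subtracted from the distributional equation for u.\<close>

lemma shock_conv:
  assumes k: "test_fun k"
  shows "\<sigma> * conv ut1 k x = conv (\<lambda>z. (ut z)\<^sup>2 / 2) (deriv k) x - eps * conv ut (deriv (deriv k)) x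
    + delta * conv ut (deriv (deriv (deriv k))) x"
proof -
  note td = test_fun_deriv
  have w: "weak_deriv ut ut1" "weak_deriv ut1 ut2" "weak_deriv ut2 ut3"
    by (rule weak_deriv_C1, rule ut_DERIV, rule ut_cont)+
  have w2: "weak_deriv (\<lambda>z. (ut z)\<^sup>2 / 2) (\<lambda>z. ut z * ut1 z)"
    by (rule weak_deriv_C1) (auto intro!: derivative_eq_intros ut_DERIV continuous_intros ut_cont)
  have li: "loc_integrable (\<lambda>z. ut z * ut1 z)" "loc_integrable ut1" "loc_integrable ut2" "loc_integrable ut3"
    by (intro loc_integrable_continuous continuous_intros ut_cont)+
  have "conv (\<lambda>z. ut z * ut1 z) k x - \<sigma> * conv ut1 k x = eps * conv ut2 k x - delta * conv ut3 k x"
  proof -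
    have "conv (\<lambda>z. ut z * ut1 z - \<sigma> * ut1 z) k x = conv (\<lambda>z. eps * ut2 z - delta * ut3 z) k x"
    proof -
      have "(\<lambda>z. ut z * ut1 z - \<sigma> * ut1 z) = (\<lambda>z. eps * ut2 z - delta * ut3 z)"
      proof
        show "ut z * ut1 z - \<sigma> * ut1 z = eps * ut2 z - delta * ut3 z" for z using ut_ode[of z] by simp
      qed
      then show ?thesis by simp
    qed
    moreover have "conv (\<lambda>z. ut z * ut1 z - \<sigma> * ut1 z) k x = conv (\<lambda>z. ut z * ut1 z) k x - \<sigma> * conv ut1 k x"
      by (subst conv_diff) (auto intro!: loc_integrable_continuous continuous_intros ut_cont k simp: conv_cmult)
    moreover have "conv (\<lambda>z. eps * ut2 z - delta * ut3 z) k x = eps * conv ut2 k x - delta * conv ut3 k x"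
      by (subst conv_diff) (auto intro!: loc_integrable_continuous continuous_intros ut_cont k simp: conv_cmult)
    ultimately show ?thesis by simp
  qed
  then show ?thesis
    using conv_weak_deriv[OF w2 k, of x] conv_weak_deriv[OF w(1) td[OF k], of x] conv_weak_deriv[OF w(2) k, of x]
      conv_weak_deriv[OF w(1) td[OF td[OF k]], of x] conv_weak_deriv[OF w(2) td[OF k], of x] conv_weak_deriv[OF w(3) k, of x]
    by simp
qed

end

section \<open>Energy identity and decay\<close>

lemma ex_antiderivative:
  fixes g :: "real \<Rightarrow> real"
  assumes "continuous_on UNIV g" shows "\<exists>G. \<forall>x. (G has_real_derivative g x) (at x)"
  using einterval_antiderivative[of "-\<infinity>" "\<infinity>" g] assms
  by (auto simp: continuous_on_eq_continuous_at has_real_derivative_iff_has_vector_derivative)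

text \<open>For each x the fundamental theorem applies to P^2 in time; Fubini then exchanges the
  integrals, justified by the uniform L2 bound B. Differentiability in t is needed only pointwise in
  x.\<close>

lemma energy_identity:
  fixes P R :: "real \<Rightarrow> real \<Rightarrow> real"
  assumes ab: "a \<le> b"
    and m: "(\<lambda>(t, x). P t x) \<in> borel_measurable (lborel \<Otimes>\<^sub>M lborel)"
      "(\<lambda>(t, x). R t x) \<in> borel_measurable (lborel \<Otimes>\<^sub>M lborel)"
    and d: "\<And>t x. t \<in> {a..b} \<Longrightarrow> ((\<lambda>t. P t x) has_real_derivative R t x) (at t within {a..b})"
    and c: "\<And>x. continuous_on {a..b} (\<lambda>t. R t x)"
    and L: "\<And>t. t \<in> {a..b} \<Longrightarrow> L2 (P t)" "\<And>t. t \<in> {a..b} \<Longrightarrow> L2 (R t)"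
      "\<And>t. t \<in> {a..b} \<Longrightarrow> norm2 (P t) \<le> B" "\<And>t. t \<in> {a..b} \<Longrightarrow> norm2 (R t) \<le> B"
  shows "integrable lborel (\<lambda>t. indicator {a..b} t * (2 * (LBINT x. P t x * R t x)))"
    and "(norm2 (P b))\<^sup>2 - (norm2 (P a))\<^sup>2 = (LBINT t. indicator {a..b} t * (2 * (LBINT x. P t x * R t x)))"
proof -
  note m[measurable]
  have B: "B \<ge> 0" by (rule order_trans[OF norm2_nonneg L(3)[of a]]) (use ab in simp)
  define h where "h = (\<lambda>(t, x). indicator {a..b} t * (2 * (P t x * R t x)) :: real)"
  have hm[measurable]: "h \<in> borel_measurable (lborel \<Otimes>\<^sub>M lborel)" unfolding h_def by measurable
  have ie: "(LBINT x. h (t, x)) = indicator {a..b} t * (2 * (LBINT x. P t x * R t x))" for t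
    by (simp add: h_def)
  have i1: "integrable lborel (\<lambda>x. h (t, x))" for t
  proof (cases "t \<in> {a..b}")
    case True
    from L2_integrable_mult[OF L(1)[OF True] L(2)[OF True]] show ?thesis
      unfolding h_def by (auto intro!: integrable_mult_right)
  qed (simp add: h_def)
  have hi: "integrable (lborel \<Otimes>\<^sub>M lborel) h"
  proof (rule lborel_pair.Fubini_integrable[OF hm])
    show "AE t in lborel. integrable lborel (\<lambda>x. h (t, x))" using i1 by simp
    show "integrable lborel (\<lambda>t. LBINT x. norm (h (t, x)))"
    proof (rule Bochner_Integration.integrable_bound)
      show "integrable lborel (\<lambda>t. 2 * B\<^sup>2 * indicator {a..b} t)"
        by (intro integrable_mult_right integrable_real_indicator) (auto simp: emeasure_lborel_Icc_eq)
      show "(\<lambda>t. LBINT x. norm (h (t, x))) \<in> borel_measurable lborel" by measurable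
      show "AE t in lborel. norm (LBINT x. norm (h (t, x))) \<le> norm (2 * B\<^sup>2 * indicator {a..b} t)"
      proof (rule AE_I2)
        fix t
        show "norm (LBINT x. norm (h (t, x))) \<le> norm (2 * B\<^sup>2 * indicator {a..b} t)"
        proof (cases "t \<in> {a..b}")
          case True
          have l: "L2 (\<lambda>x. \<bar>P t x\<bar>)" "L2 (\<lambda>x. \<bar>R t x\<bar>)" using L(1,2)[OF True] by (auto simp: L2_def)
          have "(LBINT x. norm (h (t, x))) = 2 * (LBINT x. \<bar>P t x\<bar> * \<bar>R t x\<bar>)"
            using True by (simp add: h_def abs_mult)
          also have "\<dots> \<le> 2 * (norm2 (\<lambda>x. \<bar>P t x\<bar>) * norm2 (\<lambda>x. \<bar>R t x\<bar>))"
            using Cauchy_Schwarz_L2[OF l] by simp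
          also have "\<dots> = 2 * (norm2 (P t) * norm2 (R t))" by (simp add: norm2_def)
          also have "\<dots> \<le> 2 * (B * B)" using L(3,4)[OF True] B by (intro mult_left_mono mult_mono) auto
          finally show ?thesis using True by (simp add: power2_eq_square)
        qed (simp add: h_def)
      qed
    qed
  qed
  show "integrable lborel (\<lambda>t. indicator {a..b} t * (2 * (LBINT x. P t x * R t x)))"
    using lborel_pair.integrable_fst'[OF hi] unfolding ie .
  have ft: "(LBINT t. h (t, x)) = (P b x)\<^sup>2 - (P a x)\<^sup>2" for x
  proof -
    have "(LBINT t. indicator {a..b} t *\<^sub>R (2 * (P t x * R t x))) = (P b x)\<^sup>2 - (P a x)\<^sup>2"
    proof (rule integral_FTC_atLeastAtMost[OF ab])
      fix t assume t: "a \<le> t" "t \<le> b"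
      have "((\<lambda>t. (P t x)\<^sup>2) has_real_derivative 2 * (P t x * R t x)) (at t within {a..b})"
        using d[of t x] t by (auto intro!: derivative_eq_intros)
      then show "((\<lambda>t. (P t x)\<^sup>2) has_vector_derivative 2 * (P t x * R t x)) (at t within {a..b})"
        by (simp add: has_real_derivative_iff_has_vector_derivative)
    next
      have "continuous_on {a..b} (\<lambda>t. P t x)" using d by (rule DERIV_continuous_on)
      then show "continuous_on {a..b} (\<lambda>t. 2 * (P t x * R t x))" by (intro continuous_intros c)
    qed
    then show ?thesis by (simp add: h_def)
  qed
  have "(LBINT t. indicator {a..b} t * (2 * (LBINT x. P t x * R t x))) = (LBINT t. (LBINT x. h (t, x)))"
    by (simp add: ie)
  also have "\<dots> = (LBINT x. (LBINT t. h (t, x)))"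
    using lborel_pair.Fubini_integral[of "\<lambda>t x. h (t, x)"] hi by simp
  also have "\<dots> = (LBINT x. (P b x)\<^sup>2 - (P a x)\<^sup>2)" by (simp add: ft)
  also have "\<dots> = (norm2 (P b))\<^sup>2 - (norm2 (P a))\<^sup>2"
    using L(1)[of a] L(1)[of b] ab by (simp add: norm2_power2 L2_square_integrable)
  finally show "(norm2 (P b))\<^sup>2 - (norm2 (P a))\<^sup>2 = (LBINT t. indicator {a..b} t * (2 * (LBINT x. P t x * R t x)))" ..
qed

text \<open>The integral over [0,b] of a difference quotient of X is the difference of two short
  averages of X, at b and at 0, which converge to the endpoint values. The quotients themselves are
  dominated by the Lipschitz constant and converge almost everywhere to g.\<close>

lemma lipschitz_AE_derivative_primitive:
  fixes X :: "real \<Rightarrow> real"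
  assumes lip: "L-lipschitz_on {0..} X" and g: "continuous_on {0..} g"
    and ae: "AE t in lborel. t > 0 \<longrightarrow> (X has_real_derivative g t) (at t)" and b: "b \<ge> 0"
  shows "X b - X 0 = (LBINT t. indicator {0..b} t * g t)"
proof -
  have Xc: "continuous_on {0..} X" by (rule lipschitz_on_continuous_on[OF lip])
  \<comment> \<open>Constant extension to negative arguments, so that an antiderivative exists on
    the whole line.\<close>
  define Y where "Y = (\<lambda>t. X (max 0 t))"
  have Yc: "continuous_on UNIV Y"
    unfolding Y_def by (intro continuous_on_compose2[OF Xc] continuous_intros) auto
  have [measurable]: "Y \<in> borel_measurable borel" by (rule borel_measurable_continuous_onI[OF Yc])
  have gm: "(\<lambda>t. indicator {0..b} t * g t) \<in> borel_measurable borel"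
    using borel_measurable_continuous_on_indicator[of "{0..b}" g] continuous_on_subset[OF g, of "{0..b}"] by auto
  obtain K where K: "\<And>t. (K has_real_derivative Y t) (at t)" using ex_antiderivative[OF Yc] by blast
  define s where "s = (\<lambda>n. 1 / real (Suc n))"
  have s: "s n > 0" "s \<longlonglongrightarrow> 0" for n unfolding s_def using LIMSEQ_Suc[OF lim_1_over_n] by auto
  have sF: "filterlim s (at 0) sequentially"
    using s by (auto simp: filterlim_at intro!: always_eventually less_imp_neq[symmetric])
  have L0: "L \<ge> 0" using lip by (rule lipschitz_on_nonneg)
  have "(\<lambda>n. LBINT t. indicator {0..b} t * ((Y (t + s n) - Y t) / s n)) \<longlonglongrightarrow> (LBINT t. indicator {0..b} t * g t)"
  proof (rule integral_dominated_convergence)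
    show "integrable lborel (\<lambda>t. L * indicator {0..b} t)"
      by (intro integrable_mult_right integrable_real_indicator) (auto simp: emeasure_lborel_Icc_eq)
    have "AE t in lborel. t \<noteq> 0" by (rule AE_lborel_singleton)
    then show "AE t in lborel. (\<lambda>n. indicator {0..b} t * ((Y (t + s n) - Y t) / s n)) \<longlonglongrightarrow> indicator {0..b} t * g t"
      using ae
    proof eventually_elim
      case (elim t)
      show ?case
      proof (cases "t \<in> {0..b}")
        case True
        then have t: "t > 0" using elim(1) by simp
        then have "((\<lambda>h. (X (t + h) - X t) / h) \<longlongrightarrow> g t) (at 0)" using elim(2) by (simp add: DERIV_def)
        from filterlim_compose[OF this sF] have "(\<lambda>n. (X (t + s n) - X t) / s n) \<longlonglongrightarrow> g t" .
        moreover have "Y (t + s n) = X (t + s n)" "Y t = X t" for n using t s(1)[of n] by (auto simp: Y_def)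
        ultimately show ?thesis by (intro tendsto_mult_left) simp
      qed simp
    qed
    show "AE t in lborel. norm (indicator {0..b} t * ((Y (t + s n) - Y t) / s n)) \<le> L * indicator {0..b} t" for n
    proof (rule AE_I2)
      fix t
      show "norm (indicator {0..b} t * ((Y (t + s n) - Y t) / s n)) \<le> L * indicator {0..b} t"
      proof (cases "t \<in> {0..b}")
        case True
        then have "\<bar>Y (t + s n) - Y t\<bar> \<le> L * s n"
          using lipschitz_onD[OF lip, of "t + s n" t] s(1)[of n] by (auto simp: Y_def dist_real_def)
        then have "\<bar>Y (t + s n) - Y t\<bar> / s n \<le> L" using s(1)[of n] by (simp add: field_simps)
        then show ?thesis using True s(1)[of n] by simp
      qed simp
    qed
  qed (use gm in auto)
  moreover have "(\<lambda>n. LBINT t. indicator {0..b} t * ((Y (t + s n) - Y t) / s n)) \<longlonglongrightarrow> Y b - Y 0"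
  proof -
    have "(LBINT t. indicator {0..b} t * ((Y (t + s n) - Y t) / s n)) = (K (b + s n) - K b) / s n - (K (0 + s n) - K 0) / s n" for n
    proof -
      have d: "((\<lambda>t. (K (t + s n) - K t) / s n) has_real_derivative (Y (t + s n) - Y t) / s n) (at t)" for t
      proof -
        have "((\<lambda>t. K (t + s n)) has_real_derivative Y (t + s n)) (at t)"
          using K[of "t + s n"] by (simp add: DERIV_shift)
        then show ?thesis by (intro DERIV_cdivide DERIV_diff K)
      qed
      have c: "continuous_on UNIV (\<lambda>t. (Y (t + s n) - Y t) / s n)"
        using s(1)[of n] by (intro continuous_intros continuous_on_compose2[OF Yc] Yc) auto
      show ?thesis by (rule FTC_indicator[OF d c b])
    qed
    moreover have "(\<lambda>n. (K (t + s n) - K t) / s n) \<longlonglongrightarrow> Y t" for t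
      using filterlim_compose[OF K[unfolded DERIV_def] sF] .
    ultimately show ?thesis by (simp only:) (intro tendsto_diff)
  qed
  ultimately have "Y b - Y 0 = (LBINT t. indicator {0..b} t * g t)" using LIMSEQ_unique by blast
  then show ?thesis using b by (simp add: Y_def)
qed

text \<open>The growth of 1 + y over [a,b] is at most exponential in K times the integral of h.
  Since that integral has small tails, and since y \<le> h forces y to be small at arbitrarily late
  times, y stays small from some late time on.\<close>

lemma integral_Gronwall_decay:
  fixes y h :: "real \<Rightarrow> real"
  assumes yc: "continuous_on UNIV y" and hc: "continuous_on UNIV h" and yh: "\<And>t. 0 \<le> y t" "\<And>t. y t \<le> h t"
    and hB: "\<And>T. T \<ge> 0 \<Longrightarrow> (LBINT t. indicator {0..T} t * h t) \<le> B"
    and K: "K > 0" and step: "\<And>a b. 0 \<le> a \<Longrightarrow> a \<le> b \<Longrightarrow>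
      y b - y a \<le> K * (LBINT t. indicator {a..b} t * ((1 + y t) * h t))"
  shows "(y \<longlongrightarrow> 0) at_top"
proof -
  obtain H where H: "\<And>t. (H has_real_derivative h t) (at t)" using ex_antiderivative[OF hc] by blast
  have jc: "continuous_on UNIV (\<lambda>t. (1 + y t) * h t)" by (intro continuous_intros yc hc)
  then obtain J where J: "\<And>t. (J has_real_derivative (1 + y t) * h t) (at t)" using ex_antiderivative by blast
  have h0: "0 \<le> h t" for t using yh[of t] by linarith
  have Hm: "H a \<le> H b" if "a \<le> b" for a b
    using DERIV_nonneg_imp_nondecreasing[OF that, of H] H h0 by blast
  have HB: "H T \<le> H 0 + B" if "T \<ge> 0" for T
    using hB[OF that] FTC_indicator[OF H hc that] by simp
  have growth: "1 + y b \<le> (1 + y a) * exp (K * (H b - H a))" if ab: "0 \<le> a" "a \<le> b" for a b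
  proof -
    \<comment> \<open>The right side of the integral inequality, a differentiable majorant of 1 +
      y.\<close>
    define R where "R = (\<lambda>t. 1 + y a + K * (J t - J a))"
    have R: "1 + y t \<le> R t" if "a \<le> t" for t
      using step[OF ab(1) that] FTC_indicator[OF J jc that] by (simp add: R_def)
    have "R b * exp (- K * H b) \<le> R a * exp (- K * H a)"
    proof (rule DERIV_nonpos_imp_nonincreasing[OF ab(2), where f="\<lambda>t. R t * exp (- K * H t)"])
      fix t assume t: "a \<le> t"
      have "((\<lambda>t. R t * exp (- K * H t)) has_real_derivative K * h t * (1 + y t - R t) * exp (- K * H t)) (at t)"
        unfolding R_def by (auto intro!: derivative_eq_intros J H simp: algebra_simps)
      moreover have "K * h t * (1 + y t - R t) * exp (- K * H t) \<le> 0"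
        using R[OF t] K h0[of t] by (intro mult_nonpos_nonneg mult_nonneg_nonpos) auto
      ultimately show "\<exists>y. ((\<lambda>t. R t * exp (- K * H t)) has_real_derivative y) (at t) \<and> y \<le> 0" by blast
    qed
    then have "R b * exp (- K * H b) * exp (K * H b) \<le> R a * exp (- K * H a) * exp (K * H b)"
      by (rule mult_right_mono) simp
    then have "R b \<le> R a * exp (K * (H b - H a))"
      by (simp add: mult.assoc exp_add[symmetric] right_diff_distrib)
    then show ?thesis using R[OF ab(2)] by (simp add: R_def)
  qed
  have "\<exists>l. (H \<longlongrightarrow> l) at_top"
  proof -
    have "bdd_above (H ` {0..})" using HB by (auto intro!: bdd_aboveI)
    define l where "l = (SUP t\<in>{0..}. H t)"
    have "(H \<longlongrightarrow> l) at_top"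
    proof (rule order_tendstoI)
      fix c assume "c < l"
      then obtain t where "t \<ge> 0" "c < H t"
        using less_cSUP_iff[of "{0..}" H c] \<open>bdd_above (H ` {0..})\<close> by (auto simp: l_def)
      then show "\<forall>\<^sub>F t in at_top. c < H t"
        using Hm by (auto simp: eventually_at_top_linorder intro: less_le_trans)
    next
      fix c assume "l < c"
      have "H t \<le> l" if "t \<ge> 0" for t
        unfolding l_def by (rule cSUP_upper) (use that \<open>bdd_above (H ` {0..})\<close> in auto)
      then show "\<forall>\<^sub>F t in at_top. H t < c"
        using \<open>l < c\<close> by (auto simp: eventually_at_top_linorder intro: le_less_trans)
    qed
    then show ?thesis ..
  qed
  then obtain l where l: "(H \<longlongrightarrow> l) at_top" by blast
  have Hl: "H t \<le> l" for t
    by (rule tendsto_lowerbound[OF l]) (use Hm in \<open>auto simp: eventually_at_top_linorder\<close>)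
  show ?thesis
  proof (rule order_tendstoI)
    fix e :: real assume "e < 0"
    then show "\<forall>\<^sub>F t in at_top. e < y t" by (intro always_eventually allI less_le_trans[OF _ yh(1)])
  next
    fix e :: real assume e: "0 < e"
    \<comment> \<open>Makes exp(2 d) < exp(3 d) = 1 + e: one factor exp d pays for the starting
      value y a < d, the other for the growth afterwards.\<close>
    define d where "d = ln (1 + e) / 3"
    have d: "d > 0" using e by (simp add: d_def)
    have "\<forall>\<^sub>F t in at_top. l - d / K < H t" using l d K by (intro order_tendstoD(1)[OF l]) simp
    then obtain s where s: "\<And>t. t \<ge> s \<Longrightarrow> l - d / K < H t" by (auto simp: eventually_at_top_linorder)
    define s' where "s' = max s 0"
    have "\<exists>a\<ge>s'. y a < d"
    proof (rule ccontr)
      assume "\<not> ?thesis"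
      then have ge: "d \<le> y t" if "t \<ge> s'" for t using that by (meson not_le)
      \<comment> \<open>If y stayed above d, then H would grow at least linearly, and at time T it
        would exceed its limit l by d.\<close>
      define T where "T = s' + (l - H s') / d + 1"
      have "s' \<le> T" using Hl[of s'] d by (simp add: T_def)
      have "H s' - d * s' \<le> H T - d * T"
      proof (rule DERIV_nonneg_imp_nondecreasing[OF \<open>s' \<le> T\<close>, where f="\<lambda>t. H t - d * t"])
        fix t assume "s' \<le> t"
        moreover have "((\<lambda>t. H t - d * t) has_real_derivative h t - d) (at t)" by (auto intro!: derivative_eq_intros H)
        ultimately show "\<exists>y. ((\<lambda>t. H t - d * t) has_real_derivative y) (at t) \<and> 0 \<le> y" using ge[of t] yh(2)[of t] by force
      qed
      then have "d * (T - s') \<le> l - H s'" using Hl[of T] by (simp add: right_diff_distrib)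
      moreover have "d * (T - s') = l - H s' + d" using d by (simp add: T_def field_simps)
      ultimately show False using d by simp
    qed
    then obtain a where a: "a \<ge> s'" "y a < d" by blast
    have "y b < e" if b: "b \<ge> a" for b
    proof -
      have "H b - H a \<le> d / K" using s[of a] Hl[of b] a by (simp add: s'_def)
      then have "K * (H b - H a) \<le> d" using K by (simp add: field_simps)
      have "1 + y b \<le> (1 + y a) * exp (K * (H b - H a))" using growth[of a b] a b by (simp add: s'_def)
      also have "\<dots> \<le> exp d * exp d"
      proof (intro mult_mono)
        show "1 + y a \<le> exp d" using a(2) exp_ge_add_one_self[of d] by linarith
      qed (use \<open>K * (H b - H a) \<le> d\<close> yh(1)[of a] in auto)
      also have "\<dots> = exp (2 * d)" by (simp add: exp_add[symmetric])
      also have "\<dots> < exp (3 * d)" using d by simp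
      also have "\<dots> = 1 + e" using e by (simp add: d_def)
      finally show ?thesis by simp
    qed
    then show "\<forall>\<^sub>F t in at_top. y t < e" by (auto simp: eventually_at_top_linorder)
  qed
qed

section \<open>Perturbations of the shock\<close>

text \<open>The difference is an integral of f'(x - r) over r between a and b; Cauchy-Schwarz in r
  and Tonelli in x give the bound. Only f' is required to be in L2, which suits the shock profile,
  itself not square integrable.\<close>

lemma norm2_translation:
  fixes f :: "real \<Rightarrow> real"
  assumes d: "\<And>x. (f has_real_derivative f' x) (at x)" and c: "continuous_on UNIV f'" and L: "L2 f'"
  shows "L2 (\<lambda>x. f (x - a) - f (x - b))" and "norm2 (\<lambda>x. f (x - a) - f (x - b)) \<le> \<bar>a - b\<bar> * norm2 f'"
proof -
  have [measurable]: "f \<in> borel_measurable borel" "f' \<in> borel_measurable borel"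
    by (intro borel_measurable_continuous_onI DERIV_at_continuous_on[OF d] c)+
  have main: "L2 (\<lambda>x. f (x - a) - f (x - b)) \<and> norm2 (\<lambda>x. f (x - a) - f (x - b)) \<le> (b - a) * norm2 f'" if "a \<le> b" for a b
  proof -
    let ?I = "indicator {a..b} :: real \<Rightarrow> real"
    have I: "L2 ?I" by (rule L2_indicator) (auto simp: emeasure_lborel_Icc_eq)
    have "(\<lambda>x. (?I x)\<^sup>2) = ?I" by (auto simp: indicator_def)
    then have "(norm2 ?I)\<^sup>2 = b - a" using \<open>a \<le> b\<close> by (simp add: norm2_power2)
    have Lg: "L2 (\<lambda>r. ?I r * f' (x - r))" for x
    proof -
      have "integrable lborel (\<lambda>r. (f' (x + (-1) * r))\<^sup>2)"
        by (rule lborel_integrable_real_affine[OF L2_square_integrable[OF L]]) simp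
      then have "L2 (\<lambda>r. f' (x - r))" by (simp add: L2_def)
      then show ?thesis by (rule L2_mult_bounded[where B=1]) (auto simp: indicator_def)
    qed
    have e: "f (x - a) - f (x - b) = (LBINT r. ?I r * (?I r * f' (x - r)))" for x
    proof -
      have "((\<lambda>r. - f (x - r)) has_real_derivative f' (x - r)) (at r)" for r
      proof -
        have "((\<lambda>r. x - r) has_real_derivative - 1) (at r)" by (auto intro!: derivative_eq_intros)
        from DERIV_minus[OF DERIV_chain'[OF this d]] show ?thesis by simp
      qed
      moreover have "continuous_on UNIV (\<lambda>r. f' (x - r))"
        by (intro continuous_on_compose2[OF c] continuous_intros) auto
      ultimately have "(LBINT r. ?I r * f' (x - r)) = - f (x - b) - (- f (x - a))"
        using FTC_indicator[OF _ _ that, of "\<lambda>r. - f (x - r)" "\<lambda>r. f' (x - r)"] by blast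
      moreover have "(\<lambda>r. ?I r * (?I r * f' (x - r))) = (\<lambda>r. ?I r * f' (x - r))" by (auto simp: indicator_def)
      ultimately show ?thesis by simp
    qed
    have pt: "(f (x - a) - f (x - b))\<^sup>2 \<le> (b - a) * (LBINT r. (?I r * f' (x - r))\<^sup>2)" for x
    proof -
      have "\<bar>f (x - a) - f (x - b)\<bar> \<le> norm2 ?I * norm2 (\<lambda>r. ?I r * f' (x - r))"
        unfolding e by (rule Cauchy_Schwarz_L2[OF I Lg])
      then have "\<bar>f (x - a) - f (x - b)\<bar>\<^sup>2 \<le> (norm2 ?I * norm2 (\<lambda>r. ?I r * f' (x - r)))\<^sup>2"
        by (rule power_mono) simp
      then show ?thesis using \<open>(norm2 ?I)\<^sup>2 = b - a\<close> by (simp add: power_mult_distrib norm2_power2[of "\<lambda>r. ?I r * f' (x - r)"])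
    qed
    have nr: "(\<integral>\<^sup>+x. ennreal ((?I r * f' (x - r))\<^sup>2) \<partial>lborel) = ennreal ((norm2 f')\<^sup>2) * ?I r" for r
    proof (cases "r \<in> {a..b}")
      case True
      then show ?thesis using L2_nn_integral[OF L2_shift[OF L, of r]] by (simp add: norm2_shift)
    qed simp
    have "(\<integral>\<^sup>+x. ennreal ((f (x - a) - f (x - b))\<^sup>2) \<partial>lborel)
        \<le> (\<integral>\<^sup>+x. ennreal (b - a) * (\<integral>\<^sup>+r. ennreal ((?I r * f' (x - r))\<^sup>2) \<partial>lborel) \<partial>lborel)"
    proof (rule nn_integral_mono)
      fix x
      have "ennreal ((f (x - a) - f (x - b))\<^sup>2) \<le> ennreal ((b - a) * (LBINT r. (?I r * f' (x - r))\<^sup>2))"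
        by (rule ennreal_leI[OF pt])
      also have "\<dots> = ennreal (b - a) * (\<integral>\<^sup>+r. ennreal ((?I r * f' (x - r))\<^sup>2) \<partial>lborel)"
        using that by (simp add: ennreal_mult L2_nn_integral[OF Lg] norm2_power2)
      finally show "ennreal ((f (x - a) - f (x - b))\<^sup>2) \<le> ennreal (b - a) * (\<integral>\<^sup>+r. ennreal ((?I r * f' (x - r))\<^sup>2) \<partial>lborel)" .
    qed
    also have "\<dots> = ennreal (b - a) * (\<integral>\<^sup>+x. (\<integral>\<^sup>+r. ennreal ((?I r * f' (x - r))\<^sup>2) \<partial>lborel) \<partial>lborel)"
      by (rule nn_integral_cmult) measurable
    also have "(\<integral>\<^sup>+x. (\<integral>\<^sup>+r. ennreal ((?I r * f' (x - r))\<^sup>2) \<partial>lborel) \<partial>lborel)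
        = (\<integral>\<^sup>+r. (\<integral>\<^sup>+x. ennreal ((?I r * f' (x - r))\<^sup>2) \<partial>lborel) \<partial>lborel)"
      by (rule lborel_pair.Fubini') measurable
    also have "\<dots> = ennreal ((norm2 f')\<^sup>2) * (\<integral>\<^sup>+r. ennreal (?I r) \<partial>lborel)"
      unfolding nr by (rule nn_integral_cmult) measurable
    also have "(\<integral>\<^sup>+r. ennreal (?I r) \<partial>lborel) = ennreal (b - a)"
      using that by (simp add: emeasure_lborel_Icc_eq ennreal_indicator)
    finally have *: "(\<integral>\<^sup>+x. ennreal ((f (x - a) - f (x - b))\<^sup>2) \<partial>lborel) \<le> ennreal (((b - a) * norm2 f')\<^sup>2)"
      using that by (simp add: ennreal_mult[symmetric] power2_eq_square mult_ac)
    have mm: "(\<lambda>x. f (x - a) - f (x - b)) \<in> borel_measurable borel" by measurable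
    show ?thesis using L2_nn_integralI[OF mm *] that by simp
  qed
  show "L2 (\<lambda>x. f (x - a) - f (x - b))"
    using main[of a b] L2_uminus[of "\<lambda>x. f (x - b) - f (x - a)"] main[of b a] by (cases "a \<le> b") auto
  show "norm2 (\<lambda>x. f (x - a) - f (x - b)) \<le> \<bar>a - b\<bar> * norm2 f'"
    using main[of a b] main[of b a] norm2_commute[of "\<lambda>x. f (x - a)" "\<lambda>x. f (x - b)"] by (cases "a \<le> b") auto
qed

lemma norm2_diff_tendsto:
  assumes "((\<lambda>r. norm2 (F r)) \<longlongrightarrow> 0) FF" "((\<lambda>r. norm2 (G r)) \<longlongrightarrow> 0) FF" "\<forall>\<^sub>F r in FF. L2 (F r)" "\<forall>\<^sub>F r in FF. L2 (G r)"
  shows "((\<lambda>r. norm2 (\<lambda>x. F r x - G r x)) \<longlongrightarrow> 0) FF"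
proof (rule tendsto_sandwich[OF _ _ tendsto_const])
  show "((\<lambda>r. norm2 (F r) + norm2 (G r)) \<longlongrightarrow> 0) FF" using tendsto_add[OF assms(1,2)] by simp
  show "\<forall>\<^sub>F r in FF. norm2 (\<lambda>x. F r x - G r x) \<le> norm2 (F r) + norm2 (G r)"
    using assms(3,4) by eventually_elim (rule norm2_diff)
qed simp

lemma continuous_UNIV_I: "(\<And>t. (f \<longlongrightarrow> f t) (at t)) \<Longrightarrow> continuous_on UNIV f" for f :: "real \<Rightarrow> real"
  by (simp add: continuous_on_eq_continuous_at isCont_def)

locale shock_perturbation = monotone_shock +
  fixes ubar u0 X :: "real \<Rightarrow> real" and u :: "real \<Rightarrow> real \<Rightarrow> real"
  assumes ubar_smooth: "smooth_fun ubar"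
    and ubar_left: "\<And>x. x \<le> -1 \<Longrightarrow> ubar x = um" and ubar_right: "\<And>x. x \<ge> 1 \<Longrightarrow> ubar x = up"
    and sol: "kdvb_solution eps delta u0 u"
    and space: "\<And>T. T > 0 \<Longrightarrow> in_XT T ubar u"
    and X_lip: "\<exists>L. L-lipschitz_on {0..} X"
    and X0: "X 0 = 0"
    and X_ode: "AE t in lborel. t > 0 \<longrightarrow> (X has_real_derivative (- (1 / (um - up)) *
            (LBINT x. (u t (x + X t) - ut (x - (um + up) / 2 * t)) * deriv ut (x - (um + up) / 2 * t)))) (at t)"
begin

text \<open>All time-dependent quantities are frozen at their initial value for negative times, so that they are
  continuous on the whole line; \<open>m\<close> is the velocity of the shift (see \<open>Xdot_eq\<close>).\<close>

definition "s t = \<sigma> * max 0 t + X (max 0 t)"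
definition "psi t x = u (max 0 t) x - ut (x - s t)"
definition "D t = (SOME g. weak_deriv (psi t) g \<and> L2 g)"
definition "m t = (LBINT x. psi t x * q (x - s t))"

section \<open>Time continuity of the perturbation and its derivative\<close>

lemma X_cont: "continuous_on {0..} X"
  using X_lip lipschitz_on_continuous_on by blast

lemma s_cont: "continuous_on UNIV s"
  unfolding s_def by (intro continuous_intros continuous_on_compose2[OF X_cont]) auto

lemma s_tendsto: "(s \<longlongrightarrow> s t) (at t)"
  using s_cont by (simp add: continuous_on_eq_continuous_at isCont_def)

lemma s0: "s 0 = 0" using X0 by (simp add: s_def)

lemma ubar_cont: "continuous_on S ubar" "continuous_on S (deriv ubar)"
  using ubar_smooth smooth_fun_continuous smooth_fun_deriv by blast+

text \<open>Split into a translate of ut - ubar and the difference of ubar and its translate, which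
  has compact support because ubar is constant on each side of [-1,1].\<close>

lemma ut_shift_L2: "L2 (\<lambda>x. ut (x - c) - ubar x)"
proof -
  have 1: "L2 (\<lambda>x. ut x - ubar x)" by (rule ut_diff_L2[OF ubar_cont(1) ubar_left ubar_right])
  have 2: "L2 (\<lambda>x. ubar x - ubar (x + c))"
  proof (rule L2_compact_support[where R="\<bar>c\<bar> + 1"])
    show "continuous_on UNIV (\<lambda>x. ubar x - ubar (x + c))"
      by (intro continuous_intros continuous_on_compose2[OF ubar_cont(1)]) auto
    fix x assume "\<bar>c\<bar> + 1 < \<bar>x\<bar>"
    then consider "x \<le> -1 \<and> x + c \<le> -1" | "x \<ge> 1 \<and> x + c \<ge> 1" by linarith
    then show "ubar x - ubar (x + c) = 0" by cases (auto simp: ubar_left ubar_right)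
  qed
  show ?thesis using L2_shift[OF L2_add[OF 1 2], of c] by simp
qed

lemma ubar1_L2: "L2 (deriv ubar)"
proof (rule L2_compact_support[where R=1, OF ubar_cont(2)])
  fix x :: real assume "1 < \<bar>x\<bar>"
  then consider "x < -1" | "x > 1" by linarith
  then show "deriv ubar x = 0"
  proof cases
    case 1
    have "(ubar has_real_derivative 0) (at x)"
      by (rule has_field_derivative_transform_within_open[OF DERIV_const[of um], where S="{..<-1}"])
        (use 1 ubar_left in auto)
    then show ?thesis by (rule DERIV_imp_deriv)
  next
    case 2
    have "(ubar has_real_derivative 0) (at x)"
      by (rule has_field_derivative_transform_within_open[OF DERIV_const[of up], where S="{1<..}"])
        (use 2 ubar_right in auto)
    then show ?thesis by (rule DERIV_imp_deriv)
  qed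
qed

lemma ut_shift_DERIV: "((\<lambda>x. ut (x - c)) has_real_derivative ut1 (x - c)) (at x)"
  "((\<lambda>x. ut1 (x - c)) has_real_derivative ut2 (x - c)) (at x)"
  using DERIV_shift[of ut "ut1 (x - c)" x "-c"] ut_DERIV(1)[of "x - c"]
    DERIV_shift[of ut1 "ut2 (x - c)" x "-c"] ut_DERIV(2)[of "x - c"] by simp_all

lemma ut_shift_cont: "continuous_on S (\<lambda>x. ut (x - c))" "continuous_on S (\<lambda>x. ut1 (x - c))"
  by (intro continuous_on_compose2[OF ut_cont(1)[of UNIV]] continuous_on_compose2[OF ut_cont(2)[of UNIV]] continuous_intros; simp)+

lemma ut_shift_weak: "weak_deriv (\<lambda>x. ut (x - c) - ubar x) (\<lambda>x. ut1 (x - c) - deriv ubar x)"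
  by (rule weak_deriv_C1)
    (auto intro!: derivative_eq_intros ut_shift_DERIV smooth_fun_DERIV ubar_smooth continuous_intros ut_shift_cont ubar_cont)

lemma psi_split: "psi t = (\<lambda>x. (u (max 0 t) x - ubar x) - (ut (x - s t) - ubar x))"
  by (auto simp: psi_def)

text \<open>\<open>in_XT\<close> is given for each T separately, with a derivative that may depend
  on T. The choice T = max 0 t + 1 leaves room to the right of t, and freezing at negative times
  leaves room to the left, so the continuity obtained is two-sided.\<close>

lemma psi_local:
  obtains vx where "\<And>r. r \<le> max 0 t + 1 \<Longrightarrow> weak_deriv (psi r) (\<lambda>x. vx r x - (ut1 (x - s r) - deriv ubar x))"
    and "\<And>r. r \<le> max 0 t + 1 \<Longrightarrow> L2 (psi r)" and "\<And>r. r \<le> max 0 t + 1 \<Longrightarrow> L2 (vx r)"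
    and "((\<lambda>r. norm2 (\<lambda>x. u (max 0 r) x - u (max 0 t) x)) \<longlongrightarrow> 0) (at t)"
    and "((\<lambda>r. norm2 (\<lambda>x. vx r x - vx t x)) \<longlongrightarrow> 0) (at t)"
proof -
  define T where "T = max 0 t + 1"
  have "T > 0" by (simp add: T_def)
  from space[OF this] obtain v where
    v: "\<And>r. r \<in> {0..T} \<Longrightarrow> L2 (\<lambda>x. u r x - ubar x) \<and> weak_deriv (\<lambda>x. u r x - ubar x) (v r) \<and> L2 (v r)"
    and lim: "\<And>r. r \<in> {0..T} \<Longrightarrow> ((\<lambda>z. LBINT x. (u z x - u r x)\<^sup>2 + (v z x - v r x)\<^sup>2) \<longlongrightarrow> 0) (at r within {0..T})"
    unfolding in_XT_def by blast
  define vx where "vx r = v (max 0 r)" for r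
  have r: "max 0 r \<in> {0..T}" if "r \<le> max 0 t + 1" for r using that by (auto simp: T_def)
  have t: "max 0 t \<in> {0..T}" by (auto simp: T_def)
  have w: "weak_deriv (psi r) (\<lambda>x. vx r x - (ut1 (x - s r) - deriv ubar x))" if "r \<le> max 0 t + 1" for r
    unfolding psi_split vx_def using v[OF r[OF that]] by (intro weak_deriv_diff ut_shift_weak) auto
  have l: "L2 (psi r)" if "r \<le> max 0 t + 1" for r
    unfolding psi_split by (rule L2_diff) (use v[OF r[OF that]] ut_shift_L2 in auto)
  define E where "E z = (LBINT x. (u z x - u (max 0 t) x)\<^sup>2 + (v z x - v (max 0 t) x)\<^sup>2)" for z
  have Eb: "(norm2 (\<lambda>x. u z x - u (max 0 t) x))\<^sup>2 \<le> E z" "(norm2 (\<lambda>x. v z x - v (max 0 t) x))\<^sup>2 \<le> E z"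
    if "z \<in> {0..T}" for z
  proof -
    have "L2 (\<lambda>x. (u z x - ubar x) - (u (max 0 t) x - ubar x))"
      by (rule L2_diff) (use v[OF that] v[OF t] in auto)
    then have a: "L2 (\<lambda>x. u z x - u (max 0 t) x)" by simp
    have b: "L2 (\<lambda>x. v z x - v (max 0 t) x)" using v[OF that] v[OF t] by (intro L2_diff) auto
    have "E z = (norm2 (\<lambda>x. u z x - u (max 0 t) x))\<^sup>2 + (norm2 (\<lambda>x. v z x - v (max 0 t) x))\<^sup>2"
      unfolding E_def norm2_power2 using L2_square_integrable[OF a] L2_square_integrable[OF b] by simp
    then show "(norm2 (\<lambda>x. u z x - u (max 0 t) x))\<^sup>2 \<le> E z" "(norm2 (\<lambda>x. v z x - v (max 0 t) x))\<^sup>2 \<le> E z" by simp_all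
  qed
  have small: "\<forall>\<^sub>F z in at t. E (max 0 z) < e" if "e > 0" for e
  proof -
    have "\<forall>\<^sub>F z in at (max 0 t) within {0..T}. E z < e"
      using lim[OF t] that unfolding E_def by (rule order_tendstoD)
    then obtain d where d: "d > 0" "\<And>z. z \<in> {0..T} \<Longrightarrow> z \<noteq> max 0 t \<Longrightarrow> dist z (max 0 t) < d \<Longrightarrow> E z < e"
      by (auto simp: eventually_at)
    have "E (max 0 z) < e" if "dist z t < min d 1" for z
    proof (cases "max 0 z = max 0 t")
      case True
      then show ?thesis using \<open>e > 0\<close> by (simp add: E_def)
    next
      case False
      have "dist (max 0 z) (max 0 t) \<le> dist z t" by (auto simp: dist_real_def)
      moreover have "max 0 z \<in> {0..T}" using that by (auto simp: T_def dist_real_def)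
      ultimately show ?thesis using d(2)[of "max 0 z"] False that by auto
    qed
    then show ?thesis using d(1) by (auto simp: eventually_at intro!: exI[of _ "min d 1"])
  qed
  have near: "\<forall>\<^sub>F z in at t. z \<le> max 0 t + 1"
    by (rule eventually_at_topological[THEN iffD2]) (auto intro!: exI[of _ "{..<max 0 t + 1}"])
  have nl: "((\<lambda>r. norm2 (f r)) \<longlongrightarrow> 0) (at t)"
    if "\<And>r. r \<le> max 0 t + 1 \<Longrightarrow> (norm2 (f r))\<^sup>2 \<le> E (max 0 r)" for f
  proof (rule order_tendstoI)
    fix e :: real assume "e < 0"
    then show "\<forall>\<^sub>F r in at t. e < norm2 (f r)" by (intro always_eventually allI less_le_trans[OF _ norm2_nonneg])
  next
    fix e :: real assume e: "0 < e"
    have "\<forall>\<^sub>F z in at t. E (max 0 z) < e\<^sup>2" using e by (intro small) simp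
    with near show "\<forall>\<^sub>F r in at t. norm2 (f r) < e"
    proof eventually_elim
      case (elim r)
      then have "(norm2 (f r))\<^sup>2 < e\<^sup>2" using that[of r] by linarith
      then show ?case using e by (simp add: power_less_imp_less_base)
    qed
  qed
  show ?thesis
  proof (rule that[of vx])
    show "((\<lambda>r. norm2 (\<lambda>x. u (max 0 r) x - u (max 0 t) x)) \<longlongrightarrow> 0) (at t)"
      by (rule nl) (rule Eb(1)[OF r])
    show "((\<lambda>r. norm2 (\<lambda>x. vx r x - vx t x)) \<longlongrightarrow> 0) (at t)"
      unfolding vx_def by (rule nl) (rule Eb(2)[OF r])
  qed (use w l v r in \<open>auto simp: vx_def\<close>)
qed

lemma psi_L2: "L2 (psi t)"
  by (rule psi_local[of t]) simp

lemma D_weak: "weak_deriv (psi t) (D t)" and D_L2: "L2 (D t)"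
proof -
  have "\<exists>g. weak_deriv (psi t) g \<and> L2 g"
  proof (rule psi_local[of t])
    fix vx assume *: "\<And>r. r \<le> max 0 t + 1 \<Longrightarrow> weak_deriv (psi r) (\<lambda>x. vx r x - (ut1 (x - s r) - deriv ubar x))"
      "\<And>r. r \<le> max 0 t + 1 \<Longrightarrow> L2 (vx r)"
    have "L2 (\<lambda>x. vx t x - (ut1 (x - s t) - deriv ubar x))"
      by (intro L2_diff * L2_shift ut1_L2 ubar1_L2) simp
    then show ?thesis using *(1)[of t] by force
  qed
  from someI_ex[OF this] show "weak_deriv (psi t) (D t)" "L2 (D t)" unfolding D_def by auto
qed

lemma translate_tendsto:
  assumes "\<And>x. (f has_real_derivative f' x) (at x)" "continuous_on UNIV f'" "L2 f'"
  shows "((\<lambda>r. norm2 (\<lambda>x. f (x - s r) - f (x - s t))) \<longlongrightarrow> 0) (at t)"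
proof (rule tendsto_sandwich[OF _ _ tendsto_const])
  have "((\<lambda>r. \<bar>s r - s t\<bar> * norm2 f') \<longlongrightarrow> \<bar>s t - s t\<bar> * norm2 f') (at t)"
    by (intro tendsto_intros s_tendsto)
  then show "((\<lambda>r. \<bar>s r - s t\<bar> * norm2 f') \<longlongrightarrow> 0) (at t)" by simp
  show "\<forall>\<^sub>F r in at t. norm2 (\<lambda>x. f (x - s r) - f (x - s t)) \<le> \<bar>s r - s t\<bar> * norm2 f'"
    using norm2_translation(2)[OF assms] by simp
qed simp

lemmas ut_translate_L2 = norm2_translation(1)[OF ut_DERIV(1) ut_cont(2) ut1_L2]
lemmas ut_translate_tendsto = translate_tendsto[OF ut_DERIV(1) ut_cont(2) ut1_L2]
lemmas ut1_translate_tendsto = translate_tendsto[OF ut_DERIV(2) ut_cont(3) ut2_L2]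

lemma psi_tendsto: "((\<lambda>r. norm2 (\<lambda>x. psi r x - psi t x)) \<longlongrightarrow> 0) (at t)"
proof (rule psi_local[of t])
  fix vx assume lim: "((\<lambda>r. norm2 (\<lambda>x. u (max 0 r) x - u (max 0 t) x)) \<longlongrightarrow> 0) (at t)"
  have L: "L2 (\<lambda>x. u (max 0 r) x - u (max 0 t) x)" for r
  proof -
    have "L2 (\<lambda>x. (psi r x - psi t x) + (ut (x - s r) - ut (x - s t)))"
      by (intro L2_add L2_diff psi_L2 ut_translate_L2)
    then show ?thesis by (simp add: psi_def)
  qed
  have "((\<lambda>r. norm2 (\<lambda>x. (u (max 0 r) x - u (max 0 t) x) - (ut (x - s r) - ut (x - s t)))) \<longlongrightarrow> 0) (at t)"
    by (rule norm2_diff_tendsto[OF lim ut_translate_tendsto]) (intro always_eventually allI L ut_translate_L2)+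
  then show ?thesis by (simp add: psi_def algebra_simps)
qed

text \<open>The derivative local to t is compared with \<open>D\<close> by almost everywhere
  uniqueness, which transfers the convergence from the former to the latter.\<close>

lemma D_tendsto: "((\<lambda>r. norm2 (\<lambda>x. D r x - D t x)) \<longlongrightarrow> 0) (at t)"
proof (rule psi_local[of t])
  fix vx assume w: "\<And>r. r \<le> max 0 t + 1 \<Longrightarrow> weak_deriv (psi r) (\<lambda>x. vx r x - (ut1 (x - s r) - deriv ubar x))"
    and l: "\<And>r. r \<le> max 0 t + 1 \<Longrightarrow> L2 (vx r)" and lim: "((\<lambda>r. norm2 (\<lambda>x. vx r x - vx t x)) \<longlongrightarrow> 0) (at t)"
  have near: "\<forall>\<^sub>F z in at t. z \<le> max 0 t + 1"
    by (rule eventually_at_topological[THEN iffD2]) (auto intro!: exI[of _ "{..<max 0 t + 1}"])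
  have "((\<lambda>r. norm2 (\<lambda>x. (vx r x - vx t x) - (ut1 (x - s r) - ut1 (x - s t)))) \<longlongrightarrow> 0) (at t)"
    by (rule norm2_diff_tendsto[OF lim ut1_translate_tendsto])
      (use near in \<open>auto intro!: L2_diff l L2_shift ut1_L2 elim!: eventually_mono\<close>)
  moreover have "\<forall>\<^sub>F r in at t. norm2 (\<lambda>x. (vx r x - vx t x) - (ut1 (x - s r) - ut1 (x - s t))) = norm2 (\<lambda>x. D r x - D t x)"
    using near
  proof eventually_elim
    case (elim r)
    have tt: "t \<le> max 0 t + 1" by simp
    have L: "L2 (vx r)" "L2 (vx t)" using l elim tt by auto
    have "L2 (\<lambda>x. (vx r x - vx t x) - (ut1 (x - s r) - ut1 (x - s t)))"
      by (intro L2_diff L L2_shift ut1_L2)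
    moreover have "L2 (\<lambda>x. D r x - D t x)" by (intro L2_diff D_L2)
    ultimately show ?case
      using weak_deriv_unique[OF w[OF elim] D_weak] weak_deriv_unique[OF w[OF tt] D_weak]
      by (intro norm2_AE_cong L2_measurable) auto
  qed
  ultimately show ?thesis by (rule Lim_transform_eventually)
qed

lemma norm_psi_cont: "continuous_on UNIV (\<lambda>t. norm2 (psi t))"
  by (rule continuous_UNIV_I) (rule tendsto_norm2[OF psi_L2 _ psi_tendsto], simp add: psi_L2)

lemma norm_D_cont: "continuous_on UNIV (\<lambda>t. norm2 (D t))"
  by (rule continuous_UNIV_I) (rule tendsto_norm2[OF D_L2 _ D_tendsto], simp add: D_L2)

lemma q_shift_tendsto: "((\<lambda>r. norm2 (\<lambda>x. q (x - s r) - q (x - s t))) \<longlongrightarrow> 0) (at t)"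
proof -
  have "(\<lambda>r. norm2 (\<lambda>x. q (x - s r) - q (x - s t))) = (\<lambda>r. \<bar>- 1 / A\<bar> * norm2 (\<lambda>x. ut1 (x - s r) - ut1 (x - s t)))"
    unfolding norm2_cmult[symmetric] by (simp add: ut_y algebra_simps)
  then show ?thesis using tendsto_mult_right_zero[OF ut1_translate_tendsto[of t], of "\<bar>- 1 / A\<bar>"] by (simp only:)
qed

lemma m_cont: "continuous_on UNIV m"
proof (rule continuous_UNIV_I)
  show "(m \<longlongrightarrow> m t) (at t)" for t unfolding m_def
    by (rule tendsto_inner_L2) (intro always_eventually allI psi_L2 psi_tendsto q_shift_tendsto L2_shift q_L2)+
qed

section \<open>Regularity of the shift\<close>

lemma Xdot_eq:
  assumes "t \<ge> 0"
  shows "- (1 / (um - up)) * (LBINT x. (u t (x + X t) - ut (x - (um + up) / 2 * t)) * deriv ut (x - (um + up) / 2 * t)) = m t"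
proof -
  have "(LBINT x. (u t (x + X t) - ut (x - (um + up) / 2 * t)) * deriv ut (x - (um + up) / 2 * t))
      = (LBINT x. psi t x * ut1 (x - s t))"
    using assms lborel_integral_shift[of "\<lambda>x. (u t (x + X t) - ut (x - (um + up) / 2 * t)) * deriv ut (x - (um + up) / 2 * t)" "X t", symmetric]
    by (simp add: psi_def s_def ut1_def[symmetric] \<sigma>_def[symmetric] diff_diff_eq add.commute)
  also have "\<dots> = (LBINT x. (- A) * (psi t x * q (x - s t)))" by (simp add: ut_y mult_ac)
  also have "\<dots> = - A * m t" unfolding m_def by (rule integral_mult_right_zero)
  finally show ?thesis unfolding A_def[symmetric] using A_neq by simp
qed

text \<open>The shift is a priori Lipschitz with an almost everywhere equation, but its velocity
  \<open>m\<close> is continuous in t. Hence X agrees on t \<ge> 0 with a C1 function, and the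
  moving profile can be differentiated classically.\<close>

lemma X_primitive: "\<exists>M. (\<forall>t. (M has_real_derivative m t) (at t)) \<and> (\<forall>t\<ge>0. X t = M t)"
proof -
  obtain M where M: "\<And>t. (M has_real_derivative m t) (at t)" using ex_antiderivative[OF m_cont] by blast
  obtain L where L: "L-lipschitz_on {0..} X" using X_lip by blast
  have ae: "AE t in lborel. t > 0 \<longrightarrow> (X has_real_derivative m t) (at t)"
    using X_ode by eventually_elim (use Xdot_eq in auto)
  have "X t = M t - M 0" if "t \<ge> 0" for t
    using lipschitz_AE_derivative_primitive[OF L continuous_on_subset[OF m_cont subset_UNIV] ae that]
      FTC_indicator[OF M m_cont that] X0 by simp
  then show ?thesis
    by (intro exI[of _ "\<lambda>t. M t - M 0"]) (auto intro!: derivative_eq_intros M)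
qed

section \<open>The flux difference and the mollified evolution equation\<close>

definition "N t x = (psi t x)\<^sup>2 / 2 + ut (x - s t) * psi t x"
definition "Nx t x = psi t x * D t x + (ut (x - s t) * D t x + ut1 (x - s t) * psi t x)"

text \<open>Identifies \<open>N\<close> as the difference of the two fluxes. Its definition through
  psi makes it visibly square integrable, although the fluxes themselves are not.\<close>

lemma N_eq: "N t x = (u (max 0 t) x)\<^sup>2 / 2 - (ut (x - s t))\<^sup>2 / 2"
  unfolding N_def psi_def by (simp add: power2_eq_square field_simps)

lemma ut_shift_bounds: "\<bar>ut (x - c)\<bar> \<le> M0 + A * C2" "\<bar>ut1 (x - c)\<bar> \<le> M0 + A * C2"
  using ut_bound[of "x - c"] ut1_bound[of "x - c"] by (auto intro: order_trans)

lemma N_weak: "weak_deriv (N t) (Nx t)"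
proof -
  have "weak_deriv (\<lambda>x. ut (x - s t) * psi t x) (\<lambda>x. ut (x - s t) * D t x + ut1 (x - s t) * psi t x)"
    by (rule weak_deriv_mult_C1[OF D_weak psi_L2 D_L2 ut_shift_DERIV(1) ut_shift_cont(2) ut_shift_bounds])
  from weak_deriv_add[OF weak_deriv_square[OF D_weak[of t] psi_L2 D_L2] this]
  show ?thesis unfolding N_def[abs_def] Nx_def[abs_def] .
qed

text \<open>Agmon's bound for the sup norm of \<open>psi t\<close>; it controls the nonlinearity and
  drives the decay beyond L2.\<close>

definition "S t = sqrt (2 * norm2 (psi t) * norm2 (D t))"

lemma S_nonneg: "S t \<ge> 0" by (simp add: S_def)

lemma psi_sup: "AE x in lborel. \<bar>psi t x\<bar> \<le> S t"
  unfolding S_def by (rule Agmon_AE[OF D_weak psi_L2 D_L2])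

lemma measurable_facts [measurable]: "psi t \<in> borel_measurable borel" "D t \<in> borel_measurable borel"
  "ut \<in> borel_measurable borel" "ut1 \<in> borel_measurable borel" "q \<in> borel_measurable borel"
  "s \<in> borel_measurable borel" "m \<in> borel_measurable borel"
  using psi_L2 D_L2 q_L2 s_cont m_cont ut_cont
  by (auto intro: L2_measurable borel_measurable_continuous_onI)

lemma ut_psi_L2: "L2 f \<Longrightarrow> L2 (\<lambda>x. ut (x - c) * f x)" "L2 f \<Longrightarrow> L2 (\<lambda>x. ut1 (x - c) * f x)"
  by (rule L2_mult_bounded[OF _ _ ut_shift_bounds(1)]; simp) (rule L2_mult_bounded[OF _ _ ut_shift_bounds(2)]; simp)

lemma psi_mult_L2: "L2 f \<Longrightarrow> L2 (\<lambda>x. psi t x * f x)" and psi_mult_norm2: "L2 f \<Longrightarrow> norm2 (\<lambda>x. psi t x * f x) \<le> S t * norm2 f"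
  using L2_mult_AE_bounded[OF _ _ psi_sup S_nonneg] norm2_mult_bounded[OF _ _ psi_sup S_nonneg] by auto

lemma N_L2: "L2 (N t)" and N_norm2: "norm2 (N t) \<le> (S t + M0) * norm2 (psi t)"
proof -
  have e: "N t = (\<lambda>x. 1 / 2 * (psi t x * psi t x) + ut (x - s t) * psi t x)"
    by (auto simp: N_def power2_eq_square)
  show "L2 (N t)" unfolding e by (intro L2_add L2_cmult psi_mult_L2 ut_psi_L2 psi_L2)
  have "norm2 (N t) \<le> norm2 (\<lambda>x. 1 / 2 * (psi t x * psi t x)) + norm2 (\<lambda>x. ut (x - s t) * psi t x)"
    unfolding e by (intro norm2_triangle L2_cmult psi_mult_L2 ut_psi_L2 psi_L2)
  also have "\<dots> \<le> S t * norm2 (psi t) + M0 * norm2 (psi t)"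
  proof (rule add_mono)
    have "norm2 (\<lambda>x. 1 / 2 * (psi t x * psi t x)) \<le> norm2 (\<lambda>x. psi t x * psi t x)"
      unfolding norm2_cmult using norm2_nonneg[of "\<lambda>x. psi t x * psi t x"] by simp
    then show "norm2 (\<lambda>x. 1 / 2 * (psi t x * psi t x)) \<le> S t * norm2 (psi t)" using psi_mult_norm2[OF psi_L2] by (rule order_trans)
    show "norm2 (\<lambda>x. ut (x - s t) * psi t x) \<le> M0 * norm2 (psi t)"
      using ut_bound by (intro norm2_mult_bounded psi_L2) (auto simp: M0_def)
  qed
  finally show "norm2 (N t) \<le> (S t + M0) * norm2 (psi t)" by (simp add: distrib_right)
qed

lemma Nx_L2: "L2 (Nx t)" unfolding Nx_def[abs_def] by (intro L2_add psi_mult_L2 ut_psi_L2 psi_L2 D_L2)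

lemma Nx_norm2: "norm2 (Nx t) \<le> (S t + M0) * norm2 (D t) + norm2 (\<lambda>x. ut1 (x - s t) * psi t x)"
proof -
  have "norm2 (Nx t) \<le> norm2 (\<lambda>x. psi t x * D t x) + norm2 (\<lambda>x. ut (x - s t) * D t x + ut1 (x - s t) * psi t x)"
    unfolding Nx_def[abs_def] by (intro norm2_triangle L2_add psi_mult_L2 ut_psi_L2 psi_L2 D_L2)
  also have "\<dots> \<le> norm2 (\<lambda>x. psi t x * D t x) + (norm2 (\<lambda>x. ut (x - s t) * D t x) + norm2 (\<lambda>x. ut1 (x - s t) * psi t x))"
    by (intro add_left_mono norm2_triangle ut_psi_L2 psi_L2 D_L2)
  also have "\<dots> \<le> S t * norm2 (D t) + (M0 * norm2 (D t) + norm2 (\<lambda>x. ut1 (x - s t) * psi t x))"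
    using ut_bound by (intro add_mono psi_mult_norm2 D_L2 norm2_mult_bounded order_refl) (auto simp: M0_def)
  finally show ?thesis by (simp add: distrib_right)
qed

text \<open>The right side of psi_t = - N_x + eps psi_xx - delta psi_xxx + m ut1(x - s), convolved
  with k. The last term comes from the velocity of the shift; the constant speed \<sigma> is
  absorbed by the profile equation.\<close>

definition "R k t x = - conv (N t) (deriv k) x + eps * conv (psi t) (deriv (deriv k)) x
   - delta * conv (psi t) (deriv (deriv (deriv k))) x + m t * conv ut1 k (x - s t)"

lemma conv_psi_cont: assumes "test_fun l" shows "continuous_on UNIV (\<lambda>t. conv (psi t) l x)"
proof (rule continuous_UNIV_I)
  fix t show "((\<lambda>t. conv (psi t) l x) \<longlongrightarrow> conv (psi t) l x) (at t)" unfolding conv_def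
    by (rule tendsto_inner_L2[OF psi_L2 _ psi_tendsto]) (simp_all add: psi_L2 L2_test_fun test_fun_reflect assms)
qed

text \<open>The integrand factors as psi times l(x - z) (psi / 2 + ut). Both factors are continuous
  in t with values in L2; the test function is kept in the second one to make it square
  integrable.\<close>

lemma conv_N_cont: assumes l: "test_fun l" shows "continuous_on UNIV (\<lambda>t. conv (N t) l x)"
proof (rule continuous_UNIV_I)
  fix t
  define g where "g r z = l (x - z) * (1 / 2 * psi r z + ut (z - s r))" for r z
  have lm: "(\<lambda>z. l (x - z)) \<in> borel_measurable borel" by (rule test_fun_measurable[OF test_fun_reflect[OF l]])
  obtain B where B: "\<And>z. \<bar>l (x - z)\<bar> \<le> B" using test_fun_bounded[OF l] by metis
  have gL: "L2 (g r)" for r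
  proof -
    have "L2 (\<lambda>z. l (x - z) * (1 / 2 * psi r z) + ut (z - s r) * l (x - z))"
      by (intro L2_add L2_mult_bounded[OF L2_cmult[OF psi_L2] lm B] ut_psi_L2 L2_test_fun test_fun_reflect l)
    then show ?thesis by (simp add: g_def[abs_def] algebra_simps)
  qed
  have e: "conv (N r) l x = (LBINT z. psi r z * g r z)" for r
    unfolding conv_def N_def g_def by (simp add: algebra_simps power2_eq_square)
  have dL: "L2 (\<lambda>z. 1 / 2 * (psi r z - psi t z) - (ut (z - s t) - ut (z - s r)))" for r
    by (intro L2_diff L2_cmult psi_L2 ut_translate_L2)
  have "((\<lambda>r. norm2 (\<lambda>z. 1 / 2 * (psi r z - psi t z) - (ut (z - s t) - ut (z - s r)))) \<longlongrightarrow> 0) (at t)"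
  proof (rule norm2_diff_tendsto)
    show "((\<lambda>r. norm2 (\<lambda>z. 1 / 2 * (psi r z - psi t z))) \<longlongrightarrow> 0) (at t)"
      unfolding norm2_cmult by (rule tendsto_mult_right_zero[OF psi_tendsto])
    show "((\<lambda>r. norm2 (\<lambda>z. ut (z - s t) - ut (z - s r))) \<longlongrightarrow> 0) (at t)"
      using ut_translate_tendsto by (subst norm2_commute)
  qed (intro always_eventually allI L2_cmult L2_diff psi_L2 ut_translate_L2)+
  from tendsto_mult_right_zero[OF this, of B]
  have "((\<lambda>r. norm2 (\<lambda>z. g r z - g t z)) \<longlongrightarrow> 0) (at t)"
  proof (rule tendsto_sandwich[OF _ _ tendsto_const, rotated 2])
    have "norm2 (\<lambda>z. g r z - g t z) \<le> B * norm2 (\<lambda>z. 1 / 2 * (psi r z - psi t z) - (ut (z - s t) - ut (z - s r)))" for r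
    proof -
      have "norm2 (\<lambda>z. l (x - z) * (1 / 2 * (psi r z - psi t z) - (ut (z - s t) - ut (z - s r))))
        \<le> B * norm2 (\<lambda>z. 1 / 2 * (psi r z - psi t z) - (ut (z - s t) - ut (z - s r)))"
        using B order_trans[OF abs_ge_zero B] by (intro norm2_mult_bounded dL lm) auto
      then show ?thesis by (simp add: g_def algebra_simps)
    qed
    then show "\<forall>\<^sub>F r in at t. norm2 (\<lambda>z. g r z - g t z) \<le> B * norm2 (\<lambda>z. 1 / 2 * (psi r z - psi t z) - (ut (z - s t) - ut (z - s r)))"
      by simp
  qed simp
  then show "((\<lambda>t. conv (N t) l x) \<longlongrightarrow> conv (N t) l x) (at t)" unfolding e
    by (intro tendsto_inner_L2 always_eventually allI psi_L2 psi_tendsto gL)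
qed

lemma R_cont: assumes k: "test_fun k" shows "continuous_on UNIV (\<lambda>t. R k t x)"
proof -
  have "continuous_on UNIV (conv ut1 k)" by (rule conv_continuous[OF L2_loc_integrable[OF ut1_L2] k])
  then have "continuous_on UNIV (\<lambda>t. conv ut1 k (x - s t))"
    by (rule continuous_on_compose2) (auto intro!: continuous_intros s_cont)
  then show ?thesis unfolding R_def
    by (intro continuous_intros conv_psi_cont conv_N_cont m_cont test_fun_deriv k)
qed

text \<open>The distributional equation is tested with z |-> k(x - z). Its time integrand is
  identified with the continuous function Q, so the mollified solution is C1 in time; the mollified
  profile is differentiated along its C1 path.\<close>

lemma conv_psi_DERIV:
  assumes k: "test_fun k" and a: "0 \<le> a" and t: "t \<in> {a..b}"
  shows "((\<lambda>t. conv (psi t) k x) has_real_derivative R k t x) (at t within {a..b})"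
proof -
  note td = test_fun_deriv
  note li = loc_integrable_continuous[OF ut_shift_cont(1)]
  have li2: "loc_integrable (\<lambda>x. (ut (x - c))\<^sup>2 / 2)" for c
    by (auto intro!: loc_integrable_continuous continuous_intros ut_shift_cont)
  have ul: "loc_integrable (u t)" if "t \<ge> 0" for t
  proof -
    have "loc_integrable (\<lambda>x. psi t x + ut (x - s t))" by (intro loc_integrable_add L2_loc_integrable psi_L2 li)
    then show ?thesis using that by (simp add: psi_def)
  qed
  have ul2: "loc_integrable (\<lambda>x. (u t x)\<^sup>2 / 2)" if "t \<ge> 0" for t
  proof -
    have "loc_integrable (\<lambda>x. N t x + (ut (x - s t))\<^sup>2 / 2)" by (intro loc_integrable_add L2_loc_integrable N_L2 li2)
    then show ?thesis using that by (simp add: N_eq)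
  qed
  \<comment> \<open>The rate of change of \<open>conv (u t) k x\<close>: the contribution of the
    moving profile, (\<sigma> + m) times the mollified \<open>ut1\<close>, is removed from
    R.\<close>
  define Q where "Q t = R k t x - (\<sigma> + m t) * conv ut1 k (x - s t)" for t
  have Qc: "continuous_on UNIV Q"
  proof -
    have "continuous_on UNIV (conv ut1 k)" by (rule conv_continuous[OF L2_loc_integrable[OF ut1_L2] k])
    then have "continuous_on UNIV (\<lambda>t. conv ut1 k (x - s t))"
      by (rule continuous_on_compose2) (auto intro!: continuous_intros s_cont)
    then show ?thesis unfolding Q_def by (intro continuous_intros R_cont k m_cont)
  qed
  have psi_u: "conv (psi t) l x = conv (u t) l x - conv ut l (x - s t)" if "t \<ge> 0" "test_fun l" for t l
  proof -
    have "conv (\<lambda>x. u t x - ut (x - s t)) l x = conv (u t) l x - conv (\<lambda>x. ut (x - s t)) l x"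
      by (rule conv_diff[OF ul li]) fact+
    then show ?thesis using that by (simp add: psi_def[abs_def] conv_shift)
  qed
  have N_u: "conv (N t) l x = conv (\<lambda>x. (u t x)\<^sup>2 / 2) l x - conv (\<lambda>x. (ut x)\<^sup>2 / 2) l (x - s t)" if "t \<ge> 0" "test_fun l" for t l
  proof -
    have "conv (\<lambda>x. (u t x)\<^sup>2 / 2 - (ut (x - s t))\<^sup>2 / 2) l x = conv (\<lambda>x. (u t x)\<^sup>2 / 2) l x - conv (\<lambda>x. (ut (x - s t))\<^sup>2 / 2) l x"
      by (rule conv_diff[OF ul2 li2]) fact+
    then show ?thesis using that conv_shift[of "\<lambda>x. (ut x)\<^sup>2 / 2" "s t" l x] by (simp add: N_eq[abs_def])
  qed
  have QU: "Q t = - conv (\<lambda>x. (u t x)\<^sup>2 / 2) (deriv k) x + eps * conv (u t) (deriv (deriv k)) x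
      - delta * conv (u t) (deriv (deriv (deriv k))) x" if "t \<ge> 0" for t
    unfolding Q_def R_def using shock_conv[OF k, of "x - s t"] that
    by (simp add: psi_u N_u td k algebra_simps)
  have sm: "smooth_fun k" by (rule test_fun_smooth[OF k])
  have d2: "(deriv ^^ 2) k = deriv (deriv k)" "(deriv ^^ 3) k = deriv (deriv (deriv k))"
    by (simp_all add: numeral_2_eq_2 numeral_3_eq_3)
  \<comment> \<open>Odd derivatives of the reflected kernel change sign and even ones do not; this
    turns the weak formulation into the signs of R.\<close>
  have Qin: "(LBINT z. (u r z)\<^sup>2 / 2 * deriv (\<lambda>z. k (x - z)) z + eps * u r z * (deriv ^^ 2) (\<lambda>z. k (x - z)) z
      + delta * u r z * (deriv ^^ 3) (\<lambda>z. k (x - z)) z) = Q r" if "r \<ge> 0" for r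
  proof -
    note i = conv_integrable[OF ul2[OF that] td[OF k], of x] conv_integrable[OF ul[OF that] td[OF td[OF k]], of x]
      conv_integrable[OF ul[OF that] td[OF td[OF td[OF k]]], of x]
    have "(LBINT z. (u r z)\<^sup>2 / 2 * deriv (\<lambda>z. k (x - z)) z + eps * u r z * (deriv ^^ 2) (\<lambda>z. k (x - z)) z
      + delta * u r z * (deriv ^^ 3) (\<lambda>z. k (x - z)) z)
      = (LBINT z. - ((u r z)\<^sup>2 / 2 * deriv k (x - z)) + eps * (u r z * deriv (deriv k) (x - z))
        - delta * (u r z * deriv (deriv (deriv k)) (x - z)))"
      unfolding deriv_reflect[OF sm] deriv2_reflect[OF sm] deriv3_reflect[OF sm] d2 by (simp add: mult.assoc)
    also have "\<dots> = - conv (\<lambda>x. (u r x)\<^sup>2 / 2) (deriv k) x + eps * conv (u r) (deriv (deriv k)) x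
      - delta * conv (u r) (deriv (deriv (deriv k))) x"
      unfolding conv_def using i
      by (subst Bochner_Integration.integral_diff; (subst Bochner_Integration.integral_add)?; simp)
    finally show ?thesis using QU[OF that] by simp
  qed
  obtain KQ where KQ: "\<And>t. (KQ has_real_derivative Q t) (at t)" using ex_antiderivative[OF Qc] by blast
  have uk: "conv (u t) k x = conv (u 0) k x + (KQ t - KQ 0)" if "t \<ge> 0" for t
  proof -
    have "(LBINT z. u t z * k (x - z)) - (LBINT z. u 0 z * k (x - z))
      = set_lebesgue_integral lborel {0..t} (\<lambda>r. LBINT z. (u r z)\<^sup>2 / 2 * deriv (\<lambda>z. k (x - z)) z
        + eps * u r z * (deriv ^^ 2) (\<lambda>z. k (x - z)) z + delta * u r z * (deriv ^^ 3) (\<lambda>z. k (x - z)) z)"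
      using sol test_fun_reflect[OF k, of x] that unfolding kdvb_solution_def by blast
    also have "\<dots> = (LBINT r. indicator {0..t} r * Q r)"
      unfolding set_lebesgue_integral_def
    proof (rule Bochner_Integration.integral_cong[OF refl])
      fix r
      show "indicator {0..t} r *\<^sub>R (LBINT z. (u r z)\<^sup>2 / 2 * deriv (\<lambda>z. k (x - z)) z
        + eps * u r z * (deriv ^^ 2) (\<lambda>z. k (x - z)) z + delta * u r z * (deriv ^^ 3) (\<lambda>z. k (x - z)) z)
        = indicator {0..t} r * Q r"
        using Qin[of r] by (cases "r \<in> {0..t}") auto
    qed
    also have "\<dots> = KQ t - KQ 0" by (rule FTC_indicator[OF KQ Qc that])
    finally show ?thesis by (simp add: conv_def)
  qed
  obtain M where M: "\<And>t. (M has_real_derivative m t) (at t)" "\<And>t. t \<ge> 0 \<Longrightarrow> X t = M t"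
    using X_primitive by blast
  have t0: "t \<ge> 0" using a t by simp
  have wut: "conv ut (deriv k) z = conv ut1 k z" for z
    by (rule conv_weak_deriv[OF weak_deriv_C1[OF ut_DERIV(1) ut_cont(2)] k])
  have "((\<lambda>t. x - (\<sigma> * t + M t)) has_real_derivative - (\<sigma> + m t)) (at t)"
    by (auto intro!: derivative_eq_intros M)
  from DERIV_chain'[OF this conv_DERIV[OF loc_integrable_continuous[OF ut_cont(1)] k]]
  have "((\<lambda>t. conv ut k (x - (\<sigma> * t + M t))) has_real_derivative - (\<sigma> + m t) * conv ut1 k (x - (\<sigma> * t + M t))) (at t)"
    by (simp add: wut mult.commute)
  moreover have "\<sigma> * t + M t = s t" using M(2)[OF t0] t0 by (simp add: s_def)
  ultimately have dd: "((\<lambda>t. (conv (u 0) k x + (KQ t - KQ 0)) - conv ut k (x - (\<sigma> * t + M t))) has_real_derivative R k t x) (at t)"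
    unfolding Q_def by (auto intro!: derivative_eq_intros KQ simp: Q_def algebra_simps)
  \<comment> \<open>The explicit formula represents \<open>conv (psi t) k x\<close> for nonnegative
    times, hence the derivative within [a,b].\<close>
  show ?thesis
  proof (rule has_field_derivative_transform_within[OF has_field_derivative_at_within[OF dd], of 1])
    fix r assume "r \<in> {a..b}"
    then have r: "r \<ge> 0" using a by simp
    show "conv (u 0) k x + (KQ r - KQ 0) - conv ut k (x - (\<sigma> * r + M r)) = conv (psi r) k x"
      using psi_u[OF r k] uk[OF r] M(2)[OF r] r by (simp add: s_def)
  qed (use t in auto)
qed

end

section \<open>Energy identity for the mollified perturbation\<close>

lemma conv_measurable_pair:
  assumes f: "(\<lambda>(t, z). f t z) \<in> borel_measurable (lborel \<Otimes>\<^sub>M lborel)" and k: "test_fun k"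
  shows "(\<lambda>(t, x). conv (f t) k x) \<in> borel_measurable (lborel \<Otimes>\<^sub>M lborel)"
proof -
  note f[measurable]
  have [measurable]: "k \<in> borel_measurable borel" by (rule test_fun_measurable[OF k])
  show ?thesis unfolding conv_def by measurable
qed

lemma conv_IBP:
  assumes "L2 f" "L2 g" "test_fun k" "test_fun l"
  shows "(LBINT x. conv f (deriv k) x * conv g l x) = - (LBINT x. conv f k x * conv g (deriv l) x)"
  by (rule integration_by_parts_L2)
    (intro conv_DERIV conv_continuous L2_conv L2_loc_integrable test_fun_deriv assms)+

lemma inner_conv_mollifier:
  assumes "L2 f" "L2 g"
  shows "(\<lambda>n. LBINT x. conv f (mollifier n) x * conv g (mollifier n) x) \<longlonglongrightarrow> (LBINT x. f x * g x)"
  by (rule tendsto_inner_L2) (intro always_eventually allI assms L2_conv mollifier mollify_tendsto)+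

lemma inner_conv_mollifier_bound:
  assumes "L2 f" "L2 g"
  shows "\<bar>LBINT x. conv f (mollifier n) x * conv g (mollifier n) x\<bar> \<le> norm2 f * norm2 g"
  by (rule order_trans[OF Cauchy_Schwarz_L2[OF L2_conv[OF assms(1) mollifier(1)] L2_conv[OF assms(2) mollifier(1)]]])
    (intro mult_mono norm2_conv_mollifier assms; simp)

lemma norm2_mollifier_tendsto: "L2 f \<Longrightarrow> (\<lambda>n. norm2 (conv f (mollifier n))) \<longlonglongrightarrow> norm2 f"
  by (rule tendsto_norm2) (simp_all add: L2_conv mollifier mollify_tendsto)

context shock_perturbation
begin

lemma psi_measurable: "(\<lambda>(t, x). psi t x) \<in> borel_measurable (lborel \<Otimes>\<^sub>M lborel)"
proof -
  \<comment> \<open>The joint measurability clause does not involve T, so the instance T = 1 covers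
    all times.\<close>
  have [measurable]: "(\<lambda>(t, x). u t x - ubar x) \<in> borel_measurable (lborel \<Otimes>\<^sub>M lborel)"
    using space[OF zero_less_one] unfolding in_XT_def by (elim exE conjE) assumption
  have [measurable]: "ubar \<in> borel_measurable borel"
    by (rule borel_measurable_continuous_onI[OF ubar_cont(1)])
  have "(\<lambda>(t, x). (u (max 0 t) x - ubar x) - (ut (x - s t) - ubar x)) \<in> borel_measurable (lborel \<Otimes>\<^sub>M lborel)"
    by measurable
  then show ?thesis by (simp add: psi_def)
qed

lemma N_measurable: "(\<lambda>(t, x). N t x) \<in> borel_measurable (lborel \<Otimes>\<^sub>M lborel)"
proof -
  note psi_measurable[measurable]
  show ?thesis unfolding N_def by measurable
qed

lemma R_measurable: assumes "test_fun k" shows "(\<lambda>(t, x). R k t x) \<in> borel_measurable (lborel \<Otimes>\<^sub>M lborel)"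
proof -
  note td = test_fun_deriv
  note [measurable] = conv_measurable_pair[OF N_measurable td[OF assms]]
    conv_measurable_pair[OF psi_measurable td[OF td[OF assms]]]
    conv_measurable_pair[OF psi_measurable td[OF td[OF td[OF assms]]]]
    conv_measurable[OF L2_loc_integrable[OF ut1_L2] assms]
  show ?thesis unfolding R_def by measurable
qed

lemma local_bounds:
  obtains C where "C \<ge> 0" "\<And>t. t \<in> {a..b} \<Longrightarrow> norm2 (psi t) \<le> C" "\<And>t. t \<in> {a..b} \<Longrightarrow> norm2 (D t) \<le> C"
    "\<And>t. t \<in> {a..b} \<Longrightarrow> \<bar>m t\<bar> \<le> C" "\<And>t. t \<in> {a..b} \<Longrightarrow> S t \<le> 2 * C"
proof -
  have ex: "\<exists>B. \<forall>t\<in>{a..b}. \<bar>f t\<bar> \<le> B" if "continuous_on UNIV f" for f :: "real \<Rightarrow> real"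
  proof -
    have "compact (f ` {a..b})" by (intro compact_continuous_image continuous_on_subset[OF that]) auto
    then show ?thesis by (meson compact_imp_bounded bounded_real imageI)
  qed
  obtain B1 B2 B3 where B: "\<And>t. t \<in> {a..b} \<Longrightarrow> \<bar>norm2 (psi t)\<bar> \<le> B1" "\<And>t. t \<in> {a..b} \<Longrightarrow> \<bar>norm2 (D t)\<bar> \<le> B2"
     "\<And>t. t \<in> {a..b} \<Longrightarrow> \<bar>m t\<bar> \<le> B3"
    using ex[OF norm_psi_cont] ex[OF norm_D_cont] ex[OF m_cont] by blast
  define C where "C = \<bar>B1\<bar> + \<bar>B2\<bar> + \<bar>B3\<bar>"
  have C: "C \<ge> 0" by (simp add: C_def)
  have C1: "norm2 (psi t) \<le> C" "norm2 (D t) \<le> C" if "t \<in> {a..b}" for t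
    using B(1)[OF that] B(2)[OF that] unfolding C_def by linarith+
  have C2: "\<bar>m t\<bar> \<le> C" if "t \<in> {a..b}" for t
    using B(3)[OF that] unfolding C_def by linarith
  have "S t \<le> 2 * C" if "t \<in> {a..b}" for t
  proof -
    have "2 * norm2 (psi t) * norm2 (D t) \<le> 2 * C * C" using C1[OF that] C by (intro mult_mono) auto
    also have "\<dots> \<le> (2 * C)\<^sup>2" using C by (simp add: power2_eq_square)
    finally show ?thesis unfolding S_def using C by (simp add: real_le_lsqrt)
  qed
  then show ?thesis using that[OF C] C1 C2 by blast
qed

lemma ut1_s_L2: "L2 (\<lambda>x. ut1 (x - s t))" by (rule L2_shift[OF ut1_L2])

lemma R_eq: "R k t x = - conv (N t) (deriv k) x + eps * conv (psi t) (deriv (deriv k)) x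
   - delta * conv (psi t) (deriv (deriv (deriv k))) x + m t * conv (\<lambda>x. ut1 (x - s t)) k x"
  by (simp add: R_def conv_shift)

lemma R_L2: assumes k: "test_fun k" shows "L2 (R k t)"
  unfolding R_eq[abs_def]
  by (intro L2_add L2_diff L2_uminus L2_cmult L2_conv N_L2 psi_L2 ut1_s_L2 test_fun_deriv k)

text \<open>Supplies the bound over [a,b] required by \<open>energy_identity\<close>. It depends on
  the kernel through the L1 norms of its derivatives; no uniformity over the mollifiers is
  claimed.\<close>

lemma R_norm2:
  assumes k: "test_fun k"
  shows "\<exists>B. \<forall>t\<in>{a..b}. norm2 (conv (psi t) k) \<le> B \<and> norm2 (R k t) \<le> B"
proof (rule local_bounds[of a b])
  fix C assume C: "C \<ge> 0" "\<And>t. t \<in> {a..b} \<Longrightarrow> norm2 (psi t) \<le> C" "\<And>t. t \<in> {a..b} \<Longrightarrow> norm2 (D t) \<le> C"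
    "\<And>t. t \<in> {a..b} \<Longrightarrow> \<bar>m t\<bar> \<le> C" "\<And>t. t \<in> {a..b} \<Longrightarrow> S t \<le> 2 * C"
  note td = test_fun_deriv
  define c where "c l = (LBINT x. \<bar>l x\<bar>)" for l :: "real \<Rightarrow> real"
  have c0: "c l \<ge> 0" for l by (simp add: c_def)
  have cn: "norm2 (conv f l) \<le> c l * K" if "L2 f" "test_fun l" "norm2 f \<le> K" for f l K
    using norm2_conv[OF that(1,2)] mult_left_mono[OF that(3) c0[of l]] by (simp add: c_def)
  define B where "B = c k * C + c (deriv k) * ((2 * C + M0) * C) + eps * (c (deriv (deriv k)) * C)
    + delta * (c (deriv (deriv (deriv k))) * C) + C * (c k * norm2 ut1)"
  have M0: "M0 \<ge> 0" by (simp add: M0_def)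
  have nn: "c k * C \<ge> 0" "c (deriv k) * ((2 * C + M0) * C) \<ge> 0" "eps * (c (deriv (deriv k)) * C) \<ge> 0"
    "delta * (c (deriv (deriv (deriv k))) * C) \<ge> 0" "C * (c k * norm2 ut1) \<ge> 0"
    using C(1) c0 M0 eps delta by (auto intro!: mult_nonneg_nonneg add_nonneg_nonneg)
  have "norm2 (conv (psi t) k) \<le> B \<and> norm2 (R k t) \<le> B" if t: "t \<in> {a..b}" for t
  proof
    have 0: "norm2 (conv (psi t) k) \<le> c k * C" by (intro cn psi_L2 k C t)
    then show "norm2 (conv (psi t) k) \<le> B" using nn unfolding B_def by linarith
    have nN: "norm2 (N t) \<le> (2 * C + M0) * C"
      by (rule order_trans[OF N_norm2]) (use C t M0 S_nonneg in \<open>auto intro!: mult_mono\<close>)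
    note l = L2_conv[OF N_L2 td[OF k], of t] L2_conv[OF psi_L2 td[OF td[OF k]], of t]
      L2_conv[OF psi_L2 td[OF td[OF td[OF k]]], of t] L2_conv[OF ut1_s_L2 k, of t]
    have 1: "norm2 (\<lambda>x. - conv (N t) (deriv k) x) \<le> c (deriv k) * ((2 * C + M0) * C)"
      unfolding norm2_uminus by (intro cn N_L2 td k nN)
    have 2: "norm2 (\<lambda>x. eps * conv (psi t) (deriv (deriv k)) x) \<le> eps * (c (deriv (deriv k)) * C)"
      unfolding norm2_cmult using eps by (simp, intro cn psi_L2 td k C t)
    have 3: "norm2 (\<lambda>x. delta * conv (psi t) (deriv (deriv (deriv k))) x) \<le> delta * (c (deriv (deriv (deriv k))) * C)"
      unfolding norm2_cmult using delta by (simp, intro cn psi_L2 td k C t)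
    have 4: "norm2 (\<lambda>x. m t * conv (\<lambda>x. ut1 (x - s t)) k x) \<le> C * (c k * norm2 ut1)"
      unfolding norm2_cmult by (intro mult_mono C t cn ut1_s_L2 k) (auto simp: norm2_shift C c0)
    have "norm2 (R k t) \<le> norm2 (\<lambda>x. - conv (N t) (deriv k) x + eps * conv (psi t) (deriv (deriv k)) x
        - delta * conv (psi t) (deriv (deriv (deriv k))) x) + norm2 (\<lambda>x. m t * conv (\<lambda>x. ut1 (x - s t)) k x)"
      unfolding R_eq[abs_def] by (intro norm2_triangle L2_add L2_diff L2_uminus L2_cmult l)
    also have "\<dots> \<le> (norm2 (\<lambda>x. - conv (N t) (deriv k) x + eps * conv (psi t) (deriv (deriv k)) x)
        + norm2 (\<lambda>x. delta * conv (psi t) (deriv (deriv (deriv k))) x)) + norm2 (\<lambda>x. m t * conv (\<lambda>x. ut1 (x - s t)) k x)"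
      by (intro add_right_mono norm2_diff L2_add L2_uminus L2_cmult l)
    also have "\<dots> \<le> ((norm2 (\<lambda>x. - conv (N t) (deriv k) x) + norm2 (\<lambda>x. eps * conv (psi t) (deriv (deriv k)) x))
        + norm2 (\<lambda>x. delta * conv (psi t) (deriv (deriv (deriv k))) x)) + norm2 (\<lambda>x. m t * conv (\<lambda>x. ut1 (x - s t)) k x)"
      by (intro add_right_mono norm2_triangle L2_uminus L2_cmult l)
    also have "\<dots> \<le> B" using 1 2 3 4 nn(1) unfolding B_def by linarith
    finally show "norm2 (R k t) \<le> B" .
  qed
  then show ?thesis by blast
qed

lemma energy_conv:
  assumes k: "test_fun k" and ab: "0 \<le> a" "a \<le> b"
  shows "integrable lborel (\<lambda>t. indicator {a..b} t * (2 * (LBINT x. conv (psi t) k x * R k t x)))"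
    and "(norm2 (conv (psi b) k))\<^sup>2 - (norm2 (conv (psi a) k))\<^sup>2
      = (LBINT t. indicator {a..b} t * (2 * (LBINT x. conv (psi t) k x * R k t x)))"
proof -
  obtain B where B: "\<And>t. t \<in> {a..b} \<Longrightarrow> norm2 (conv (psi t) k) \<le> B" "\<And>t. t \<in> {a..b} \<Longrightarrow> norm2 (R k t) \<le> B"
    using R_norm2[OF k, of a b] by blast
  note e = energy_identity[where P="\<lambda>t. conv (psi t) k" and R="R k" and B=B, OF ab(2)
      conv_measurable_pair[OF psi_measurable k] R_measurable[OF k] conv_psi_DERIV[OF k ab(1)]
      continuous_on_subset[OF R_cont[OF k] subset_UNIV] L2_conv[OF psi_L2 k] R_L2[OF k] B]
  show "integrable lborel (\<lambda>t. indicator {a..b} t * (2 * (LBINT x. conv (psi t) k x * R k t x)))"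
    by (rule e(1))
  show "(norm2 (conv (psi b) k))\<^sup>2 - (norm2 (conv (psi a) k))\<^sup>2
      = (LBINT t. indicator {a..b} t * (2 * (LBINT x. conv (psi t) k x * R k t x)))"
    by (rule e(2))
qed

lemma production_eq:
  assumes k: "test_fun k"
  shows "(LBINT x. conv (psi t) k x * R k t x) = - (LBINT x. conv (psi t) k x * conv (N t) (deriv k) x)
    - eps * (norm2 (conv (psi t) (deriv k)))\<^sup>2 + m t * (LBINT x. conv (psi t) k x * conv (\<lambda>x. ut1 (x - s t)) k x)"
proof -
  note td = test_fun_deriv
  note l = L2_conv[OF psi_L2 k, of t] L2_conv[OF N_L2 td[OF k], of t] L2_conv[OF psi_L2 td[OF td[OF k]], of t]
      L2_conv[OF psi_L2 td[OF td[OF td[OF k]]], of t] L2_conv[OF ut1_s_L2 k, of t]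
  note i = L2_integrable_mult[OF l(1) l(2)] L2_integrable_mult[OF l(1) l(3)] L2_integrable_mult[OF l(1) l(4)]
     L2_integrable_mult[OF l(1) l(5)]
  let ?p = "conv (psi t) k"
  have "(LBINT x. ?p x * R k t x) = (LBINT x. - (?p x * conv (N t) (deriv k) x) + eps * (?p x * conv (psi t) (deriv (deriv k)) x)
     - delta * (?p x * conv (psi t) (deriv (deriv (deriv k))) x) + m t * (?p x * conv (\<lambda>x. ut1 (x - s t)) k x))"
    by (simp add: R_eq algebra_simps)
  also have "\<dots> = - (LBINT x. ?p x * conv (N t) (deriv k) x) + eps * (LBINT x. ?p x * conv (psi t) (deriv (deriv k)) x)
     - delta * (LBINT x. ?p x * conv (psi t) (deriv (deriv (deriv k))) x) + m t * (LBINT x. ?p x * conv (\<lambda>x. ut1 (x - s t)) k x)"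
    using i by simp
  also have "(LBINT x. ?p x * conv (psi t) (deriv (deriv k)) x) = - (norm2 (conv (psi t) (deriv k)))\<^sup>2"
    unfolding norm2_power2 using conv_IBP[OF psi_L2 psi_L2 k td[OF k], of t t] by (simp add: power2_eq_square)
  \<comment> \<open>Two integrations by parts: the first moves one derivative, the second shows that
    the resulting integral equals its own negative.\<close>
  also have "(LBINT x. ?p x * conv (psi t) (deriv (deriv (deriv k))) x) = 0"
    using conv_IBP[OF psi_L2 psi_L2 k td[OF td[OF k]], of t t] conv_IBP[OF psi_L2 psi_L2 td[OF k] td[OF k], of t t]
    by (simp add: mult.commute)
  finally show ?thesis by simp
qed

section \<open>L2 contraction\<close>

definition "W t = (LBINT x. q (x - s t) * (psi t x)\<^sup>2)"

lemma q_shift_bound: "\<bar>q (x - c)\<bar> \<le> C2"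
  using q_le[of "x - c"] q_nonneg[of "x - c"] by simp

lemma q_psi_L2: "L2 (\<lambda>x. q (x - s t) * psi t x)"
  by (rule L2_mult_bounded[OF psi_L2 _ q_shift_bound]) simp

text \<open>\<open>W\<close> - m^2 is the variance of psi under the density q(x - s t), so the
  weighted Poincare inequality applies. The mean part is left over, to be compensated by the motion
  of the shift.\<close>

lemma W_bound: "A / 2 * W t \<le> A / 2 * (m t)\<^sup>2 + 5 / 8 * eps * (norm2 (D t))\<^sup>2"
proof -
  have "(LBINT x. q (x - s t) * psi t x) = m t" by (simp add: m_def mult.commute)
  with Poincare_shock[OF D_weak psi_L2 D_L2, of "s t" t]
  show "A / 2 * W t \<le> A / 2 * (m t)\<^sup>2 + 5 / 8 * eps * (norm2 (D t))\<^sup>2"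
    by (simp add: W_def right_diff_distrib)
qed

lemma psi_ut1: "(LBINT x. psi t x * ut1 (x - s t)) = - A * m t"
proof -
  have "(LBINT x. psi t x * ut1 (x - s t)) = (LBINT x. (- A) * (psi t x * q (x - s t)))"
    by (simp add: ut_y mult_ac)
  also have "\<dots> = - A * m t" unfolding m_def by (rule integral_mult_right_zero)
  finally show ?thesis .
qed

text \<open>The cubic part integrates to 0. In the part of \<open>Nx\<close> linear in psi,
  integration by parts of ut psi psi_x returns minus half of the term with ut1, so that half of it
  remains; ut1 = - A q turns it into - (A / 2) \<open>W\<close>.\<close>

lemma psi_Nx: "(LBINT x. psi t x * Nx t x) = - A / 2 * W t"
proof -
  note l = psi_mult_L2[OF psi_L2, of t t] ut_psi_L2(1)[OF psi_L2, of "s t" t] ut_psi_L2(2)[OF psi_L2, of "s t" t]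
  have i: "integrable lborel (\<lambda>x. D t x * (psi t x * psi t x))"
    "integrable lborel (\<lambda>x. (ut (x - s t) * psi t x) * D t x)" "integrable lborel (\<lambda>x. (ut1 (x - s t) * psi t x) * psi t x)"
    by (intro L2_integrable_mult l psi_L2 D_L2)+
  have "(LBINT x. psi t x * Nx t x) = (LBINT x. D t x * (psi t x * psi t x)
      + ((ut (x - s t) * psi t x) * D t x + (ut1 (x - s t) * psi t x) * psi t x))"
    by (simp add: Nx_def algebra_simps)
  also have "\<dots> = (LBINT x. D t x * (psi t x * psi t x))
      + ((LBINT x. (ut (x - s t) * psi t x) * D t x) + (LBINT x. (ut1 (x - s t) * psi t x) * psi t x))"
    using i by simp
  also have "(LBINT x. D t x * (psi t x * psi t x)) = 0" by (rule integral_cube_deriv[OF D_weak psi_L2 D_L2])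
  also have "(LBINT x. (ut1 (x - s t) * psi t x) * psi t x) = (LBINT x. ut1 (x - s t) * (psi t x)\<^sup>2)"
    by (simp add: power2_eq_square mult.assoc)
  also have "(LBINT x. (ut (x - s t) * psi t x) * D t x) = - (1 / 2) * (LBINT x. ut1 (x - s t) * (psi t x)\<^sup>2)"
    using integral_weight_deriv[OF D_weak psi_L2 D_L2 ut_shift_DERIV(1) ut_shift_cont(2) ut_shift_bounds, of "s t" t] by simp
  also have "(LBINT x. ut1 (x - s t) * (psi t x)\<^sup>2) = (LBINT x. (- A) * (q (x - s t) * (psi t x)\<^sup>2))"
    by (simp add: ut_y mult_ac)
  also have "\<dots> = - A * W t" unfolding W_def by (rule integral_mult_right_zero)
  finally show ?thesis by simp
qed

text \<open>The identity for the mollified perturbation passes to the limit by dominated convergence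
  in t, with limit density A W - 2 A m^2 - 2 eps |D|^2. The variance bound gives A W \<le> A m^2 +
  (5/4) eps |D|^2, which leaves the coefficients A and (3/4) eps.\<close>

lemma L2_energy:
  assumes ab: "0 \<le> a" "a \<le> b"
  shows "(norm2 (psi b))\<^sup>2 - (norm2 (psi a))\<^sup>2
    \<le> - (LBINT t. indicator {a..b} t * (A * (m t)\<^sup>2 + 3 / 4 * eps * (norm2 (D t))\<^sup>2))"
proof (rule local_bounds[of a b])
  fix C assume C: "C \<ge> 0" "\<And>t. t \<in> {a..b} \<Longrightarrow> norm2 (psi t) \<le> C" "\<And>t. t \<in> {a..b} \<Longrightarrow> norm2 (D t) \<le> C"
    "\<And>t. t \<in> {a..b} \<Longrightarrow> \<bar>m t\<bar> \<le> C" "\<And>t. t \<in> {a..b} \<Longrightarrow> S t \<le> 2 * C"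
  define e where "e t = 2 * (- (LBINT x. psi t x * Nx t x) - eps * (norm2 (D t))\<^sup>2
    + m t * (LBINT x. psi t x * ut1 (x - s t)))" for t
  define en where "en n t = 2 * (LBINT x. conv (psi t) (mollifier n) x * R (mollifier n) t x)" for n t
  have en_eq: "en n t = 2 * (- (LBINT x. conv (psi t) (mollifier n) x * conv (Nx t) (mollifier n) x)
      - eps * (norm2 (conv (D t) (mollifier n)))\<^sup>2
      + m t * (LBINT x. conv (psi t) (mollifier n) x * conv (\<lambda>x. ut1 (x - s t)) (mollifier n) x))" for n t
    unfolding en_def production_eq[OF mollifier(1)]
    by (simp add: conv_weak_deriv[OF N_weak mollifier(1)] conv_weak_deriv[OF D_weak mollifier(1)] norm2_def)
  have lim: "(\<lambda>n. en n t) \<longlonglongrightarrow> e t" for t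
    unfolding en_eq e_def
    by (intro tendsto_intros inner_conv_mollifier norm2_mollifier_tendsto psi_L2 Nx_L2 D_L2 ut1_s_L2)
  \<comment> \<open>Bounds the densities independently of n: only norms of psi, \<open>Nx\<close>,
    \<open>D\<close> and \<open>ut1\<close> enter, and mollification does not increase them.\<close>
  define K where "K = C * ((2 * C + M0) * C + A * C2 * C) + eps * C\<^sup>2 + C * (C * norm2 ut1)"
  have M0: "M0 \<ge> 0" by (simp add: M0_def)
  have enb: "\<bar>en n t\<bar> \<le> 2 * K" if t: "t \<in> {a..b}" for n t
  proof -
    have nx: "norm2 (Nx t) \<le> (2 * C + M0) * C + A * C2 * C"
    proof (rule order_trans[OF Nx_norm2], rule add_mono)
      show "(S t + M0) * norm2 (D t) \<le> (2 * C + M0) * C"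
        using C t M0 S_nonneg[of t] by (intro mult_mono) auto
      have "norm2 (\<lambda>x. ut1 (x - s t) * psi t x) \<le> A * C2 * norm2 (psi t)"
        using ut1_bound A_pos C2_pos by (intro norm2_mult_bounded psi_L2) auto
      also have "\<dots> \<le> A * C2 * C" using C t A_pos C2_pos by (intro mult_left_mono) auto
      finally show "norm2 (\<lambda>x. ut1 (x - s t) * psi t x) \<le> A * C2 * C" .
    qed
    have 1: "\<bar>LBINT x. conv (psi t) (mollifier n) x * conv (Nx t) (mollifier n) x\<bar> \<le> C * ((2 * C + M0) * C + A * C2 * C)"
      by (rule order_trans[OF inner_conv_mollifier_bound[OF psi_L2 Nx_L2]], rule mult_mono) (use C t nx in auto)
    have 2: "\<bar>eps * (norm2 (conv (D t) (mollifier n)))\<^sup>2\<bar> \<le> eps * C\<^sup>2"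
      using eps power_mono[OF order_trans[OF norm2_conv_mollifier[OF D_L2] C(3)[OF t]] norm2_nonneg, of n 2]
      by (simp add: abs_mult)
    have 3: "\<bar>m t * (LBINT x. conv (psi t) (mollifier n) x * conv (\<lambda>x. ut1 (x - s t)) (mollifier n) x)\<bar> \<le> C * (C * norm2 ut1)"
      unfolding abs_mult
    proof (rule mult_mono)
      show "\<bar>LBINT x. conv (psi t) (mollifier n) x * conv (\<lambda>x. ut1 (x - s t)) (mollifier n) x\<bar> \<le> C * norm2 ut1"
        by (rule order_trans[OF inner_conv_mollifier_bound[OF psi_L2 ut1_s_L2]], unfold norm2_shift, rule mult_right_mono)
          (use C t in auto)
    qed (use C t in auto)
    have "\<bar>2 * (- x - y + z)\<bar> \<le> 2 * (x' + y' + z')" if "\<bar>x\<bar> \<le> x'" "\<bar>y\<bar> \<le> y'" "\<bar>z\<bar> \<le> z'" for x y z x' y' z' :: real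
      using that unfolding abs_le_iff by (auto simp: algebra_simps)
    from this[OF 1 2 3] show ?thesis unfolding en_eq K_def .
  qed
  have inten: "integrable lborel (\<lambda>t. indicator {a..b} t * en n t)" for n
    unfolding en_def by (rule energy_conv(1)[OF mollifier(1) ab])
  have K0: "K \<ge> 0" using C(1) M0 A_pos C2_pos eps unfolding K_def by (intro add_nonneg_nonneg mult_nonneg_nonneg) auto
  have lim1: "AE t in lborel. (\<lambda>n. indicator {a..b} t * en n t) \<longlonglongrightarrow> indicator {a..b} t * e t"
    by (intro AE_I2 tendsto_mult_left lim)
  have meas: "(\<lambda>t. indicator {a..b} t * e t) \<in> borel_measurable lborel"
    by (rule borel_measurable_LIMSEQ_real[of _ "\<lambda>n t. indicator {a..b} t * en n t"])
      (use inten in \<open>auto intro: tendsto_mult_left lim\<close>)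
  have dom: "integrable lborel (\<lambda>t. 2 * K * indicator {a..b} t)"
    by (intro integrable_mult_right integrable_real_indicator) (auto simp: emeasure_lborel_Icc_eq)
  have bnd: "AE t in lborel. norm (indicator {a..b} t * en n t) \<le> 2 * K * indicator {a..b} t" for n
    using enb by (auto intro!: AE_I2 simp: indicator_def)
  have menb: "(\<lambda>t. indicator {a..b} t * en n t) \<in> borel_measurable lborel" for n
    using inten by (rule borel_measurable_integrable)
  have conv_int: "(\<lambda>n. LBINT t. indicator {a..b} t * en n t) \<longlonglongrightarrow> (LBINT t. indicator {a..b} t * e t)"
    by (rule integral_dominated_convergence[OF meas menb dom lim1 bnd])
  have inte: "integrable lborel (\<lambda>t. indicator {a..b} t * e t)"
    by (rule integrable_dominated_convergence[OF meas menb dom lim1 bnd])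
  have "(\<lambda>n. (norm2 (conv (psi b) (mollifier n)))\<^sup>2 - (norm2 (conv (psi a) (mollifier n)))\<^sup>2)
     \<longlonglongrightarrow> (norm2 (psi b))\<^sup>2 - (norm2 (psi a))\<^sup>2"
    by (intro tendsto_intros norm2_mollifier_tendsto psi_L2)
  then have "(norm2 (psi b))\<^sup>2 - (norm2 (psi a))\<^sup>2 = (LBINT t. indicator {a..b} t * e t)"
    using conv_int unfolding energy_conv(2)[OF mollifier(1) ab] en_def by (rule LIMSEQ_unique)
  also have "\<dots> \<le> (LBINT t. - (indicator {a..b} t * (A * (m t)\<^sup>2 + 3 / 4 * eps * (norm2 (D t))\<^sup>2)))"
  proof (rule integral_mono[OF inte])
    have "set_integrable lborel {a..b} (\<lambda>t. A * (m t)\<^sup>2 + 3 / 4 * eps * (norm2 (D t))\<^sup>2)"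
      by (intro borel_integrable_atLeastAtMost' continuous_intros continuous_on_subset[OF m_cont] continuous_on_subset[OF norm_D_cont]) auto
    then show "integrable lborel (\<lambda>t. - (indicator {a..b} t * (A * (m t)\<^sup>2 + 3 / 4 * eps * (norm2 (D t))\<^sup>2)))"
      by (simp add: set_integrable_def)
    fix t
    have "e t = A * W t - 2 * eps * (norm2 (D t))\<^sup>2 - 2 * A * (m t)\<^sup>2"
      unfolding e_def psi_Nx psi_ut1 by (simp add: power2_eq_square algebra_simps)
    also have "\<dots> \<le> - (A * (m t)\<^sup>2 + 3 / 4 * eps * (norm2 (D t))\<^sup>2)"
      using W_bound[of t] by (simp add: algebra_simps)
    finally show "indicator {a..b} t * e t \<le> - (indicator {a..b} t * (A * (m t)\<^sup>2 + 3 / 4 * eps * (norm2 (D t))\<^sup>2))"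
      by (auto simp: indicator_def)
  qed
  finally show ?thesis by simp
qed

lemma norm_psi_le: assumes "t \<ge> 0" shows "norm2 (psi t) \<le> norm2 (psi 0)"
proof -
  have "0 \<le> (LBINT r. indicator {0..t} r * (A * (m r)\<^sup>2 + 3 / 4 * eps * (norm2 (D r))\<^sup>2))"
    using A_pos eps by (intro integral_nonneg_AE AE_I2) (auto simp: indicator_def)
  then have "(norm2 (psi t))\<^sup>2 \<le> (norm2 (psi 0))\<^sup>2" using L2_energy[of 0 t] assms by linarith
  then show ?thesis by (rule power2_le_imp_le) simp
qed

section \<open>Estimate of the derivative\<close>

definition "H t = (norm2 (D t))\<^sup>2 + (m t)\<^sup>2"

text \<open>\<open>H\<close> collects what the L2 estimate makes integrable in time, and every term
  must be bounded by a multiple of it. With d = |D|, the quadratic term uses S^2 \<le> 2 |psi 0| d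
  and d \<le> 1 + d^2. The term ut1 psi goes through the weighted moment \<open>W\<close>, because
  the L2 norm of psi is only known to be bounded in time.\<close>

lemma Nx_square_bound:
  "\<exists>K>0. \<forall>t\<ge>0. (norm2 (Nx t))\<^sup>2 + (m t * norm2 ut1)\<^sup>2 \<le> K * ((1 + (norm2 (D t))\<^sup>2) * H t)"
proof -
  define E0 where "E0 = norm2 (psi 0)"
  \<comment> \<open>From q^2 \<le> \<open>C2\<close> q and W \<le> (1 + 5 eps / (4 A)) H, the latter
    being \<open>W_bound\<close> divided by A / 2.\<close>
  define c where "c = A\<^sup>2 * C2 * (1 + 5 / 4 * eps / A)"
  \<comment> \<open>The 3 comes from squaring a sum of three terms; the final 1 ensures K >
    0.\<close>
  define K where "K = 3 * (2 * E0 + M0\<^sup>2 + c) + (norm2 ut1)\<^sup>2 + 1"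
  have c: "c \<ge> 0" using A_pos C2_pos eps by (auto simp: c_def intro!: mult_nonneg_nonneg add_nonneg_nonneg)
  have E0: "E0 \<ge> 0" by (simp add: E0_def)
  have "(norm2 (Nx t))\<^sup>2 + (m t * norm2 ut1)\<^sup>2 \<le> K * ((1 + (norm2 (D t))\<^sup>2) * H t)" if t: "t \<ge> 0" for t
  proof -
    define d where "d = norm2 (D t)"
    define z where "z = norm2 (\<lambda>x. ut1 (x - s t) * psi t x)"
    have d: "d \<ge> 0" by (simp add: d_def)
    have H: "H t \<ge> d\<^sup>2" "H t \<ge> (m t)\<^sup>2" "H t \<ge> 0" by (simp_all add: H_def d_def)
    have zb: "z\<^sup>2 \<le> c * H t"
    proof -
      have q2: "q (x - s t) * (q (x - s t) * (psi t x)\<^sup>2) \<le> C2 * (q (x - s t) * (psi t x)\<^sup>2)" for x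
        using q_le[of "x - s t"] q_nonneg[of "x - s t"] by (intro mult_right_mono) auto
      have iq: "integrable lborel (\<lambda>x. q (x - s t) * (psi t x)\<^sup>2)"
        using L2_integrable_mult[OF q_psi_L2 psi_L2] by (simp add: power2_eq_square mult.assoc)
      have "z\<^sup>2 = (LBINT x. A\<^sup>2 * (q (x - s t) * (q (x - s t) * (psi t x)\<^sup>2)))"
        unfolding z_def norm2_power2 by (simp add: ut_y power2_eq_square mult_ac)
      also have "\<dots> \<le> (LBINT x. A\<^sup>2 * (C2 * (q (x - s t) * (psi t x)\<^sup>2)))"
      proof (rule integral_mono)
        show "integrable lborel (\<lambda>x. A\<^sup>2 * (q (x - s t) * (q (x - s t) * (psi t x)\<^sup>2)))"
          using L2_square_integrable[OF q_psi_L2, of t] by (intro integrable_mult_right) (simp add: power2_eq_square mult_ac)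
        show "integrable lborel (\<lambda>x. A\<^sup>2 * (C2 * (q (x - s t) * (psi t x)\<^sup>2)))" by (intro integrable_mult_right iq)
      qed (use q2 in \<open>auto intro!: mult_left_mono\<close>)
      also have "\<dots> = A\<^sup>2 * C2 * W t" by (simp add: W_def mult.assoc)
      also have "\<dots> \<le> A\<^sup>2 * C2 * ((1 + 5 / 4 * eps / A) * H t)"
      proof (rule mult_left_mono)
        have "A * W t \<le> A * ((m t)\<^sup>2 + 5 / 4 * eps / A * d\<^sup>2)"
          using W_bound[of t] A_pos by (simp add: d_def algebra_simps)
        then have "W t \<le> (m t)\<^sup>2 + 5 / 4 * eps / A * d\<^sup>2" using A_pos by simp
        also have "\<dots> \<le> H t + 5 / 4 * eps / A * H t"
          using H A_pos eps by (intro add_mono mult_left_mono) auto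
        finally show "W t \<le> (1 + 5 / 4 * eps / A) * H t" by (simp add: distrib_right)
      qed (use C2_pos in simp)
      finally show ?thesis by (simp add: c_def mult.assoc)
    qed
    have S2: "(S t)\<^sup>2 \<le> 2 * E0 * d"
    proof -
      have "(S t)\<^sup>2 = 2 * norm2 (psi t) * d" by (simp add: S_def d_def)
      also have "\<dots> \<le> 2 * E0 * d" using norm_psi_le[OF t] d by (intro mult_right_mono) (auto simp: E0_def)
      finally show ?thesis .
    qed
    have sq3: "(x + y + w)\<^sup>2 \<le> 3 * (x\<^sup>2 + y\<^sup>2 + w\<^sup>2)" for x y w :: real
    proof -
      have "3 * (x\<^sup>2 + y\<^sup>2 + w\<^sup>2) - (x + y + w)\<^sup>2 = (x - y)\<^sup>2 + (y - w)\<^sup>2 + (x - w)\<^sup>2"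
        by (simp add: power2_eq_square algebra_simps)
      then show ?thesis using zero_le_power2[of "x - y"] zero_le_power2[of "y - w"] zero_le_power2[of "x - w"] by linarith
    qed
    have "norm2 (Nx t) \<le> S t * d + M0 * d + z"
      using Nx_norm2[of t] by (simp add: d_def z_def distrib_right)
    then have "(norm2 (Nx t))\<^sup>2 \<le> (S t * d + M0 * d + z)\<^sup>2" by (intro power_mono) auto
    also have "\<dots> \<le> 3 * ((S t * d)\<^sup>2 + (M0 * d)\<^sup>2 + z\<^sup>2)" by (rule sq3)
    also have "\<dots> \<le> 3 * (2 * E0 * ((1 + d\<^sup>2) * H t) + M0\<^sup>2 * ((1 + d\<^sup>2) * H t) + c * ((1 + d\<^sup>2) * H t))"
    proof (intro mult_left_mono add_mono)
      have dd: "d \<le> 1 + d\<^sup>2" using sum_squares_bound[of 1 d] by (simp add: power2_eq_square) (smt (verit) d)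
      have "(S t * d)\<^sup>2 \<le> (2 * E0 * d) * d\<^sup>2" unfolding power_mult_distrib by (intro mult_right_mono S2) simp
      also have "\<dots> \<le> (2 * E0 * (1 + d\<^sup>2)) * H t"
        using dd d E0 H by (intro mult_mono mult_left_mono) auto
      finally show "(S t * d)\<^sup>2 \<le> 2 * E0 * ((1 + d\<^sup>2) * H t)" by (simp add: mult.assoc)
      have hh: "H t \<le> (1 + d\<^sup>2) * H t" using H by (simp add: distrib_right)
      have "(M0 * d)\<^sup>2 \<le> M0\<^sup>2 * H t" unfolding power_mult_distrib by (intro mult_left_mono H) simp
      also have "\<dots> \<le> M0\<^sup>2 * ((1 + d\<^sup>2) * H t)" by (intro mult_left_mono hh) simp
      finally show "(M0 * d)\<^sup>2 \<le> M0\<^sup>2 * ((1 + d\<^sup>2) * H t)" .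
      show "z\<^sup>2 \<le> c * ((1 + d\<^sup>2) * H t)" using zb mult_left_mono[OF hh c] by linarith
    qed simp
    also have "\<dots> = 3 * (2 * E0 + M0\<^sup>2 + c) * ((1 + d\<^sup>2) * H t)" by (simp add: algebra_simps)
    finally have 1: "(norm2 (Nx t))\<^sup>2 \<le> 3 * (2 * E0 + M0\<^sup>2 + c) * ((1 + d\<^sup>2) * H t)" .
    have "(m t * norm2 ut1)\<^sup>2 \<le> (norm2 ut1)\<^sup>2 * H t"
      using mult_right_mono[OF H(2), of "(norm2 ut1)\<^sup>2"] by (simp add: power_mult_distrib mult.commute)
    also have "\<dots> \<le> (norm2 ut1)\<^sup>2 * ((1 + d\<^sup>2) * H t)" using H by (intro mult_left_mono) (auto simp: distrib_right)
    finally have 2: "(m t * norm2 ut1)\<^sup>2 \<le> (norm2 ut1)\<^sup>2 * ((1 + d\<^sup>2) * H t)" .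
    have 3: "0 \<le> (1 + d\<^sup>2) * H t" using H by simp
    show ?thesis using 1 2 3 unfolding K_def d_def[symmetric] by (simp add: distrib_right)
  qed
  moreover have "K > 0" using E0 c unfolding K_def by (smt (verit) zero_le_power2)
  ultimately show ?thesis by blast
qed

text \<open>The energy identity is applied with the kernel \<open>deriv (mollifier n)\<close>, so
  that the mollified \<open>D\<close> appears. The second derivative p has no bound uniform in n;
  its products with \<open>Nx\<close> and m ut1 are absorbed by - eps |p|^2 before n tends to
  infinity.\<close>

lemma H1_energy:
  "\<exists>K>0. \<forall>a b. 0 \<le> a \<longrightarrow> a \<le> b \<longrightarrow> (norm2 (D b))\<^sup>2 - (norm2 (D a))\<^sup>2
    \<le> K * (LBINT t. indicator {a..b} t * ((1 + (norm2 (D t))\<^sup>2) * H t))"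
proof -
  obtain K where K: "K > 0" "\<And>t. t \<ge> 0 \<Longrightarrow> (norm2 (Nx t))\<^sup>2 + (m t * norm2 ut1)\<^sup>2 \<le> K * ((1 + (norm2 (D t))\<^sup>2) * H t)"
    using Nx_square_bound by blast
  have "(norm2 (D b))\<^sup>2 - (norm2 (D a))\<^sup>2 \<le> K / eps * (LBINT t. indicator {a..b} t * ((1 + (norm2 (D t))\<^sup>2) * H t))"
    if ab: "0 \<le> a" "a \<le> b" for a b
  proof (rule LIMSEQ_le_const2)
    show "(\<lambda>n. (norm2 (conv (D b) (mollifier n)))\<^sup>2 - (norm2 (conv (D a) (mollifier n)))\<^sup>2)
        \<longlonglongrightarrow> (norm2 (D b))\<^sup>2 - (norm2 (D a))\<^sup>2"
      by (intro tendsto_intros norm2_mollifier_tendsto D_L2)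
    have "(norm2 (conv (D b) (mollifier n)))\<^sup>2 - (norm2 (conv (D a) (mollifier n)))\<^sup>2
        \<le> K / eps * (LBINT t. indicator {a..b} t * ((1 + (norm2 (D t))\<^sup>2) * H t))" for n
    proof -
      define k where "k = deriv (mollifier n)"
      have k: "test_fun k" unfolding k_def by (intro test_fun_deriv mollifier)
      have Dk: "conv (psi t) k = conv (D t) (mollifier n)" for t
        using conv_weak_deriv[OF D_weak mollifier(1)] by (auto simp: k_def)
      have pt: "2 * (LBINT x. conv (psi t) k x * R k t x) \<le> K / eps * ((1 + (norm2 (D t))\<^sup>2) * H t)" if t: "t \<ge> 0" for t
      proof -
        let ?p = "conv (psi t) (deriv k)"
        let ?N = "conv (Nx t) (mollifier n)" and ?u = "conv (\<lambda>x. ut1 (x - s t)) (mollifier n)"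
        have pL: "L2 ?p" by (intro L2_conv psi_L2 test_fun_deriv k)
        have NL: "L2 ?N" by (intro L2_conv Nx_L2 mollifier)
        have uL: "L2 ?u" by (intro L2_conv ut1_s_L2 mollifier)
        have 1: "(LBINT x. conv (psi t) k x * conv (N t) (deriv k) x) = - (LBINT x. ?p x * ?N x)"
          using conv_IBP[OF psi_L2 N_L2 k k, of t t] conv_weak_deriv[OF N_weak mollifier(1), of t n] by (simp add: k_def)
        have 2: "(LBINT x. conv (psi t) k x * conv (\<lambda>x. ut1 (x - s t)) k x) = - (LBINT x. ?p x * ?u x)"
          using conv_IBP[OF psi_L2 ut1_s_L2 k mollifier(1), of t t n] by (simp add: k_def)
        have "(LBINT x. conv (psi t) k x * R k t x) = (LBINT x. ?p x * ?N x) - eps * (norm2 ?p)\<^sup>2 - m t * (LBINT x. ?p x * ?u x)"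
          unfolding production_eq[OF k] 1 2 by simp
        also have "\<dots> \<le> norm2 ?p * norm2 (Nx t) - eps * (norm2 ?p)\<^sup>2 + norm2 ?p * \<bar>m t * norm2 ut1\<bar>"
        proof -
          have "\<bar>LBINT x. ?p x * ?N x\<bar> \<le> norm2 ?p * norm2 (Nx t)"
            using Cauchy_Schwarz_L2[OF pL NL] mult_left_mono[OF norm2_conv_mollifier[OF Nx_L2[of t], of n] norm2_nonneg[of ?p]] by linarith
          moreover have "\<bar>m t * (LBINT x. ?p x * ?u x)\<bar> \<le> norm2 ?p * \<bar>m t * norm2 ut1\<bar>"
          proof -
            have "norm2 ?u \<le> norm2 ut1" using norm2_conv_mollifier[OF ut1_s_L2, of t n] by (simp add: norm2_shift)
            then have "\<bar>LBINT x. ?p x * ?u x\<bar> \<le> norm2 ?p * norm2 ut1"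
              using Cauchy_Schwarz_L2[OF pL uL] mult_left_mono[of "norm2 ?u" "norm2 ut1" "norm2 ?p"] by simp
            from mult_left_mono[OF this abs_ge_zero[of "m t"]] show ?thesis by (simp add: abs_mult mult_ac)
          qed
          ultimately show ?thesis by linarith
        qed
        also have "\<dots> \<le> ((norm2 (Nx t))\<^sup>2 + (m t * norm2 ut1)\<^sup>2) / (2 * eps)"
        proof -
          \<comment> \<open>Young's inequality with weight eps / 2: applied twice, it consumes
            exactly the dissipation eps |p|^2.\<close>
          have am: "p * z \<le> eps / 2 * p\<^sup>2 + z\<^sup>2 / (2 * eps)" for p z :: real
          proof -
            have "0 \<le> (eps * p - z)\<^sup>2 / (2 * eps)" using eps by simp
            also have "\<dots> = eps / 2 * p\<^sup>2 + z\<^sup>2 / (2 * eps) - p * z"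
              using eps by (simp add: power2_eq_square field_simps)
            finally show ?thesis by simp
          qed
          have "(\<bar>m t * norm2 ut1\<bar>)\<^sup>2 = (m t * norm2 ut1)\<^sup>2" by simp
          then show ?thesis
            using am[of "norm2 ?p" "norm2 (Nx t)"] am[of "norm2 ?p" "\<bar>m t * norm2 ut1\<bar>"] by (simp add: add_divide_distrib)
        qed
        also have "\<dots> \<le> K * ((1 + (norm2 (D t))\<^sup>2) * H t) / (2 * eps)"
          using K(2)[OF t] eps by (intro divide_right_mono) auto
        finally show ?thesis by simp
      qed
      have "(norm2 (conv (psi b) k))\<^sup>2 - (norm2 (conv (psi a) k))\<^sup>2
          = (LBINT t. indicator {a..b} t * (2 * (LBINT x. conv (psi t) k x * R k t x)))"
        by (rule energy_conv(2)[OF k ab])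
      also have "\<dots> \<le> (LBINT t. K / eps * (indicator {a..b} t * ((1 + (norm2 (D t))\<^sup>2) * H t)))"
      proof (rule integral_mono[OF energy_conv(1)[OF k ab]])
        have "set_integrable lborel {a..b} (\<lambda>t. (1 + (norm2 (D t))\<^sup>2) * H t)"
          unfolding H_def
          by (intro borel_integrable_atLeastAtMost' continuous_intros continuous_on_subset[OF m_cont] continuous_on_subset[OF norm_D_cont]) auto
        then show "integrable lborel (\<lambda>t. K / eps * (indicator {a..b} t * ((1 + (norm2 (D t))\<^sup>2) * H t)))"
          by (intro integrable_mult_right) (simp add: set_integrable_def)
        show "indicator {a..b} t * (2 * (LBINT x. conv (psi t) k x * R k t x))
            \<le> K / eps * (indicator {a..b} t * ((1 + (norm2 (D t))\<^sup>2) * H t))" for t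
          using pt[of t] ab by (cases "t \<in> {a..b}") auto
      qed
      also have "\<dots> = K / eps * (LBINT t. indicator {a..b} t * ((1 + (norm2 (D t))\<^sup>2) * H t))"
        by (rule integral_mult_right_zero)
      finally show ?thesis by (simp only: Dk)
    qed
    then show "\<exists>N. \<forall>n\<ge>N. (norm2 (conv (D b) (mollifier n)))\<^sup>2 - (norm2 (conv (D a) (mollifier n)))\<^sup>2
        \<le> K / eps * (LBINT t. indicator {a..b} t * ((1 + (norm2 (D t))\<^sup>2) * H t))" by blast
  qed
  then show ?thesis using K(1) eps by (intro exI[of _ "K / eps"]) auto
qed

section \<open>Decay in time\<close>

lemma D_tendsto_0: "((\<lambda>t. norm2 (D t)) \<longlongrightarrow> 0) at_top"
proof -
  obtain K where K: "K > 0" "\<And>a b. 0 \<le> a \<Longrightarrow> a \<le> b \<Longrightarrow> (norm2 (D b))\<^sup>2 - (norm2 (D a))\<^sup>2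
    \<le> K * (LBINT t. indicator {a..b} t * ((1 + (norm2 (D t))\<^sup>2) * H t))"
    using H1_energy by blast
  \<comment> \<open>The smaller of the two dissipation coefficients, so that c times the time
    integral of \<open>H\<close> is bounded by the initial energy.\<close>
  define c where "c = min A (3 / 4 * eps)"
  have c: "c > 0" using A_pos eps by (simp add: c_def)
  have "((\<lambda>t. (norm2 (D t))\<^sup>2) \<longlongrightarrow> 0) at_top"
  proof (rule integral_Gronwall_decay[where h=H and K=K and B="(norm2 (psi 0))\<^sup>2 / c"])
    show "continuous_on UNIV H" unfolding H_def by (intro continuous_intros m_cont norm_D_cont)
    fix T :: real assume T: "T \<ge> 0"
    have i: "integrable lborel (\<lambda>t. indicator {0..T} t * (x * (m t)\<^sup>2 + y * (norm2 (D t))\<^sup>2))" for x y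
    proof -
      have "set_integrable lborel {0..T} (\<lambda>t. x * (m t)\<^sup>2 + y * (norm2 (D t))\<^sup>2)"
        by (intro borel_integrable_atLeastAtMost' continuous_intros continuous_on_subset[OF m_cont] continuous_on_subset[OF norm_D_cont]) auto
      then show ?thesis by (simp add: set_integrable_def)
    qed
    have "c * (LBINT t. indicator {0..T} t * H t) = (LBINT t. c * (indicator {0..T} t * H t))" by simp
    also have "\<dots> = (LBINT t. indicator {0..T} t * (c * (m t)\<^sup>2 + c * (norm2 (D t))\<^sup>2))"
      by (simp add: H_def algebra_simps)
    also have "\<dots> \<le> (LBINT t. indicator {0..T} t * (A * (m t)\<^sup>2 + 3 / 4 * eps * (norm2 (D t))\<^sup>2))"
    proof (rule integral_mono[OF i i])
      have "c \<le> A" "c \<le> 3 / 4 * eps" by (simp_all add: c_def)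
      then show "indicator {0..T} t * (c * (m t)\<^sup>2 + c * (norm2 (D t))\<^sup>2)
          \<le> indicator {0..T} t * (A * (m t)\<^sup>2 + 3 / 4 * eps * (norm2 (D t))\<^sup>2)" for t
        by (intro mult_left_mono add_mono mult_right_mono) auto
    qed
    also have "\<dots> \<le> (norm2 (psi 0))\<^sup>2" using L2_energy[OF order_refl T] zero_le_power2[of "norm2 (psi T)"] by linarith
    finally show "(LBINT t. indicator {0..T} t * H t) \<le> (norm2 (psi 0))\<^sup>2 / c"
      using c by (simp add: pos_le_divide_eq mult.commute)
  qed (use K in \<open>auto simp: H_def intro!: continuous_intros norm_D_cont\<close>)
  from tendsto_real_sqrt[OF this] show ?thesis by simp
qed

lemma S_tendsto_0: "(S \<longlongrightarrow> 0) at_top"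
proof -
  have "((\<lambda>t. sqrt (2 * norm2 (psi 0) * norm2 (D t))) \<longlongrightarrow> sqrt (2 * norm2 (psi 0) * 0)) at_top"
    by (intro tendsto_intros D_tendsto_0)
  then have lim: "((\<lambda>t. sqrt (2 * norm2 (psi 0) * norm2 (D t))) \<longlongrightarrow> 0) at_top" by simp
  show ?thesis
  proof (rule tendsto_sandwich[OF _ _ tendsto_const lim])
    show "\<forall>\<^sub>F t in at_top. 0 \<le> S t" by (simp add: S_nonneg)
    show "\<forall>\<^sub>F t in at_top. S t \<le> sqrt (2 * norm2 (psi 0) * norm2 (D t))"
      using eventually_ge_at_top[of "0::real"]
    proof eventually_elim
      case (elim t)
      then show ?case unfolding S_def using norm_psi_le[OF elim] by (intro real_sqrt_le_mono mult_right_mono) auto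
    qed
  qed
qed

text \<open>q(x - s t) is a probability density, so the mean of psi against it is bounded by the sup
  norm.\<close>

lemma m_bound: "\<bar>m t\<bar> \<le> S t"
proof -
  have qi: "integrable lborel (\<lambda>x. q (x - s t))"
    using lborel_integrable_real_affine[OF q_integrable, of 1 "- s t"] by simp
  have "\<bar>m t\<bar> \<le> (LBINT x. \<bar>psi t x * q (x - s t)\<bar>)" unfolding m_def by (rule integral_abs_bound)
  also have "\<dots> \<le> (LBINT x. S t * q (x - s t))"
  proof (rule integral_mono_AE)
    show "integrable lborel (\<lambda>x. \<bar>psi t x * q (x - s t)\<bar>)"
      by (intro integrable_abs L2_integrable_mult psi_L2 L2_shift q_L2)
    show "integrable lborel (\<lambda>x. S t * q (x - s t))" by (intro integrable_mult_right qi)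
    show "AE x in lborel. \<bar>psi t x * q (x - s t)\<bar> \<le> S t * q (x - s t)"
      using psi_sup by eventually_elim (auto simp: abs_mult q_nonneg intro!: mult_right_mono)
  qed
  also have "\<dots> = S t" by (simp add: lborel_integral_shift q_integral)
  finally show ?thesis .
qed

text \<open>Interpolation: |psi|^p \<le> S^(p - 2) psi^2, where the L2 norm stays below its initial
  value and the positive exponent p - 2 makes the first factor decay.\<close>

lemma Lp_tendsto_0:
  assumes p: "2 < p"
  shows "((\<lambda>t. \<integral>\<^sup>+x. ennreal (\<bar>psi t x\<bar> powr p) \<partial>lborel) \<longlongrightarrow> 0) at_top"
proof (rule tendsto_sandwich[OF _ _ tendsto_const])
  have bound: "(\<integral>\<^sup>+x. ennreal (\<bar>psi t x\<bar> powr p) \<partial>lborel) \<le> ennreal (S t powr (p - 2) * (norm2 (psi 0))\<^sup>2)" if t: "t \<ge> 0" for t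
  proof -
    have "(\<integral>\<^sup>+x. ennreal (\<bar>psi t x\<bar> powr p) \<partial>lborel) \<le> (\<integral>\<^sup>+x. ennreal (S t powr (p - 2)) * ennreal ((psi t x)\<^sup>2) \<partial>lborel)"
    proof (rule nn_integral_mono_AE)
      show "AE x in lborel. ennreal (\<bar>psi t x\<bar> powr p) \<le> ennreal (S t powr (p - 2)) * ennreal ((psi t x)\<^sup>2)"
        using psi_sup[of t]
      proof eventually_elim
        case (elim x)
        have "\<bar>psi t x\<bar> powr p = \<bar>psi t x\<bar> powr (p - 2) * \<bar>psi t x\<bar> powr 2" by (simp only: powr_add[symmetric]) simp
        also have "\<dots> \<le> S t powr (p - 2) * (psi t x)\<^sup>2"
          using elim p by (intro mult_mono powr_mono2) (auto simp: powr_numeral)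
        finally show ?case by (simp add: ennreal_mult[symmetric] ennreal_leI)
      qed
    qed
    also have "\<dots> = ennreal (S t powr (p - 2)) * ennreal ((norm2 (psi t))\<^sup>2)"
      by (subst nn_integral_cmult) (simp_all add: L2_nn_integral[OF psi_L2])
    also have "\<dots> = ennreal (S t powr (p - 2) * (norm2 (psi t))\<^sup>2)" by (simp add: ennreal_mult)
    also have "\<dots> \<le> ennreal (S t powr (p - 2) * (norm2 (psi 0))\<^sup>2)"
      by (intro ennreal_leI mult_left_mono power_mono norm_psi_le t) auto
    finally show ?thesis .
  qed
  show "\<forall>\<^sub>F t in at_top. (\<integral>\<^sup>+x. ennreal (\<bar>psi t x\<bar> powr p) \<partial>lborel) \<le> ennreal (S t powr (p - 2) * (norm2 (psi 0))\<^sup>2)"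
    using eventually_ge_at_top[of "0::real"] by eventually_elim (rule bound)
  have "((\<lambda>t. S t powr (p - 2)) \<longlongrightarrow> 0) at_top"
    using tendsto_powr'[OF S_tendsto_0 tendsto_const[of "p - 2"]] p S_nonneg by simp
  then have "((\<lambda>t. S t powr (p - 2) * (norm2 (psi 0))\<^sup>2) \<longlongrightarrow> 0 * (norm2 (psi 0))\<^sup>2) at_top" by (intro tendsto_intros)
  from tendsto_ennrealI[OF this]
  show "((\<lambda>t. ennreal (S t powr (p - 2) * (norm2 (psi 0))\<^sup>2)) \<longlongrightarrow> 0) at_top" by simp
qed simp

lemma esssup_tendsto_0: "((\<lambda>t. esssup lborel (\<lambda>x. ereal \<bar>psi t x\<bar>)) \<longlongrightarrow> 0) at_top"
proof (rule tendsto_sandwich[OF _ _ tendsto_const])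
  have "0 \<le> esssup lborel (\<lambda>x. ereal \<bar>psi t x\<bar>)" for t
  proof -
    have "esssup lborel (\<lambda>x::real. 0 :: ereal) = 0" by (rule esssup_const) simp
    moreover have "esssup lborel (\<lambda>x::real. 0 :: ereal) \<le> esssup lborel (\<lambda>x. ereal \<bar>psi t x\<bar>)"
      by (rule esssup_mono) auto
    ultimately show ?thesis by simp
  qed
  then show "\<forall>\<^sub>F t in at_top. 0 \<le> esssup lborel (\<lambda>x. ereal \<bar>psi t x\<bar>)" by simp
  have "esssup lborel (\<lambda>x. ereal \<bar>psi t x\<bar>) \<le> ereal (S t)" for t
    by (rule esssup_I) (use psi_sup in auto)
  then show "\<forall>\<^sub>F t in at_top. esssup lborel (\<lambda>x. ereal \<bar>psi t x\<bar>) \<le> ereal (S t)" by simp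
  show "((\<lambda>t. ereal (S t)) \<longlongrightarrow> 0) at_top" using S_tendsto_0 by (simp add: zero_ereal_def)
qed

text \<open>Any family w of weak derivatives agrees almost everywhere in x with \<open>D\<close>, so
  the extended-valued integrals are finite and the claim reduces to the L2 estimate.\<close>

lemma contraction:
  assumes T: "T \<ge> 0" and w: "\<And>t. t \<ge> 0 \<Longrightarrow> weak_deriv (psi t) (w t)"
  shows "(\<integral>\<^sup>+x. ennreal ((psi T x)\<^sup>2) \<partial>lborel)
     + ennreal ((2 * sqrt 2 - 5 / 2) * eps) * (\<integral>\<^sup>+t. indicator {0..T} t * (\<integral>\<^sup>+x. ennreal ((w t x)\<^sup>2) \<partial>lborel) \<partial>lborel)
    \<le> (\<integral>\<^sup>+x. ennreal ((u0 x - ut x)\<^sup>2) \<partial>lborel)"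
proof -
  define I where "I = (LBINT t. indicator {0..T} t * (norm2 (D t))\<^sup>2)"
  \<comment> \<open>The bounds 5/4 \<le> sqrt 2 \<le> 13/8 put the constant between 0 and the
    available 3/4; nonnegativity is what \<open>ennreal\<close> needs to preserve it.\<close>
  have Cs: "0 \<le> 2 * sqrt 2 - 5 / 2" "2 * sqrt 2 - 5 / 2 \<le> 3 / 4"
  proof -
    have "sqrt 2 \<ge> 5 / 4" by (rule real_le_rsqrt) (simp add: power2_eq_square)
    moreover have "sqrt 2 \<le> 13 / 8" by (rule real_le_lsqrt) (auto simp: power2_eq_square)
    ultimately show "0 \<le> 2 * sqrt 2 - 5 / 2" "2 * sqrt 2 - 5 / 2 \<le> 3 / 4" by simp_all
  qed
  have i: "integrable lborel (\<lambda>t. indicator {0..T} t * (x * (m t)\<^sup>2 + y * (norm2 (D t))\<^sup>2))" for x y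
  proof -
    have "set_integrable lborel {0..T} (\<lambda>t. x * (m t)\<^sup>2 + y * (norm2 (D t))\<^sup>2)"
      by (intro borel_integrable_atLeastAtMost' continuous_intros continuous_on_subset[OF m_cont] continuous_on_subset[OF norm_D_cont]) auto
    then show ?thesis by (simp add: set_integrable_def)
  qed
  have I0: "I \<ge> 0" unfolding I_def by (intro integral_nonneg_AE AE_I2) auto
  have wn: "(\<integral>\<^sup>+x. ennreal ((w t x)\<^sup>2) \<partial>lborel) = ennreal ((norm2 (D t))\<^sup>2)" if "t \<ge> 0" for t
  proof -
    have "(\<integral>\<^sup>+x. ennreal ((w t x)\<^sup>2) \<partial>lborel) = (\<integral>\<^sup>+x. ennreal ((D t x)\<^sup>2) \<partial>lborel)"
      by (rule nn_integral_cong_AE) (use weak_deriv_unique[OF w[OF that] D_weak] in eventually_elim, simp)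
    then show ?thesis by (simp add: L2_nn_integral[OF D_L2])
  qed
  have "(\<integral>\<^sup>+t. indicator {0..T} t * (\<integral>\<^sup>+x. ennreal ((w t x)\<^sup>2) \<partial>lborel) \<partial>lborel)
      = (\<integral>\<^sup>+t. ennreal (indicator {0..T} t * (norm2 (D t))\<^sup>2) \<partial>lborel)"
    by (rule nn_integral_cong) (auto simp: indicator_def wn)
  also have "\<dots> = ennreal I"
    unfolding I_def using i[of 0 1] by (intro nn_integral_eq_integral) auto
  finally have 1: "(\<integral>\<^sup>+t. indicator {0..T} t * (\<integral>\<^sup>+x. ennreal ((w t x)\<^sup>2) \<partial>lborel) \<partial>lborel) = ennreal I" .
  have "3 / 4 * eps * I = (LBINT t. indicator {0..T} t * (0 * (m t)\<^sup>2 + 3 / 4 * eps * (norm2 (D t))\<^sup>2))"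
    unfolding I_def by (subst integral_mult_right_zero[symmetric]) (simp add: mult_ac)
  also have "\<dots> \<le> (LBINT t. indicator {0..T} t * (A * (m t)\<^sup>2 + 3 / 4 * eps * (norm2 (D t))\<^sup>2))"
    using A_pos by (intro integral_mono i) (auto simp: indicator_def)
  finally have "3 / 4 * eps * I \<le> (norm2 (psi 0))\<^sup>2 - (norm2 (psi T))\<^sup>2" using L2_energy[OF order_refl T] by linarith
  moreover have "(2 * sqrt 2 - 5 / 2) * eps * I \<le> 3 / 4 * eps * I"
    using Cs eps I0 by (intro mult_right_mono) auto
  ultimately have 2: "(norm2 (psi T))\<^sup>2 + (2 * sqrt 2 - 5 / 2) * eps * I \<le> (norm2 (psi 0))\<^sup>2" by linarith
  have ae: "AE x in lborel. u 0 x = u0 x" using sol unfolding kdvb_solution_def by blast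
  have "(\<integral>\<^sup>+x. ennreal ((u0 x - ut x)\<^sup>2) \<partial>lborel) = (\<integral>\<^sup>+x. ennreal ((psi 0 x)\<^sup>2) \<partial>lborel)"
    by (rule nn_integral_cong_AE) (use ae in eventually_elim, simp add: psi_def s0)
  then have 3: "(\<integral>\<^sup>+x. ennreal ((u0 x - ut x)\<^sup>2) \<partial>lborel) = ennreal ((norm2 (psi 0))\<^sup>2)"
    by (simp add: L2_nn_integral[OF psi_L2])
  have "(\<integral>\<^sup>+x. ennreal ((psi T x)\<^sup>2) \<partial>lborel) + ennreal ((2 * sqrt 2 - 5 / 2) * eps) * ennreal I
      = ennreal ((norm2 (psi T))\<^sup>2 + (2 * sqrt 2 - 5 / 2) * eps * I)"
    using Cs eps I0 by (simp add: L2_nn_integral[OF psi_L2] ennreal_mult ennreal_plus del: ennreal_plus[symmetric])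
  also have "\<dots> \<le> ennreal ((norm2 (psi 0))\<^sup>2)" by (rule ennreal_leI[OF 2])
  finally show ?thesis unfolding 1 3 .
qed

end

theorem theorem1p1:
  fixes eps delta um up :: real
    and ut ubar u0 X :: "real \<Rightarrow> real"
    and u :: "real \<Rightarrow> real \<Rightarrow> real"
  defines "\<sigma> \<equiv> (um + up) / 2"
    and "Cstar \<equiv> 2 * sqrt 2 - 5 / 2"
    and "Xdot \<equiv> (\<lambda>t. - (1 / (um - up)) *
            (\<integral>x. (u t (x + X t) - ut (x - (um + up) / 2 * t)) * deriv ut (x - (um + up) / 2 * t) \<partial>lborel))"
  assumes eps: "eps > 0" and delta: "delta > 0" and ums: "um > up"
    and small1: "0 < delta * (um - up) / (2 * eps^2)"
    and small2: "delta * (um - up) / (2 * eps^2) \<le> 1 / 4"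
    and shock: "vd_shock eps delta um up ut"
    and shock_mono: "mono ut \<or> antimono ut"
    and ubar_smooth: "smooth_fun ubar"
    and ubar_mono: "mono ubar \<or> antimono ubar"
    and ubar_left: "\<forall>x \<le> -1. ubar x = um"
    and ubar_right: "\<forall>x \<ge> 1. ubar x = up"
    and init: "H1 (\<lambda>x. u0 x - ut x)"
    and sol: "kdvb_solution eps delta u0 u"
    and space: "\<forall>T > 0. in_XT T ubar u"
    and X_lip: "\<exists>L. L-lipschitz_on {0..} X"
    and X0: "X 0 = 0"
    and X_ode: "AE t in lborel. t > 0 \<longrightarrow> (X has_real_derivative Xdot t) (at t)"
  shows "(\<forall>T > 0. \<forall>w :: real \<Rightarrow> real \<Rightarrow> real.
            ((\<forall>t \<ge> 0. weak_deriv (\<lambda>x. u t x - ut (x - \<sigma> * t - X t)) (w t)) \<and>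
             (\<lambda>(t, x). w t x) \<in> borel_measurable (lborel \<Otimes>\<^sub>M lborel)) \<longrightarrow>
            (\<integral>\<^sup>+ x. ennreal ((u T x - ut (x - \<sigma> * T - X T))^2) \<partial>lborel)
              + ennreal (Cstar * eps) *
                (\<integral>\<^sup>+ t. indicator {0..T} t * (\<integral>\<^sup>+ x. ennreal ((w t x)^2) \<partial>lborel) \<partial>lborel)
            \<le> (\<integral>\<^sup>+ x. ennreal ((u0 x - ut x)^2) \<partial>lborel))
       \<and> (\<forall>p :: real. 2 < p \<longrightarrow>
            ((\<lambda>t. \<integral>\<^sup>+ x. ennreal (\<bar>u t x - ut (x - \<sigma> * t - X t)\<bar> powr p) \<partial>lborel)
               \<longlongrightarrow> 0) at_top)
       \<and> ((\<lambda>t. esssup lborel (\<lambda>x. ereal \<bar>u t x - ut (x - \<sigma> * t - X t)\<bar>)) \<longlongrightarrow> 0) at_top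
       \<and> ((\<lambda>t. \<bar>Xdot t\<bar>) \<longlongrightarrow> 0) at_top"
proof -
  interpret P: shock_perturbation eps delta um up ut ubar u0 X u
    by unfold_locales
      (use eps delta ums small2 shock shock_mono ubar_smooth ubar_left ubar_right sol space X_lip X0 X_ode
        in \<open>auto simp: Xdot_def\<close>)
  have psi: "P.psi t = (\<lambda>x. u t x - ut (x - \<sigma> * t - X t))" if "t \<ge> 0" for t
    using that by (auto simp: P.psi_def P.s_def P.\<sigma>_def \<sigma>_def diff_diff_eq)
  have ev: "\<forall>\<^sub>F t in at_top. P.psi t = (\<lambda>x. u t x - ut (x - \<sigma> * t - X t))"
    using eventually_ge_at_top[of "0::real"] by eventually_elim (rule psi)
  have "(\<integral>\<^sup>+ x. ennreal ((u T x - ut (x - \<sigma> * T - X T))^2) \<partial>lborel)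
              + ennreal (Cstar * eps) *
                (\<integral>\<^sup>+ t. indicator {0..T} t * (\<integral>\<^sup>+ x. ennreal ((w t x)^2) \<partial>lborel) \<partial>lborel)
            \<le> (\<integral>\<^sup>+ x. ennreal ((u0 x - ut x)^2) \<partial>lborel)"
    if "T > 0" and w: "\<forall>t \<ge> 0. weak_deriv (\<lambda>x. u t x - ut (x - \<sigma> * t - X t)) (w t)" for T w
    using P.contraction[of T w] that psi by (simp add: Cstar_def)
  moreover have "((\<lambda>t. \<integral>\<^sup>+ x. ennreal (\<bar>u t x - ut (x - \<sigma> * t - X t)\<bar> powr p) \<partial>lborel) \<longlongrightarrow> 0) at_top"
    if "2 < p" for p
    by (rule Lim_transform_eventually[OF P.Lp_tendsto_0[OF that]])
      (use ev in eventually_elim, simp)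
  moreover have "((\<lambda>t. esssup lborel (\<lambda>x. ereal \<bar>u t x - ut (x - \<sigma> * t - X t)\<bar>)) \<longlongrightarrow> 0) at_top"
    by (rule Lim_transform_eventually[OF P.esssup_tendsto_0]) (use ev in eventually_elim, simp)
  \<comment> \<open>For t \<ge> 0 the velocity of the shift is the weighted mean \<open>P.m\<close>,
    bounded by the decaying \<open>P.S\<close>.\<close>
  moreover have "((\<lambda>t. \<bar>Xdot t\<bar>) \<longlongrightarrow> 0) at_top"
  proof (rule tendsto_sandwich[OF _ _ tendsto_const P.S_tendsto_0])
    show "\<forall>\<^sub>F t in at_top. \<bar>Xdot t\<bar> \<le> P.S t"
      using eventually_ge_at_top[of "0::real"]
      by eventually_elim (use P.Xdot_eq P.m_bound in \<open>auto simp: Xdot_def\<close>)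
  qed simp
  ultimately show ?thesis by blast
qed

end
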